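(* The bigraded ring $J^{\mathrm{w},W(E_8)}_{*,E_8,*}=\bigoplus_{t\ge0}\bigoplus_{k\in\mathbb Z}J^{\mathrm{w},W(E_8)}_{k,E_8,t}$ is not a polynomial algebra over $M_*$; that is, there is no set $S$ of elements of it, algebraically independent over $M_*$, such that $J^{\mathrm{w},W(E_8)}_{*,E_8,*}=M_*[S]$.
   Context: Let $(\cdot,\cdot)$ be the standard scalar product on $\mathbb R^8$ and $E_8=\{x\in\frac12\mathbb Z^8: x_1\equiv\cdots\equiv x_8 \bmod 1,\ \sum x_i\equiv 0 \bmod 2\}$; $W(E_8)$ its Weyl group acting on $\mathbb C^8$. Put $q=e^{2\pi i\tau}$. A $W(E_8)$-invariant weak Jacobi form of weight $k\in\mathbb Z$ and index $t\in\mathbb N$ is a holomorphic $\varphi:\mathbb H\times\mathbb C^8\to\mathbb C$ invariant under $\mathfrak z\mapsto\sigma\mathfrak z$ for $\sigma\in W(E_8)$, with $\varphi(\tau,\mathfrak z+x\tau+y)=\exp(-t\pi i[(x,x)\tau+2(x,\mathfrak z)])\varphi(\tau,\mathfrak z)$ ($x,y\in E_8$), $\varphi(\frac{a\tau+b}{c\tau+d},\frac{\mathfrak z}{c\tau+d})=(c\tau+d)^k\exp(t\pi i\frac{c(\mathfrak z,\mathfrak z)}{c\tau+d})\varphi(\tau,\mathfrak z)$ for $\begin{pmatrix}a&b\\c&d\end{pmatrix}\in SL_2(\mathbb Z)$, and Fourier expansion $\sum_{n\ge0}\sum_{\ell\in E_8}f(n,\ell)q^ne^{2\pi i(\ell,\mathfrak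 z)}$; the space is $J^{\mathrm{w},W(E_8)}_{k,E_8,t}$. $M_*=\mathbb C[E_4,E_6]$ is the ring of holomorphic modular forms for $SL_2(\mathbb Z)$. *)

theory Defs
  imports
    "HOL-Analysis.Analysis"
    "HOL-Library.Poly_Mapping"
    "HOL-Library.Function_Algebras"
    "HOL-Library.Product_Plus"
begin

section \<open>The upper half-plane\<close>

typedef uhp = "{\<tau>::complex. Im \<tau> > 0}"
  by (rule exI[of _ \<i>]) simp

definition mobius :: "int \<Rightarrow> int \<Rightarrow> int \<Rightarrow> int \<Rightarrow> uhp \<Rightarrow> uhp" where
  "mobius a b c d \<tau> =
     Abs_uhp ((of_int a * Rep_uhp \<tau> + of_int b) / (of_int c * Rep_uhp \<tau> + of_int d))"

lemma Im_mobius_pos: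
  fixes w :: complex
  assumes "a * d - b * c = 1" and "Im w > 0"
  shows "Im ((of_int a * w + of_int b) / (of_int c * w + of_int d)) > 0"
proof -
  have ne: "of_int c * w + of_int d \<noteq> 0"
  proof
    assume z: "of_int c * w + of_int d = 0"
    from z have "Im (of_int c * w + of_int d) = 0" by simp
    then have c: "c = 0" using assms(2) by simp
    with z have "d = 0" by simp
    with c assms(1) show False by simp
  qed
  have det: "of_int a * of_int d - of_int b * of_int c = (1::real)"
    using assms(1) by (metis of_int_1 of_int_diff of_int_mult)
  have "Im ((of_int a * w + of_int b) / (of_int c * w + of_int d)) =
      (of_int a * of_int d - of_int b * of_int c) * Im w / (cmod (of_int c * w + of_int d))\<^sup>2"
    unfolding Im_divide cmod_power2 by (simp add: algebra_simps)
  then show ?thesis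
    using det ne assms(2) by simp
qed

lemma Rep_mobius:
  assumes "a * d - b * c = 1"
  shows "Rep_uhp (mobius a b c d \<tau>) =
    (of_int a * Rep_uhp \<tau> + of_int b) / (of_int c * Rep_uhp \<tau> + of_int d)"
  unfolding mobius_def
  by (rule Abs_uhp_inverse) (use Im_mobius_pos[OF assms] Rep_uhp[of \<tau>] in simp)


section \<open>The lattice and its Weyl group\<close>

definition E8 :: "(real^8) set" where
  "E8 = {x. (\<forall>i. 2 * x $ i \<in> \<int>) \<and> (\<forall>i j. x $ i - x $ j \<in> \<int>) \<and>
            (\<exists>m::int. (\<Sum>i\<in>UNIV. x $ i) = 2 * of_int m)}"

definition cvec :: "real^8 \<Rightarrow> complex^8" where
  "cvec x = (\<chi> i. complex_of_real (x $ i))"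

text \<open>The bilinear (not Hermitian) extension of the scalar product.\<close>

definition cdot :: "complex^8 \<Rightarrow> complex^8 \<Rightarrow> complex" where
  "cdot z w = (\<Sum>i\<in>UNIV. z $ i * w $ i)"

text \<open>The complex-linear extension of the reflection in a root \<open>r\<close> with \<open>(r, r) = 2\<close>.\<close>

definition reflection :: "real^8 \<Rightarrow> complex^8 \<Rightarrow> complex^8" where
  "reflection r z = z - cdot (cvec r) z *s cvec r"

text \<open>The reflections are involutions, so the monoid they generate is a group.\<close>

inductive_set weyl_E8 :: "(complex^8 \<Rightarrow> complex^8) set" where
  id: "id \<in> weyl_E8"
| refl: "\<sigma> \<in> weyl_E8 \<Longrightarrow> r \<in> E8 \<Longrightarrow> r \<bullet> r = 2 \<Longrightarrow> reflection r \<circ> \<sigma> \<in> weyl_E8"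


section \<open>Modular forms and weak Jacobi forms\<close>

text \<open>Modular forms for the full modular group, holomorphic at the cusp.\<close>

definition modular_form :: "int \<Rightarrow> (uhp \<Rightarrow> complex) \<Rightarrow> bool" where
  "modular_form k f \<longleftrightarrow>
     (\<lambda>w. f (Abs_uhp w)) holomorphic_on {w. Im w > 0} \<and>
     (\<forall>a b c d \<tau>. a * d - b * c = 1 \<longrightarrow>
        f (mobius a b c d \<tau>) = (of_int c * Rep_uhp \<tau> + of_int d) powi k * f \<tau>) \<and>
     (\<exists>a. \<forall>\<tau>. (\<lambda>n. a n * exp (2 * pi * \<i> * Rep_uhp \<tau>) ^ n) sums f \<tau>)"

text \<open>Holomorphy in all nine variables: the total real derivative exists and is complex-linear.\<close>

definition jacobi_holomorphic :: "(uhp \<Rightarrow> complex^8 \<Rightarrow> complex) \<Rightarrow> bool" where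
  "jacobi_holomorphic \<phi> \<longleftrightarrow>
     (\<forall>\<tau> z. \<exists>D. ((\<lambda>(w, v). \<phi> (Abs_uhp w) v) has_derivative D) (at (Rep_uhp \<tau>, z)) \<and>
              (\<forall>c w v. D (c * w, c *s v) = c * D (w, v)))"

definition weak_jacobi_form :: "int \<Rightarrow> nat \<Rightarrow> (uhp \<Rightarrow> complex^8 \<Rightarrow> complex) \<Rightarrow> bool" where
  "weak_jacobi_form k t \<phi> \<longleftrightarrow>
     jacobi_holomorphic \<phi> \<and>
     (\<forall>\<sigma>\<in>weyl_E8. \<forall>\<tau> z. \<phi> \<tau> (\<sigma> z) = \<phi> \<tau> z) \<and>
     (\<forall>x\<in>E8. \<forall>y\<in>E8. \<forall>\<tau> z.
        \<phi> \<tau> (z + Rep_uhp \<tau> *s cvec x + cvec y) =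
        exp (- of_nat t * pi * \<i> *
               (of_real (x \<bullet> x) * Rep_uhp \<tau> + 2 * cdot (cvec x) z)) * \<phi> \<tau> z) \<and>
     (\<forall>a b c d \<tau> z. a * d - b * c = 1 \<longrightarrow>
        \<phi> (mobius a b c d \<tau>) (inverse (of_int c * Rep_uhp \<tau> + of_int d) *s z) =
        (of_int c * Rep_uhp \<tau> + of_int d) powi k *
        exp (of_nat t * pi * \<i> * (of_int c * cdot z z / (of_int c * Rep_uhp \<tau> + of_int d))) *
        \<phi> \<tau> z) \<and>
     (\<exists>f :: nat \<Rightarrow> real^8 \<Rightarrow> complex. \<forall>\<tau> z.
        ((\<lambda>(n, l). f n l * exp (2 * pi * \<i> * Rep_uhp \<tau>) ^ n * exp (2 * pi * \<i> * cdot (cvec l) z))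
           has_sum \<phi> \<tau> z) (UNIV \<times> E8))"

text \<open>
  The bigraded direct sum sits inside the commutative ring of finitely supported families of
  functions indexed by (weight, index).  Multiplication of families is convolution,
  i.e. the bilinear extension of the pointwise product of functions.
\<close>

type_synonym graded_fun = "(int \<times> nat) \<Rightarrow>\<^sub>0 (uhp \<Rightarrow> complex^8 \<Rightarrow> complex)"

definition weak_jacobi_ring :: "graded_fun set" where
  "weak_jacobi_ring = {F. \<forall>k t. weak_jacobi_form k t (Poly_Mapping.lookup F (k, t))}"

text \<open>
  The graded ring of modular forms, as a subring in index 0: a modular form is
  regarded as a function of \<open>(\<tau>, z)\<close> that is constant in \<open>z\<close>.
\<close>

definition modular_ring :: "graded_fun set" where
  "modular_ring =
     {F. (\<forall>k. \<exists>f. modular_form k f \<and> Poly_Mapping.lookup F (k, 0) = (\<lambda>\<tau> z. f \<tau>)) \<and>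
         (\<forall>k t. t \<noteq> 0 \<longrightarrow> Poly_Mapping.lookup F (k, t) = 0)}"


section \<open>Polynomial algebras over a subring\<close>

text \<open>
  Polynomials in variables indexed by the elements of \<open>S\<close> with coefficients in \<open>R\<close>;
  a monomial is a finitely supported exponent function, and \<open>poly_value\<close> substitutes
  for each variable the element indexing it.
\<close>

definition polys_over :: "'a::comm_ring_1 set \<Rightarrow> 'a set \<Rightarrow> (('a \<Rightarrow>\<^sub>0 nat) \<Rightarrow>\<^sub>0 'a) set" where
  "polys_over R S = {p. (\<forall>m. Poly_Mapping.lookup p m \<in> R) \<and>
                        (\<forall>m\<in>Poly_Mapping.keys p. Poly_Mapping.keys m \<subseteq> S)}"

definition poly_value :: "(('a \<Rightarrow>\<^sub>0 nat) \<Rightarrow>\<^sub>0 'a::comm_ring_1) \<Rightarrow> 'a" where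
  "poly_value p = (\<Sum>m\<in>Poly_Mapping.keys p. Poly_Mapping.lookup p m *
                     (\<Prod>s\<in>Poly_Mapping.keys m. s ^ Poly_Mapping.lookup m s))"

definition algebraically_independent :: "'a::comm_ring_1 set \<Rightarrow> 'a set \<Rightarrow> bool" where
  "algebraically_independent R S \<longleftrightarrow> (\<forall>p\<in>polys_over R S. poly_value p = 0 \<longrightarrow> p = 0)"

definition adjoin :: "'a::comm_ring_1 set \<Rightarrow> 'a set \<Rightarrow> 'a set" where
  "adjoin R S = poly_value ` polys_over R S"

end

(*
Let A1 be the theta function of E8, of weight 4 and index 1. Among the weak Jacobi forms there is a
relation A1^2 = E4 A2 + D phi, where E4 and D are modular forms of weight 4 and 12, A2 is the image
of A1 under a Hecke operator of index 2, and phi = (A1^2 - E4 A2) / D has weight -4: the numerator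
vanishes at the cusp, and D has a simple zero there and no other zero. So A1^2 lies in the ideal
generated by the modular forms of positive weight. In a polynomial algebra over M_* that ideal is
radical, so A1 would be a combination of forms psi of index 1 and weight < 4 with such coefficients.
Every weak Jacobi form of index 1 is A1 times a modular form, since E8 is unimodular, so each psi is
zero, a contradiction.

D is the eighth power of the product of the theta constants. Its transformation law, like that of A1,
comes from the inversion formula of the one-variable theta function; it has no zeros because every
point is equivalent to one with imaginary part at least 1/5, where the leading term dominates.
*)

theory Submission
  imports
    Defs
    "HOL-Complex_Analysis.Complex_Analysis"
    "HOL-Probability.Probability"
begin

section \<open>The lattice and Fourier expansions\<close>

text \<open>The elements of \<open>S\<close> need not be homogeneous, so no count of weights or
  indices of generators is available. The proof looks at coefficients only. Modular forms have no
  negative weights, so the weight 0 component is a ring homomorphism on \<open>modular_ring\<close>;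
  evaluated at a point it has complex values, and a polynomial ring over the complex numbers is
  reduced. This is why the ideal is radical. The analytic obstacle is that the quotient by D must
  again be a weak Jacobi form, holomorphic in nine variables and with an expansion of its own.
  Everything is therefore routed through Fourier expansions: their convergence at every point
  already yields holomorphy, invariance under \<tau> + 1 and the periods in \<open>E8\<close>. At
  q^0 both A1^2 and E4 A2 consist of the constant 1 alone, without any dependence on z, so their
  difference can be divided by the nome term by term. Vanishing in negative weight comes from the
  maximum principle on discs in the nome, not from a valence formula.\<close>

definition half_vec :: "(8 \<Rightarrow> int) \<Rightarrow> real^8" where
  "half_vec a = (\<chi> i. of_int (a i) / 2)"

lemma half_vec_nth [simp]: "half_vec a $ i = of_int (a i) / 2"
  by (simp add: half_vec_def)

lemma inj_half_vec: "inj half_vec"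
proof (rule injI)
  fix a b :: "8 \<Rightarrow> int"
  assume "half_vec a = half_vec b"
  then have "half_vec a $ i = half_vec b $ i" for i
    by simp
  then show "a = b"
    by (intro ext) simp
qed

text \<open>In doubled coordinates membership becomes two congruences on integers. In this form
  characters of the integers can detect \<open>E8\<close>, see \<open>sum_half_char\<close>.\<close>

lemma half_vec_in_E8_iff:
  "half_vec a \<in> E8 \<longleftrightarrow> (\<forall>i j. even (a i - a j)) \<and> 4 dvd (\<Sum>i\<in>UNIV. a i)"
proof -
  have diff: "half_vec a $ i - half_vec a $ j \<in> \<int> \<longleftrightarrow> even (a i - a j)" for i j
  proof
    assume "half_vec a $ i - half_vec a $ j \<in> \<int>"
    then obtain n where "half_vec a $ i - half_vec a $ j = of_int n"
      by (elim Ints_cases)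
    then have "real_of_int (a i - a j) = of_int (2 * n)"
      by (simp add: field_simps)
    then have "a i - a j = 2 * n"
      by (simp only: of_int_eq_iff)
    then show "even (a i - a j)"
      by simp
  next
    assume "even (a i - a j)"
    then obtain n where "a i - a j = 2 * n"
      by (elim evenE)
    then have "real_of_int (a i - a j) = of_int (2 * n)"
      by simp
    then have "half_vec a $ i - half_vec a $ j = of_int n"
      by (simp add: field_simps)
    then show "half_vec a $ i - half_vec a $ j \<in> \<int>"
      by simp
  qed
  have *: "(\<Sum>i\<in>UNIV. half_vec a $ i) = of_int (\<Sum>i\<in>UNIV. a i) / 2"
    by (simp add: sum_divide_distrib)
  have "(\<Sum>i\<in>UNIV. half_vec a $ i) = 2 * of_int m \<longleftrightarrow> (\<Sum>i\<in>UNIV. a i) = 4 * m" for m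
  proof -
    have "(\<Sum>i\<in>UNIV. half_vec a $ i) = 2 * of_int m \<longleftrightarrow> real_of_int (\<Sum>i\<in>UNIV. a i) = of_int (4 * m)"
      unfolding * by (simp add: field_simps)
    then show ?thesis
      by (simp only: of_int_eq_iff)
  qed
  then have "(\<exists>m::int. (\<Sum>i\<in>UNIV. half_vec a $ i) = 2 * of_int m) \<longleftrightarrow> 4 dvd (\<Sum>i\<in>UNIV. a i)"
    by (auto simp: dvd_def)
  moreover have "2 * half_vec a $ i \<in> \<int>" for i
    by simp
  ultimately show ?thesis
    unfolding E8_def mem_Collect_eq diff by blast
qed

lemma E8_eq_half_vec: "E8 = half_vec ` {a. (\<forall>i j. even (a i - a j)) \<and> 4 dvd (\<Sum>i\<in>UNIV. a i)}"
proof (intro equalityI subsetI)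
  fix x assume x: "x \<in> E8"
  define a where "a i = \<lfloor>2 * x $ i\<rfloor>" for i
  have "2 * x $ i \<in> \<int>" for i
    using x by (simp add: E8_def)
  then have "of_int (a i) = 2 * x $ i" for i
    unfolding a_def by (metis Ints_cases floor_of_int)
  then have "x = half_vec a"
    by (simp add: vec_eq_iff)
  then show "x \<in> half_vec ` {a. (\<forall>i j. even (a i - a j)) \<and> 4 dvd (\<Sum>i\<in>UNIV. a i)}"
    using x half_vec_in_E8_iff by auto
qed (auto simp: half_vec_in_E8_iff)

lemma E8E:
  assumes "x \<in> E8"
  obtains a where "x = half_vec a" "\<And>i j. even (a i - a j)" "4 dvd (\<Sum>i\<in>UNIV. a i)"
  using assms unfolding E8_eq_half_vec by auto

lemma E8_zero: "0 \<in> E8"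
proof -
  have "0 = half_vec (\<lambda>_. 0)"
    by (simp add: vec_eq_iff)
  moreover have "half_vec (\<lambda>_. 0) \<in> E8"
    by (simp add: half_vec_in_E8_iff)
  ultimately show ?thesis
    by metis
qed

lemma E8_add:
  assumes "x \<in> E8" "y \<in> E8"
  shows "x + y \<in> E8"
proof -
  obtain a b where ab: "x = half_vec a" "\<And>i j. even (a i - a j)" "4 dvd (\<Sum>i\<in>UNIV. a i)"
    "y = half_vec b" "\<And>i j. even (b i - b j)" "4 dvd (\<Sum>i\<in>UNIV. b i)"
    using E8E[OF assms(1)] E8E[OF assms(2)] by metis
  have *: "x + y = half_vec (\<lambda>i. a i + b i)"
    by (simp add: ab vec_eq_iff add_divide_distrib)
  have "even ((a i + b i) - (a j + b j))" for i j
    using ab(2)[of i j] ab(5)[of i j] by (metis add_diff_add dvd_add)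
  then show ?thesis
    unfolding * half_vec_in_E8_iff using ab(3,6) by (auto simp: sum.distrib)
qed

lemma E8_scale:
  assumes "x \<in> E8"
  shows "of_int k *\<^sub>R x \<in> E8"
proof -
  obtain a where a: "x = half_vec a" "\<And>i j. even (a i - a j)" "4 dvd (\<Sum>i\<in>UNIV. a i)"
    using E8E[OF assms] by metis
  have *: "of_int k *\<^sub>R x = half_vec (\<lambda>i. k * a i)"
    by (simp add: a vec_eq_iff)
  have "even (k * a i - k * a j)" for i j
    using a(2)[of i j] by (metis dvd_mult right_diff_distrib)
  then show ?thesis
    unfolding * half_vec_in_E8_iff using a(3) by (simp flip: sum_distrib_left)
qed

lemma E8_minus: "x \<in> E8 \<Longrightarrow> - x \<in> E8"
  using E8_scale[of x "-1"] by simp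

lemma E8_diff: "x \<in> E8 \<Longrightarrow> y \<in> E8 \<Longrightarrow> x - y \<in> E8"
  using E8_add[OF _ E8_minus, of x y] by simp

text \<open>Four times the norm is a sum of eight integer squares, so the claim is divisibility of
  that sum by 8. The all-even and the all-odd case need different reasons.\<close>

lemma E8_norm_even:
  assumes "x \<in> E8"
  obtains n :: nat where "x \<bullet> x = 2 * of_nat n"
proof -
  obtain a where a: "x = half_vec a" "\<And>i j. even (a i - a j)" "4 dvd (\<Sum>i\<in>UNIV. a i)"
    using E8E[OF assms] by metis
  have "8 dvd (\<Sum>i\<in>UNIV. (a i)\<^sup>2)"
  proof (cases "even (a 0)")
    case True
    then have "even (a i)" for i
      using a(2)[of i 0] by simp
    then have "\<exists>b. a i = 2 * b" for i
      by (auto elim: evenE)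
    then obtain b where b: "\<And>i. a i = 2 * b i"
      by metis
    \<comment> \<open>A square has the parity of its base, so the sum of squares has the parity of
      the sum of the \<open>b i\<close>, which is even by the divisibility by 4.\<close>
    have "even (\<Sum>i\<in>UNIV. (b i)\<^sup>2 - b i)"
      by (intro dvd_sum) simp
    moreover have "even (\<Sum>i\<in>UNIV. b i)"
      using a(3) by (simp add: b flip: sum_distrib_left) presburger
    ultimately have "even (\<Sum>i\<in>UNIV. (b i)\<^sup>2)"
      by (simp add: sum_subtractf)
    then show ?thesis
      by (simp add: b power_mult_distrib flip: sum_distrib_left) presburger
  next
    case False
    then have odd: "odd (a i)" for i
      using a(2)[of i 0] by simp
    \<comment> \<open>Odd squares are 1 modulo 8, and the eight ones add up to 8.\<close>
    have "8 dvd (\<Sum>i\<in>UNIV. (a i)\<^sup>2 - 1)"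
    proof (intro dvd_sum)
      fix i :: 8
      obtain b where b: "a i = 2 * b + 1"
        using odd[of i] by (elim oddE)
      have "even (b * (b + 1))"
        by simp
      then obtain c where c: "b * (b + 1) = 2 * c"
        by (elim evenE)
      have "(a i)\<^sup>2 - 1 = 4 * (b * (b + 1))"
        by (simp add: b power2_eq_square algebra_simps)
      then show "8 dvd (a i)\<^sup>2 - 1"
        by (simp add: c)
    qed
    then show ?thesis
      by (simp add: sum_subtractf) presburger
  qed
  then obtain m where m: "(\<Sum>i\<in>UNIV. (a i)\<^sup>2) = 8 * m"
    by (elim dvdE)
  have "x \<bullet> x = of_int (\<Sum>i\<in>UNIV. (a i)\<^sup>2) / 4"
    by (simp add: a(1) inner_vec_def power2_eq_square sum_divide_distrib)
  then have *: "x \<bullet> x = 2 * of_int m"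
    by (simp add: m)
  then have "m \<ge> 0"
    using inner_ge_zero[of x] by simp
  then show ?thesis
    using that[of "nat m"] * by simp
qed

text \<open>Polarisation of the even norm.\<close>

lemma E8_inner_int:
  assumes "x \<in> E8" "y \<in> E8"
  obtains n :: int where "x \<bullet> y = of_int n"
proof -
  obtain a b c :: nat where "x \<bullet> x = 2 * of_nat a" "y \<bullet> y = 2 * of_nat b"
    "(x + y) \<bullet> (x + y) = 2 * of_nat c"
    using assms E8_norm_even E8_add by metis
  then have "x \<bullet> y = of_int (int c - int a - int b)"
    by (simp add: inner_add inner_commute)
  then show ?thesis
    by (rule that)
qed

lemma cdot_add_left: "cdot (z + w) v = cdot z v + cdot w v"
  by (simp add: cdot_def distrib_right sum.distrib)

lemma cdot_add_right: "cdot v (z + w) = cdot v z + cdot v w"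
  by (simp add: cdot_def distrib_left sum.distrib)

lemma cdot_diff_left: "cdot (z - w) v = cdot z v - cdot w v"
  by (simp add: cdot_def left_diff_distrib sum_subtractf)

lemma cdot_diff_right: "cdot v (z - w) = cdot v z - cdot v w"
  by (simp add: cdot_def right_diff_distrib sum_subtractf)

lemma cdot_scale_left: "cdot (c *s z) w = c * cdot z w"
  by (simp add: cdot_def sum_distrib_left mult.assoc)

lemma cdot_scale_right: "cdot z (c *s w) = c * cdot z w"
  by (simp add: cdot_def sum_distrib_left mult.left_commute)

lemma cdot_zero [simp]: "cdot 0 z = 0" "cdot z 0 = 0"
  by (simp_all add: cdot_def)

lemma cdot_cvec: "cdot (cvec x) (cvec y) = of_real (x \<bullet> y)"
  by (simp add: cdot_def cvec_def inner_vec_def)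

lemma cvec_add: "cvec (x + y) = cvec x + cvec y"
  by (simp add: cvec_def vec_eq_iff)

lemma cvec_diff: "cvec (x - y) = cvec x - cvec y"
  by (simp add: cvec_def vec_eq_iff)

lemma cvec_minus: "cvec (- x) = - cvec x"
  by (simp add: cvec_def vec_eq_iff)

lemma cvec_scaleR: "cvec (c *\<^sub>R x) = of_real c *s cvec x"
  by (simp add: cvec_def vec_eq_iff)

lemma cvec_zero [simp]: "cvec 0 = 0"
  by (simp add: cvec_def vec_eq_iff)

lemmas cdot_simps = cdot_add_left cdot_add_right cdot_diff_left cdot_diff_right
  cdot_scale_left cdot_scale_right cdot_cvec

lemma Im_Rep_uhp: "Im (Rep_uhp \<tau>) > 0"
  using Rep_uhp[of \<tau>] by simp

lemma Rep_Abs_uhp: "Im w > 0 \<Longrightarrow> Rep_uhp (Abs_uhp w) = w"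
  by (rule Abs_uhp_inverse) simp

lemma exp_2pi_int: "exp (2 * pi * \<i> * of_int n) = 1"
  using exp_integer_2pi[of "of_int n"] by (simp add: mult_ac)

abbreviation nome :: "uhp \<Rightarrow> complex" where
  "nome \<tau> \<equiv> exp (2 * pi * \<i> * Rep_uhp \<tau>)"

text \<open>The last clause of \<open>weak_jacobi_form\<close> with the coefficients exposed, so
  that they can be added, convolved and shifted.\<close>

definition jacobi_expansion :: "(nat \<Rightarrow> real^8 \<Rightarrow> complex) \<Rightarrow> (uhp \<Rightarrow> complex^8 \<Rightarrow> complex) \<Rightarrow> bool" where
  "jacobi_expansion f \<phi> \<longleftrightarrow> (\<forall>\<tau> z.
     ((\<lambda>(n, l). f n l * nome \<tau> ^ n * exp (2 * pi * \<i> * cdot (cvec l) z))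
        has_sum \<phi> \<tau> z) (UNIV \<times> E8))"

lemma jacobi_expansionD:
  assumes "jacobi_expansion f \<phi>"
  shows "((\<lambda>(n, l). f n l * nome \<tau> ^ n * exp (2 * pi * \<i> * cdot (cvec l) z))
        has_sum \<phi> \<tau> z) (UNIV \<times> E8)"
  using assms by (simp add: jacobi_expansion_def)

lemma jacobi_expansion_add:
  assumes "jacobi_expansion f \<phi>" "jacobi_expansion g \<psi>"
  shows "jacobi_expansion (\<lambda>n l. f n l + g n l) (\<lambda>\<tau> z. \<phi> \<tau> z + \<psi> \<tau> z)"
  unfolding jacobi_expansion_def
proof (intro allI)
  fix \<tau> z
  show "((\<lambda>(n, l). (f n l + g n l) * nome \<tau> ^ n * exp (2 * pi * \<i> * cdot (cvec l) z))
        has_sum (\<phi> \<tau> z + \<psi> \<tau> z)) (UNIV \<times> E8)"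
    using has_sum_add[OF assms[THEN jacobi_expansionD, of \<tau> z]]
    by (simp add: case_prod_unfold distrib_right)
qed

lemma jacobi_expansion_cmult:
  assumes "jacobi_expansion f \<phi>"
  shows "jacobi_expansion (\<lambda>n l. c * f n l) (\<lambda>\<tau> z. c * \<phi> \<tau> z)"
  unfolding jacobi_expansion_def
proof (intro allI)
  fix \<tau> z
  show "((\<lambda>(n, l). c * f n l * nome \<tau> ^ n * exp (2 * pi * \<i> * cdot (cvec l) z))
        has_sum (c * \<phi> \<tau> z)) (UNIV \<times> E8)"
    using has_sum_cmult_right[OF assms[THEN jacobi_expansionD, of \<tau> z], of c]
    by (simp add: case_prod_unfold mult.assoc)
qed

lemma jacobi_expansion_diff:
  assumes "jacobi_expansion f \<phi>" "jacobi_expansion g \<psi>"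
  shows "jacobi_expansion (\<lambda>n l. f n l - g n l) (\<lambda>\<tau> z. \<phi> \<tau> z - \<psi> \<tau> z)"
  using jacobi_expansion_add[OF assms(1) jacobi_expansion_cmult[OF assms(2), of "-1"]] by simp

lemma jacobi_expansion_shift:
  assumes f: "jacobi_expansion f \<phi>" and "Rep_uhp \<tau>' = Rep_uhp \<tau> + 1"
  shows "\<phi> \<tau>' z = \<phi> \<tau> z"
proof -
  have *: "exp (2 * pi * \<i> * Rep_uhp \<tau>') = nome \<tau>"
    using exp_2pi_int[of 1] by (simp add: assms(2) distrib_left exp_add)
  show ?thesis
    using has_sum_unique[OF jacobi_expansionD[OF f, of \<tau>' z, unfolded *] jacobi_expansionD[OF f, of \<tau> z]] .
qed

text \<open>Scalar products in \<open>E8\<close> are integers, so every character of the expansion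
  is periodic.\<close>

lemma jacobi_expansion_lattice:
  assumes f: "jacobi_expansion f \<phi>" and y: "y \<in> E8"
  shows "\<phi> \<tau> (z + cvec y) = \<phi> \<tau> z"
proof -
  have *: "exp (2 * pi * \<i> * cdot (cvec l) (z + cvec y)) = exp (2 * pi * \<i> * cdot (cvec l) z)"
    if l: "l \<in> E8" for l
  proof -
    obtain n where "l \<bullet> y = of_int n"
      using E8_inner_int[OF l y] .
    then show ?thesis
      using exp_2pi_int[of n] by (simp add: cdot_simps distrib_left exp_add)
  qed
  have "((\<lambda>(n, l). f n l * nome \<tau> ^ n * exp (2 * pi * \<i> * cdot (cvec l) z))
        has_sum \<phi> \<tau> (z + cvec y)) (UNIV \<times> E8)"
    by (rule has_sum_cong[THEN iffD1, OF _ jacobi_expansionD[OF f]]) (auto simp: *[simplified])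
  then show ?thesis
    using has_sum_unique jacobi_expansionD[OF f] by blast
qed

section \<open>Transformation laws from the generators of the modular group\<close>

text \<open>The modular clause for one matrix at a time, so that laws can be composed like
  matrices.\<close>

definition jacobi_law :: "int \<Rightarrow> nat \<Rightarrow> (uhp \<Rightarrow> complex^8 \<Rightarrow> complex) \<Rightarrow> int \<Rightarrow> int \<Rightarrow> int \<Rightarrow> int \<Rightarrow> bool" where
  "jacobi_law k t \<phi> a b c d \<longleftrightarrow> (\<forall>\<tau> z.
     \<phi> (mobius a b c d \<tau>) (inverse (of_int c * Rep_uhp \<tau> + of_int d) *s z) =
       (of_int c * Rep_uhp \<tau> + of_int d) powi k *
       exp (of_nat t * pi * \<i> * (of_int c * cdot z z / (of_int c * Rep_uhp \<tau> + of_int d))) * \<phi> \<tau> z)"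

lemma automorphy_factor_nonzero:
  assumes "a * d - b * c = (1::int)"
  shows "of_int c * Rep_uhp \<tau> + of_int d \<noteq> (0::complex)"
proof
  assume z: "of_int c * Rep_uhp \<tau> + of_int d = (0::complex)"
  then have "Im (of_int c * Rep_uhp \<tau> + of_int d) = 0"
    by simp
  then have "c = 0"
    using Im_Rep_uhp[of \<tau>] by simp
  with z have "d = 0"
    by simp
  with \<open>c = 0\<close> assms show False
    by simp
qed

text \<open>The automorphy factor and the quadratic exponent are both cocycles. For the exponent
  this is the fact \<open>ex\<close>, which rests on \<open>c = c3 * d' - d3 * c'\<close>, a
  consequence of the second determinant.\<close>

lemma jacobi_law_mult:
  assumes det: "a * d - b * c = 1" "a' * d' - b' * c' = 1"
    and 1: "jacobi_law k t \<phi> a b c d" and 2: "jacobi_law k t \<phi> a' b' c' d'"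
  shows "jacobi_law k t \<phi> (a * a' + b * c') (a * b' + b * d') (c * a' + d * c') (c * b' + d * d')"
  unfolding jacobi_law_def
proof (intro allI)
  fix \<tau> and z :: "complex^8"
  define w where "w = Rep_uhp \<tau>"
  define \<tau>' where "\<tau>' = mobius a' b' c' d' \<tau>"
  define w' where "w' = Rep_uhp \<tau>'"
  define j where "j = of_int c' * w + of_int d'"
  define j' where "j' = of_int c * w' + of_int d"
  define c3 where "c3 = c * a' + d * c'"
  define d3 where "d3 = c * b' + d * d'"
  define j3 where "j3 = of_int c3 * w + of_int d3"
  have j0: "j \<noteq> 0"
    using automorphy_factor_nonzero[OF det(2), of \<tau>] by (simp add: j_def w_def)
  have j'0: "j' \<noteq> 0"
    using automorphy_factor_nonzero[OF det(1), of \<tau>'] by (simp add: j'_def w'_def)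
  have w': "w' = (of_int a' * w + of_int b') / j"
    using Rep_mobius[OF det(2), of \<tau>] by (simp add: w'_def \<tau>'_def j_def w_def)
  have j3: "j3 = j' * j"
    using j0 by (simp add: j3_def j'_def w' c3_def d3_def field_simps) (simp add: j_def algebra_simps)
  have det3: "(a * a' + b * c') * d3 - (a * b' + b * d') * c3 = 1"
  proof -
    have "(a * a' + b * c') * d3 - (a * b' + b * d') * c3 = (a * d - b * c) * (a' * d' - b' * c')"
      by (simp add: c3_def d3_def algebra_simps)
    then show ?thesis
      by (simp add: det)
  qed
  have "Rep_uhp (mobius a b c d \<tau>') = (of_int a * w' + of_int b) / j'"
    using Rep_mobius[OF det(1), of \<tau>'] by (simp add: w'_def j'_def)
  also have "\<dots> = (of_int (a * a' + b * c') * w + of_int (a * b' + b * d')) / j3"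
    using j0 j'0 unfolding j3 by (simp add: w' divide_simps) (simp add: j_def algebra_simps)
  also have "\<dots> = Rep_uhp (mobius (a * a' + b * c') (a * b' + b * d') c3 d3 \<tau>)"
    using Rep_mobius[OF det3, of \<tau>] by (simp add: w_def j3_def)
  finally have mob: "mobius a b c d \<tau>' = mobius (a * a' + b * c') (a * b' + b * d') c3 d3 \<tau>"
    by (simp add: Rep_uhp_inject)
  define z' where "z' = inverse j *s z"
  have z': "inverse j3 *s z = inverse j' *s z'"
    using j0 j'0 by (simp add: z'_def j3 vec_eq_iff)
  have "c = c3 * d' - d3 * c'"
  proof -
    have "c3 * d' - d3 * c' = c * (a' * d' - b' * c')"
      by (simp add: c3_def d3_def algebra_simps)
    then show ?thesis
      by (simp add: det)
  qed
  then have "(of_int c :: complex) = of_int (c3 * d' - d3 * c')"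
    by simp
  then have c: "(of_int c :: complex) = of_int c3 * j - of_int c' * j3"
    by (simp add: j_def j3_def algebra_simps)
  have ex: "of_int c * cdot z' z' / j' + of_int c' * cdot z z / j = of_int c3 * cdot z z / j3"
    using j0 j'0 by (simp add: z'_def cdot_simps c j3 field_simps)
  have exs: "exp (of_nat t * pi * \<i> * (of_int c3 * cdot z z / j3)) =
      exp (of_nat t * pi * \<i> * (of_int c * cdot z' z' / j')) *
      exp (of_nat t * pi * \<i> * (of_int c' * cdot z z / j))"
    unfolding ex[symmetric] by (simp only: distrib_left exp_add)
  have "\<phi> (mobius a b c d \<tau>') (inverse j' *s z') =
      j' powi k * exp (of_nat t * pi * \<i> * (of_int c * cdot z' z' / j')) * \<phi> \<tau>' z'"
    using 1 unfolding jacobi_law_def by (simp add: j'_def w'_def)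
  also have "\<phi> \<tau>' z' = j powi k * exp (of_nat t * pi * \<i> * (of_int c' * cdot z z / j)) * \<phi> \<tau> z"
    using 2 unfolding jacobi_law_def by (simp add: j_def w_def z'_def \<tau>'_def)
  also have "j' powi k * exp (of_nat t * pi * \<i> * (of_int c * cdot z' z' / j')) *
      (j powi k * exp (of_nat t * pi * \<i> * (of_int c' * cdot z z / j)) * \<phi> \<tau> z) =
      j3 powi k * exp (of_nat t * pi * \<i> * (of_int c3 * cdot z z / j3)) * \<phi> \<tau> z"
    unfolding exs by (simp only: j3 power_int_mult_distrib mult_ac)
  finally show "\<phi> (mobius (a * a' + b * c') (a * b' + b * d') (c * a' + d * c') (c * b' + d * d') \<tau>)
       (inverse (of_int (c * a' + d * c') * Rep_uhp \<tau> + of_int (c * b' + d * d')) *s z) =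
      (of_int (c * a' + d * c') * Rep_uhp \<tau> + of_int (c * b' + d * d')) powi k *
      exp (of_nat t * pi * \<i> * (of_int (c * a' + d * c') * cdot z z /
        (of_int (c * a' + d * c') * Rep_uhp \<tau> + of_int (c * b' + d * d')))) * \<phi> \<tau> z"
    unfolding c3_def[symmetric] d3_def[symmetric] w_def[symmetric] j3_def[symmetric] z' mob[symmetric] .
qed

lemma jacobi_law_translation:
  assumes "\<And>\<tau> \<tau>' z. Rep_uhp \<tau>' = Rep_uhp \<tau> + 1 \<Longrightarrow> \<phi> \<tau>' z = \<phi> \<tau> z"
  shows "jacobi_law k t \<phi> 1 m 0 1"
proof -
  have Rep: "Rep_uhp (mobius 1 m 0 1 \<tau>) = Rep_uhp \<tau> + of_int m" for m \<tau>
    using Rep_mobius[of 1 1 m 0 \<tau>] by simp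
  have "\<phi> (mobius 1 m 0 1 \<tau>) z = \<phi> \<tau> z" for \<tau> z
  proof (induction m rule: int_induct[where k = 0])
    case base
    have "mobius 1 0 0 1 \<tau> = \<tau>"
      using Rep[of 0 \<tau>] by (simp add: Rep_uhp_inject)
    then show ?case
      by simp
  next
    case (step1 i)
    have "\<phi> (mobius 1 (i + 1) 0 1 \<tau>) z = \<phi> (mobius 1 i 0 1 \<tau>) z"
      by (rule assms) (simp add: Rep)
    then show ?case
      using step1 by simp
  next
    case (step2 i)
    have "\<phi> (mobius 1 i 0 1 \<tau>) z = \<phi> (mobius 1 (i - 1) 0 1 \<tau>) z"
      by (rule assms) (simp add: Rep)
    then show ?case
      using step2 by simp
  qed
  then show ?thesis
    by (simp add: jacobi_law_def)
qed

text \<open>Euclid's algorithm on the first column of the matrix, by induction on the absolute value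
  of the lower left entry.\<close>

lemma jacobi_law_generators:
  assumes T: "\<And>\<tau> \<tau>' z. Rep_uhp \<tau>' = Rep_uhp \<tau> + 1 \<Longrightarrow> \<phi> \<tau>' z = \<phi> \<tau> z"
    and S: "jacobi_law k t \<phi> 0 (-1) 1 0"
    and det: "a * d - b * c = 1"
  shows "jacobi_law k t \<phi> a b c d"
  using det
proof (induction "nat \<bar>c\<bar>" arbitrary: a b c d rule: less_induct)
  case less
  note T = jacobi_law_translation[OF T]
  show ?case
  proof (cases "c = 0")
    case True
    then have "a * d = 1"
      using less.prems by simp
    then consider "a = 1" "d = 1" | "a = -1" "d = -1"
      by (auto simp: zmult_eq_1_iff)
    then show ?thesis
    proof cases
      case 1
      then show ?thesis
        using T True by simp
    next
      case 2
      \<comment> \<open>The square of the inversion is minus the identity; it reaches the triangular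
        matrices with diagonal -1.\<close>
      have "jacobi_law k t \<phi> (- 1) 0 0 (- 1)"
        using jacobi_law_mult[OF _ _ S S] by simp
      then show ?thesis
        using jacobi_law_mult[OF _ _ _ T[where m = "-b"], of "-1" "-1" 0 0] 2 True by simp
    qed
  next
    case False
    \<comment> \<open>With T the translation and S the inversion, the matrix is T^m S times the one
      with rows (c, d) and (-a', -b'), whose lower left entry is smaller in absolute value.\<close>
    define m where "m = a div c"
    define a' where "a' = a mod c"
    define b' where "b' = b - m * d"
    have a: "a = m * c + a'" and b: "b = m * d + b'"
      by (simp_all add: m_def a'_def b'_def)
    have det': "c * (- b') - d * (- a') = 1"
      using less.prems by (simp add: a b algebra_simps)
    have "nat \<bar>- a'\<bar> < nat \<bar>c\<bar>"
      using False abs_mod_less[of c a] by (simp add: a'_def)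
    then have "jacobi_law k t \<phi> c d (- a') (- b')"
      using less.hyps det' by blast
    from jacobi_law_mult[OF _ det' S this] have "jacobi_law k t \<phi> a' b' c d"
      by simp
    from jacobi_law_mult[OF _ _ T[where m = m] this] show ?thesis
      using det' by (simp add: a b algebra_simps)
  qed
qed

lemma cdot_cvec_reflection:
  "cdot (cvec l) (reflection r z) = cdot (cvec (l - (l \<bullet> r) *\<^sub>R r)) z"
  by (simp add: reflection_def cvec_diff cvec_scaleR cdot_simps)

text \<open>The checklist for all concrete forms below. Induction over the generators covers
  \<open>weyl_E8\<close> and the modular group, and the expansion accounts for the shifts that fix
  the nome or the characters.\<close>

lemma weak_jacobi_formI:
  assumes hol: "jacobi_holomorphic \<phi>" and f: "jacobi_expansion f \<phi>"
    and refl: "\<And>r \<tau> z. r \<in> E8 \<Longrightarrow> r \<bullet> r = 2 \<Longrightarrow> \<phi> \<tau> (reflection r z) = \<phi> \<tau> z"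
    and trans: "\<And>x \<tau> z. x \<in> E8 \<Longrightarrow> \<phi> \<tau> (z + Rep_uhp \<tau> *s cvec x) =
        exp (- of_nat t * pi * \<i> * (of_real (x \<bullet> x) * Rep_uhp \<tau> + 2 * cdot (cvec x) z)) * \<phi> \<tau> z"
    and S: "jacobi_law k t \<phi> 0 (-1) 1 0"
  shows "weak_jacobi_form k t \<phi>"
proof -
  have "\<phi> \<tau> (\<sigma> z) = \<phi> \<tau> z" if "\<sigma> \<in> weyl_E8" for \<sigma> \<tau> z
    using that by induction (auto simp: refl)
  moreover have "jacobi_law k t \<phi> a b c d" if "a * d - b * c = 1" for a b c d
    by (rule jacobi_law_generators[OF jacobi_expansion_shift[OF f] S that])
  ultimately show ?thesis
    unfolding weak_jacobi_form_def using hol f trans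
    by (auto simp: jacobi_law_def jacobi_expansion_lattice[OF f] jacobi_expansion_def)
qed

section \<open>Modular forms of negative weight\<close>

lemma Im_mobius:
  assumes "a * d - b * c = 1"
  shows "Im (Rep_uhp (mobius a b c d \<tau>)) =
    Im (Rep_uhp \<tau>) / (cmod (of_int c * Rep_uhp \<tau> + of_int d))\<^sup>2"
proof -
  have det: "of_int a * of_int d - of_int b * of_int c = (1::real)"
    using assms by (metis of_int_1 of_int_diff of_int_mult)
  have "Im (Rep_uhp (mobius a b c d \<tau>)) =
      (of_int a * of_int d - of_int b * of_int c) * Im (Rep_uhp \<tau>) /
        (cmod (of_int c * Rep_uhp \<tau> + of_int d))\<^sup>2"
    unfolding Rep_mobius[OF assms] Im_divide cmod_power2 by (simp add: algebra_simps)
  then show ?thesis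
    by (simp add: det)
qed

text \<open>Dirichlet approximation of the real part produces a small automorphy factor. The bound
  1/5 is weaker than the sharp one, but it needs no fundamental domain.\<close>

lemma exists_mobius_Im_ge:
  obtains a b c d where "a * d - b * c = 1" "Im (Rep_uhp (mobius a b c d \<tau>)) \<ge> 1 / 5"
proof -
  define x where "x = Re (Rep_uhp \<tau>)"
  define y where "y = Im (Rep_uhp \<tau>)"
  have y: "y > 0"
    by (simp add: y_def Im_Rep_uhp)
  show ?thesis
  proof (cases "y \<ge> 1 / 5")
    case True
    then show ?thesis
      using that[of 1 1 0 0] by (simp add: Im_mobius y_def)
  next
    case False
    \<comment> \<open>The size aimed at for the automorphy factor. With \<open>N\<close> close to
      \<open>1 / s\<close>, Dirichlet makes \<open>k * x - h\<close> at most \<open>s\<close> in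
      absolute value while \<open>k * s\<close> stays at most 3/2, so the squared modulus is at most
      \<open>y + 9 / 4 * y\<close>.\<close>
    define s where "s = sqrt y"
    have s: "s > 0" "s\<^sup>2 = y"
      using y by (simp_all add: s_def)
    have "s < 1 / 2"
    proof (rule ccontr)
      assume "\<not> s < 1 / 2"
      then have "(1 / 2)\<^sup>2 \<le> s\<^sup>2"
        by (intro power_mono) auto
      then show False
        using False s(2) by (simp add: power2_eq_square)
    qed
    define N where "N = nat \<lceil>1 / s\<rceil>"
    have N1: "1 / s \<le> N" "real N \<le> 1 / s + 1"
      using s(1) by (simp_all add: N_def)
    have "1 / s > 0"
      using s by simp
    then have N0: "N > 0"
      using N1 by (metis gr0I of_nat_0 not_le)
    have N2: "real N * s \<le> 3 / 2"
    proof -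
      have "real N * s \<le> (1 / s + 1) * s"
        using N1 s by (intro mult_right_mono) auto
      also have "\<dots> = 1 + s"
        using s by (simp add: distrib_right)
      finally show ?thesis
        using \<open>s < 1 / 2\<close> by simp
    qed
    obtain h k where hk: "coprime h k" "0 < k" "k \<le> int N" "\<bar>of_int k * x - of_int h\<bar> < 1 / N"
      using Dirichlet_approx_coprime[OF N0] by metis
    obtain u v where "u * h + v * k = 1"
      using bezout_int[of h k] hk(1) by auto
    then have det: "(- u) * (- h) - (- v) * k = 1"
      by (simp add: algebra_simps)
    have "1 / real N \<le> s"
      using N1 N0 s by (simp add: field_simps)
    then have 1: "(of_int k * x - of_int h)\<^sup>2 \<le> y"
      using hk(4) s by (metis abs_ge_zero less_imp_le order_trans power2_abs power_mono)
    have "of_int k * s \<le> 3 / 2"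
    proof -
      have "real_of_int k \<le> real N"
        using hk(3) by (metis of_int_le_iff of_int_of_nat_eq)
      then have "of_int k * s \<le> real N * s"
        using s by (intro mult_right_mono) auto
      with N2 show ?thesis
        by simp
    qed
    then have "(of_int k * s)\<^sup>2 \<le> (3 / 2)\<^sup>2"
      using s hk(2) by (intro power_mono) auto
    then have 2: "(of_int k)\<^sup>2 * y \<le> 9 / 4"
      unfolding power_mult_distrib s(2) by (simp add: power2_eq_square)
    have "(cmod (of_int k * Rep_uhp \<tau> + of_int (- h)))\<^sup>2 = (of_int k * x - of_int h)\<^sup>2 + (of_int k)\<^sup>2 * y * y"
      unfolding cmod_power2 by (simp add: x_def y_def power2_eq_square)
    also have "\<dots> \<le> y + 9 / 4 * y"
      using 1 2 y by (intro add_mono mult_right_mono) auto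
    also have "\<dots> \<le> 5 * y"
      using y by simp
    finally have le: "(cmod (of_int k * Rep_uhp \<tau> + of_int (- h)))\<^sup>2 \<le> 5 * y" .
    have "of_int k * Rep_uhp \<tau> + of_int (- h) \<noteq> 0"
    proof
      assume "of_int k * Rep_uhp \<tau> + of_int (- h) = 0"
      then have "Im (of_int k * Rep_uhp \<tau> + of_int (- h)) = 0"
        by simp
      then show False
        using hk(2) y by (simp add: y_def)
    qed
    then have "Im (Rep_uhp (mobius (- u) (- v) k (- h) \<tau>)) \<ge> 1 / 5"
      unfolding Im_mobius[OF det] using le by (simp add: field_simps y_def)
    then show ?thesis
      using that det by blast
  qed
qed

lemma exp_surj_punctured_disc:
  assumes "w \<noteq> 0" "cmod w < 1"
  obtains \<tau> where "nome \<tau> = w"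
    "Im (Rep_uhp \<tau>) = - ln (cmod w) / (2 * pi)"
proof -
  define u where "u = Ln w / (2 * pi * \<i>)"
  have "Im u = - ln (cmod w) / (2 * pi)"
    using assms by (simp add: u_def Im_divide power2_eq_square)
  moreover have "ln (cmod w) < 0"
    using assms by simp
  ultimately have "Im u > 0"
    by (simp add: divide_neg_pos)
  moreover have "exp (2 * pi * \<i> * u) = w"
    using assms by (simp add: u_def)
  ultimately show ?thesis
    using that[of "Abs_uhp u"] \<open>Im u = _\<close> by (simp add: Rep_Abs_uhp)
qed

lemma norm_exp_2pi_i: "cmod (exp (2 * pi * \<i> * w)) = exp (- 2 * pi * Im w)"
  by (simp add: norm_exp_eq_Re)

text \<open>Reducing to \<open>Im \<tau> \<ge> 1/5\<close> bounds \<open>h \<tau>\<close> by a positive power of \<open>Im \<tau>\<close>, so \<open>h\<close>, as a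
  function of the nome, tends to zero at the unit circle.\<close>

lemma negative_weight_zero:
  assumes k: "k < 0"
    and law: "\<And>a b c d \<tau>. a * d - b * c = 1 \<Longrightarrow>
      h (mobius a b c d \<tau>) = (of_int c * Rep_uhp \<tau> + of_int d) powi k * h \<tau>"
    and sums: "\<And>\<tau>. (\<lambda>n. a n * nome \<tau> ^ n) sums h \<tau>"
  shows "h \<tau> = 0"
proof -
  define H where "H w = suminf (\<lambda>n. a n * w ^ n)" for w
  have sumsH: "(\<lambda>n. a n * w ^ n) sums H w" if "cmod w < 1" for w
  proof (cases "w = 0")
    case True
    then show ?thesis
      unfolding H_def by (simp add: sums_iff)
  next
    case False
    then obtain \<tau> where "nome \<tau> = w"
      using exp_surj_punctured_disc \<open>cmod w < 1\<close> by blast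
    then show ?thesis
      using sums[of \<tau>] unfolding H_def by (simp add: sums_iff)
  qed
  have hH: "h \<tau> = H (nome \<tau>)" for \<tau>
    using sums[of \<tau>] unfolding H_def by (simp add: sums_iff)
  have hol: "H holomorphic_on ball 0 1"
    by (rule power_series_holomorphic[where a = a]) (use sumsH in simp)
  \<comment> \<open>The bound for the modulus of the nome on Im \<tau> \<ge> 1/5.\<close>
  define r0 where "r0 = exp (- 2 * pi / 5)"
  have "r0 < 1"
    by (simp add: r0_def)
  then have "continuous_on (cball 0 r0) H"
    by (intro holomorphic_on_imp_continuous_on holomorphic_on_subset[OF hol]) auto
  then have "compact (H ` cball 0 r0)"
    by (intro compact_continuous_image) auto
  then obtain B where B: "\<And>w. cmod w \<le> r0 \<Longrightarrow> cmod (H w) \<le> B" "B > 0"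
    using compact_imp_bounded bounded_pos by (metis image_eqI mem_cball_0)
  define m where "m = nat (- k)"
  have m: "m > 0" "k = - int m"
    using k by (simp_all add: m_def)
  have bound: "cmod (h \<tau>) \<le> B * sqrt (5 * Im (Rep_uhp \<tau>)) ^ m" for \<tau>
  proof -
    obtain a b c d where det: "a * d - b * c = 1" and Im: "Im (Rep_uhp (mobius a b c d \<tau>)) \<ge> 1 / 5"
      by (rule exists_mobius_Im_ge)
    define j where "j = of_int c * Rep_uhp \<tau> + of_int d"
    have j: "j \<noteq> 0"
    proof
      assume "j = 0"
      then show False
        using Im Im_mobius[OF det, of \<tau>] by (simp add: j_def)
    qed
    have "(cmod j)\<^sup>2 \<le> 5 * Im (Rep_uhp \<tau>)"
      using Im Im_mobius[OF det, of \<tau>, folded j_def] j by (simp add: field_simps)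
    then have le: "cmod j \<le> sqrt (5 * Im (Rep_uhp \<tau>))"
      by (rule real_le_rsqrt)
    have "cmod (exp (2 * pi * \<i> * Rep_uhp (mobius a b c d \<tau>))) \<le> r0"
      unfolding norm_exp_2pi_i r0_def using Im by simp
    then have "cmod (h (mobius a b c d \<tau>)) \<le> B"
      unfolding hH by (rule B)
    moreover have "h \<tau> = j ^ m * h (mobius a b c d \<tau>)"
      using law[OF det, of \<tau>, folded j_def] j by (simp add: m power_int_minus field_simps)
    ultimately have "cmod (h \<tau>) \<le> cmod j ^ m * B"
      by (simp add: norm_mult norm_power mult_left_mono)
    also have "\<dots> \<le> sqrt (5 * Im (Rep_uhp \<tau>)) ^ m * B"
      using le B(2) by (intro mult_right_mono power_mono) auto
    finally show ?thesis
      by (simp add: mult.commute)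
  qed
  have "H w = 0" if w: "cmod w < 1" for w
  proof -
    \<comment> \<open>On the circle of radius r the imaginary part of \<tau> is - ln r / (2 pi), so
      \<open>bound\<close> becomes \<open>?g r\<close>. The maximum principle carries it inside, and
      it tends to 0 as r tends to 1 because \<open>m\<close> is positive.\<close>
    let ?g = "\<lambda>r. B * sqrt (5 * (- ln r / (2 * pi))) ^ m"
    have "cmod (H w) \<le> ?g r" if r: "r \<in> {cmod w<..<1}" for r
    proof (rule maximum_modulus_frontier[where S = "cball 0 r" and f = H])
      have r0: "0 < r"
        using r norm_ge_zero[of w] by (auto simp del: norm_ge_zero)
      show "H holomorphic_on interior (cball 0 r)"
        by (rule holomorphic_on_subset[OF hol]) (use r in auto)
      show "continuous_on (closure (cball 0 r)) H"
        by (intro holomorphic_on_imp_continuous_on holomorphic_on_subset[OF hol]) (use r in auto)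
      show "w \<in> cball 0 r"
        using r by simp
      fix v :: complex assume "v \<in> frontier (cball 0 r)"
      then have v: "cmod v = r"
        by (simp add: frontier_cball)
      then have "v \<noteq> 0" "cmod v < 1"
        using r r0 by auto
      then obtain \<tau> where "nome \<tau> = v"
        "Im (Rep_uhp \<tau>) = - ln (cmod v) / (2 * pi)"
        by (rule exp_surj_punctured_disc)
      then show "cmod (H v) \<le> ?g r"
        using bound[of \<tau>] hH[of \<tau>] v by simp
    qed simp
    then have "\<forall>\<^sub>F r in at_left 1. cmod (H w) \<le> ?g r"
      using w by (auto simp: eventually_at_left_field intro!: exI[of _ "cmod w"])
    moreover have "(?g \<longlongrightarrow> B * sqrt (5 * (- ln 1 / (2 * pi))) ^ m) (at_left 1)"
      by (intro tendsto_intros) auto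
    ultimately have "cmod (H w) \<le> B * sqrt (5 * (- ln 1 / (2 * pi))) ^ m"
      by (intro tendsto_lowerbound) auto
    then show ?thesis
      using m(1) by (simp add: zero_power)
  qed
  moreover have "cmod (nome \<tau>) < 1"
    unfolding norm_exp_2pi_i using Im_Rep_uhp[of \<tau>] by simp
  ultimately show ?thesis
    using hH by simp
qed

lemma modular_form_negative_weight:
  assumes "modular_form k f" "k < 0"
  shows "f = 0"
proof
  fix \<tau>
  obtain a where sums: "\<And>\<tau>. (\<lambda>n. a n * nome \<tau> ^ n) sums f \<tau>"
    using assms(1) unfolding modular_form_def by blast
  have law: "f (mobius a b c d \<tau>) = (of_int c * Rep_uhp \<tau> + of_int d) powi k * f \<tau>"
    if "a * d - b * c = 1" for a b c d \<tau>
    using assms(1) that unfolding modular_form_def by blast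
  have "f \<tau> = 0"
    by (rule negative_weight_zero[OF assms(2) law sums])
  then show "f \<tau> = 0 \<tau>"
    by simp
qed

section \<open>Holomorphy of Fourier expansions\<close>

lemma has_sum_sum:
  fixes f :: "'i \<Rightarrow> 'a \<Rightarrow> 'b::topological_comm_monoid_add"
  assumes "\<And>i. i \<in> I \<Longrightarrow> (f i has_sum s i) A"
  shows "((\<lambda>x. \<Sum>i\<in>I. f i x) has_sum (\<Sum>i\<in>I. s i)) A"
  using assms by (induction I rule: infinite_finite_induct) (auto intro!: has_sum_add)

lemma summable_on_norm_complex:
  fixes f :: "'a \<Rightarrow> complex"
  assumes "(f has_sum s) A"
  shows "(\<lambda>x. norm (f x)) summable_on A"
  using has_sum_imp_summable[OF assms] summable_on_iff_abs_summable_on_complex by blast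

lemma has_sum_diff:
  fixes f g :: "'a \<Rightarrow> complex"
  assumes "(f has_sum a) A" "(g has_sum b) A"
  shows "((\<lambda>x. f x - g x) has_sum (a - b)) A"
  using has_sum_add[OF assms(1) has_sum_uminusI[OF assms(2)]] by simp

text \<open>Linear in the pair of variables: each term of an expansion is the exponential of a
  linear form and differentiates to itself times that form.\<close>

definition fourier_exponent :: "nat \<times> (real^8) \<Rightarrow> complex \<times> (complex^8) \<Rightarrow> complex" where
  "fourier_exponent p h = 2 * pi * \<i> * (of_nat (fst p) * fst h + cdot (cvec (snd p)) (snd h))"

lemma jacobi_expansion_exp:
  assumes "jacobi_expansion f \<phi>" "Im w > 0"
  shows "((\<lambda>p. f (fst p) (snd p) * exp (fourier_exponent p (w, z))) has_sum \<phi> (Abs_uhp w) z) (UNIV \<times> E8)"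
proof -
  have "exp (2 * pi * \<i> * w) ^ n * exp (2 * pi * \<i> * cdot (cvec l) z) = exp (fourier_exponent (n, l) (w, z))" for n l
    by (simp add: fourier_exponent_def distrib_left exp_add exp_of_nat_mult[symmetric] mult_ac)
  then show ?thesis
    using jacobi_expansionD[OF assms(1), of "Abs_uhp w" z] assms(2)
    by (simp add: Rep_Abs_uhp case_prod_unfold mult.assoc)
qed

lemma fourier_exponent_add: "fourier_exponent p (h + h') = fourier_exponent p h + fourier_exponent p h'"
  by (simp add: fourier_exponent_def cdot_simps distrib_left)

lemma fourier_exponent_cmult: "fourier_exponent p (c * w, c *s v) = c * fourier_exponent p (w, v)"
  by (simp add: fourier_exponent_def cdot_simps algebra_simps)

lemma fourier_exponent_scaleR: "fourier_exponent p (r *\<^sub>R h) = r *\<^sub>R fourier_exponent p h"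
proof -
  have "r *\<^sub>R h = (of_real r * fst h, of_real r *s snd h)"
    by (simp add: prod_eq_iff vec_eq_iff) (simp add: scaleR_conv_of_real)
  then show ?thesis
    using fourier_exponent_cmult[of p "of_real r" "fst h" "snd h"] by (simp add: scaleR_conv_of_real)
qed

text \<open>The l1 norm of the frequency is chosen because sign vectors realise it exactly in
  \<open>jacobi_expansion_dominated\<close>.\<close>

lemma norm_fourier_exponent:
  "norm (fourier_exponent p h) \<le> 2 * pi * (real (fst p) + (\<Sum>i\<in>UNIV. \<bar>snd p $ i\<bar>)) * norm h"
proof -
  have "norm (cdot (cvec (snd p)) (snd h)) \<le> (\<Sum>i\<in>UNIV. \<bar>snd p $ i\<bar> * norm h)"
    unfolding cdot_def
  proof (rule sum_norm_le)
    fix i :: 8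
    have "norm (snd h $ i) \<le> norm h"
      using Finite_Cartesian_Product.norm_nth_le[of "snd h" i] norm_snd_le[of "snd h" "fst h"] by simp
    then show "norm (cvec (snd p) $ i * snd h $ i) \<le> \<bar>snd p $ i\<bar> * norm h"
      by (simp add: norm_mult cvec_def mult_left_mono)
  qed
  moreover have "norm (of_nat (fst p) * fst h) \<le> real (fst p) * norm h"
    by (simp add: norm_mult mult_left_mono norm_fst_le[of "fst h" "snd h", simplified])
  ultimately have "norm (of_nat (fst p) * fst h + cdot (cvec (snd p)) (snd h)) \<le>
      (real (fst p) + (\<Sum>i\<in>UNIV. \<bar>snd p $ i\<bar>)) * norm h"
    by (intro norm_triangle_le) (simp add: distrib_right sum_distrib_right)
  then show ?thesis
    by (simp add: fourier_exponent_def norm_mult mult.assoc mult_left_mono)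
qed

lemma norm_exp_minus_1_minus:
  fixes u :: complex
  shows "norm (exp u - 1 - u) \<le> exp (norm u) * (norm u)\<^sup>2"
  using Taylor_exp_field[of u 1] by (simp add: numeral_2_eq_2 algebra_simps)

text \<open>The factor \<open>exp (\<delta> M)\<close> is dominated by a finite sum of values of the same series at shifted
  points, one for each sign vector, so everywhere-convergence already gives locally uniform control.\<close>

lemma jacobi_expansion_dominated:
  assumes f: "jacobi_expansion f \<phi>" and \<delta>: "\<delta> > 0" "\<delta> < Im w"
  shows "(\<lambda>p. norm (f (fst p) (snd p) * exp (fourier_exponent p (w, z))) *
      exp (\<delta> * (2 * pi * (real (fst p) + (\<Sum>i\<in>UNIV. \<bar>snd p $ i\<bar>))))) summable_on (UNIV \<times> E8)"
proof -
  \<comment> \<open>If \<open>S\<close> is the set of nonnegative coordinates of the frequency, this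
    imaginary shift adds 2 pi \<delta> times the absolute value of each coordinate to the exponent.
    The shift of \<open>w\<close> by - i \<delta> does the same for the power of the nome.\<close>
  define v :: "8 set \<Rightarrow> complex^8" where "v S = (\<chi> i. if i \<in> S then - \<i> * \<delta> else \<i> * \<delta>)" for S
  define g where "g S p = norm (f (fst p) (snd p) * exp (fourier_exponent p (w - \<i> * \<delta>, z + v S)))" for S p
  have g: "g S summable_on (UNIV \<times> E8)" for S
    unfolding g_def by (rule summable_on_norm_complex[OF jacobi_expansion_exp[OF f]]) (use \<delta> in simp)
  have "(\<lambda>p. \<Sum>S\<in>UNIV. g S p) summable_on (UNIV \<times> E8)"
    by (rule has_sum_imp_summable[OF has_sum_sum]) (rule has_sum_infsum[OF g])
  then show ?thesis
  proof (rule summable_on_comparison_test)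
    fix p :: "nat \<times> (real^8)"
    define S where "S = {i. snd p $ i \<ge> 0}"
    have "cdot (cvec (snd p)) (v S) = - \<i> * \<delta> * of_real (\<Sum>i\<in>UNIV. \<bar>snd p $ i\<bar>)"
      by (simp add: cdot_def v_def S_def cvec_def sum_distrib_left sum_negf[symmetric] del: sum_negf)
        (intro sum.cong refl, auto)
    then have "fourier_exponent p (w - \<i> * \<delta>, z + v S) =
        fourier_exponent p (w, z) + of_real (\<delta> * (2 * pi * (real (fst p) + (\<Sum>i\<in>UNIV. \<bar>snd p $ i\<bar>))))"
      by (simp add: fourier_exponent_def cdot_simps algebra_simps)
    then have "norm (f (fst p) (snd p) * exp (fourier_exponent p (w, z))) *
        exp (\<delta> * (2 * pi * (real (fst p) + (\<Sum>i\<in>UNIV. \<bar>snd p $ i\<bar>)))) = g S p"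
      unfolding g_def by (simp only: exp_add norm_mult exp_of_real norm_of_real abs_exp_cancel mult.assoc)
    also have "\<dots> \<le> (\<Sum>S\<in>UNIV. g S p)"
      by (rule member_le_sum) (auto simp: g_def)
    finally show "norm (f (fst p) (snd p) * exp (fourier_exponent p (w, z))) *
        exp (\<delta> * (2 * pi * (real (fst p) + (\<Sum>i\<in>UNIV. \<bar>snd p $ i\<bar>)))) \<le> (\<Sum>S\<in>UNIV. g S p)" .
  qed simp
qed

text \<open>Termwise differentiation, with the remainder controlled by the second-order Taylor bound
  for exp. Complex linearity of the derivative is inherited from the terms.\<close>

lemma jacobi_expansion_holomorphic:
  assumes f: "jacobi_expansion f \<phi>"
  shows "jacobi_holomorphic \<phi>"
  unfolding jacobi_holomorphic_def
proof (intro allI)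
  fix \<tau> and z :: "complex^8"
  define x where "x = (Rep_uhp \<tau>, z)"
  define I :: "(nat \<times> (real^8)) set" where "I = UNIV \<times> E8"
  define F where "F p = f (fst p) (snd p) * exp (fourier_exponent p x)" for p
  define M where "M p = 2 * pi * (real (fst p) + (\<Sum>i\<in>UNIV. \<bar>snd p $ i\<bar>))" for p :: "nat \<times> (real^8)"
  \<comment> \<open>Half the imaginary part, so that the shifted point of the majorant stays in the
    upper half-plane.\<close>
  define \<delta> where "\<delta> = Im (Rep_uhp \<tau>) / 2"
  define K where "K p = norm (F p) * exp (\<delta> * M p)" for p
  have \<delta>: "\<delta> > 0" "\<delta> < Im (Rep_uhp \<tau>)"
    using Im_Rep_uhp[of \<tau>] by (simp_all add: \<delta>_def)
  have M0: "M p \<ge> 0" for p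
    by (simp add: M_def sum_nonneg)
  have K: "K summable_on I"
    using jacobi_expansion_dominated[OF f \<delta>, of z] unfolding K_def F_def M_def x_def I_def .
  have lam: "norm (fourier_exponent p h) \<le> M p * norm h" for p h
    unfolding M_def by (rule norm_fourier_exponent)
  have M1: "M p \<le> exp (\<delta> * M p) / \<delta>" for p
  proof -
    have "\<delta> * M p \<le> exp (\<delta> * M p)"
      using exp_ge_add_one_self[of "\<delta> * M p"] by linarith
    then show ?thesis
      using \<delta> by (simp add: field_simps)
  qed
  \<comment> \<open>Half of the available exponent \<open>\<delta> * M p\<close> absorbs the square
    of \<open>M p\<close> from the Taylor remainder. The other half is kept for the exponential of
    an increment shorter than \<delta>/2.\<close>
  have M2: "(M p)\<^sup>2 * exp (\<delta> / 2 * M p) \<le> 16 / \<delta>\<^sup>2 * exp (\<delta> * M p)" for p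
  proof -
    have "\<delta> / 4 * M p \<le> exp (\<delta> / 4 * M p)"
      using exp_ge_add_one_self[of "\<delta> / 4 * M p"] by linarith
    then have "(\<delta> / 4 * M p)\<^sup>2 \<le> (exp (\<delta> / 4 * M p))\<^sup>2"
      using \<delta> M0[of p] by (intro power_mono) auto
    also have "\<dots> = exp (\<delta> / 2 * M p)"
      by (simp add: exp_double[symmetric])
    finally have "(M p)\<^sup>2 * \<delta>\<^sup>2 \<le> 16 * exp (\<delta> / 2 * M p)"
      by (simp add: power_mult_distrib power_divide mult_ac)
    then have "(M p)\<^sup>2 \<le> 16 / \<delta>\<^sup>2 * exp (\<delta> / 2 * M p)"
      using \<delta> by (simp add: field_simps)
    then have "(M p)\<^sup>2 * exp (\<delta> / 2 * M p) \<le> 16 / \<delta>\<^sup>2 * exp (\<delta> / 2 * M p) * exp (\<delta> / 2 * M p)"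
      by (rule mult_right_mono) simp
    also have "\<dots> = 16 / \<delta>\<^sup>2 * exp (\<delta> * M p)"
      by (simp add: mult.assoc exp_add[symmetric])
    finally show ?thesis .
  qed
  define D where "D h = infsum (\<lambda>p. F p * fourier_exponent p h) I" for h
  have D_bound: "norm (F p * fourier_exponent p h) \<le> K p * (norm h / \<delta>)" for p h
  proof -
    have "norm (F p * fourier_exponent p h) \<le> norm (F p) * (exp (\<delta> * M p) / \<delta> * norm h)"
      unfolding norm_mult by (intro mult_left_mono order_trans[OF lam mult_right_mono[OF M1]]) auto
    then show ?thesis
      by (simp add: K_def)
  qed
  have D_summable: "(\<lambda>p. F p * fourier_exponent p h) summable_on I" for h
    by (rule abs_summable_summable, rule Infinite_Sum.abs_summable_on_comparison_test'[OF summable_on_cmult_left[OF K] D_bound])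
  have D_linear: "bounded_linear D"
  proof (rule bounded_linear_intro)
    fix h h' and r :: real
    show "D (h + h') = D h + D h'"
      unfolding D_def fourier_exponent_add distrib_left
      by (rule infsum_add) (rule D_summable)+
    show "D (r *\<^sub>R h) = r *\<^sub>R D h"
      unfolding D_def fourier_exponent_scaleR
      using infsum_scaleR_right[of r "\<lambda>p. F p * fourier_exponent p h" I] by simp
    have "norm (D h) \<le> infsum (\<lambda>p. K p * (norm h / \<delta>)) I"
      unfolding D_def
      by (rule norm_infsum_le[OF has_sum_infsum[OF D_summable] has_sum_infsum[OF summable_on_cmult_left[OF K]] D_bound])
    also have "\<dots> = infsum K I * (norm h / \<delta>)"
      by (rule infsum_cmult_left')
    finally show "norm (D h) \<le> norm h * (infsum K I / \<delta>)"
      by (simp add: mult_ac)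
  qed
  have "((\<lambda>(w, v). \<phi> (Abs_uhp w) v) has_derivative D) (at x)"
  proof (rule has_derivativeI_sandwich[where H = "\<lambda>y. 16 / \<delta>\<^sup>2 * infsum K I * norm (y - x)"])
    show "\<delta> / 2 > 0"
      using \<delta> by simp
    fix y :: "complex \<times> (complex^8)"
    assume "y \<noteq> x" and "dist y x < \<delta> / 2"
    define h where "h = y - x"
    have h: "norm h < \<delta> / 2" "h \<noteq> 0" "y = x + h"
      using \<open>dist y x < \<delta> / 2\<close> \<open>y \<noteq> x\<close> by (simp_all add: h_def dist_norm)
    have "\<bar>Im (fst h)\<bar> \<le> norm h"
      using abs_Im_le_cmod[of "fst h"] norm_fst_le[of "fst h" "snd h"] by simp
    then have "Im (fst y) > 0"
      using h \<delta> by (simp add: x_def)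
    then have 1: "((\<lambda>p. f (fst p) (snd p) * exp (fourier_exponent p y)) has_sum (case y of (w, v) \<Rightarrow> \<phi> (Abs_uhp w) v)) I"
      using jacobi_expansion_exp[OF f, of "fst y" "snd y"] by (simp add: case_prod_unfold I_def)
    have 2: "((\<lambda>p. F p) has_sum (case x of (w, v) \<Rightarrow> \<phi> (Abs_uhp w) v)) I"
      using jacobi_expansion_exp[OF f Im_Rep_uhp, of \<tau> z] by (simp add: F_def x_def I_def)
    have 3: "((\<lambda>p. F p * fourier_exponent p h) has_sum D h) I"
      unfolding D_def by (rule has_sum_infsum[OF D_summable])
    have 4: "f (fst p) (snd p) * exp (fourier_exponent p y) - F p - F p * fourier_exponent p h =
        F p * (exp (fourier_exponent p h) - 1 - fourier_exponent p h)" for p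
      unfolding h(3) fourier_exponent_add exp_add F_def by (simp add: algebra_simps)
    have 5: "((\<lambda>p. F p * (exp (fourier_exponent p h) - 1 - fourier_exponent p h)) has_sum
        ((case y of (w, v) \<Rightarrow> \<phi> (Abs_uhp w) v) - (case x of (w, v) \<Rightarrow> \<phi> (Abs_uhp w) v) - D h)) I"
      using has_sum_diff[OF has_sum_diff[OF 1 2] 3] unfolding 4 .
    have 6: "norm (F p * (exp (fourier_exponent p h) - 1 - fourier_exponent p h)) \<le> K p * (16 / \<delta>\<^sup>2 * (norm h)\<^sup>2)" for p
    proof -
      have "norm (fourier_exponent p h) \<le> \<delta> / 2 * M p"
        using lam[of p h] h(1) M0[of p] by (smt (verit) mult.commute mult_left_mono)
      then have "exp (norm (fourier_exponent p h)) * (norm (fourier_exponent p h))\<^sup>2 \<le> exp (\<delta> / 2 * M p) * (M p * norm h)\<^sup>2"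
        using lam[of p h] by (intro mult_mono power_mono) auto
      also have "\<dots> = (M p)\<^sup>2 * exp (\<delta> / 2 * M p) * (norm h)\<^sup>2"
        by (simp add: power_mult_distrib mult_ac)
      also have "\<dots> \<le> 16 / \<delta>\<^sup>2 * exp (\<delta> * M p) * (norm h)\<^sup>2"
        by (rule mult_right_mono[OF M2]) simp
      finally have "norm (exp (fourier_exponent p h) - 1 - fourier_exponent p h) \<le> 16 / \<delta>\<^sup>2 * exp (\<delta> * M p) * (norm h)\<^sup>2"
        using norm_exp_minus_1_minus[of "fourier_exponent p h"] by linarith
      then have "norm (F p) * norm (exp (fourier_exponent p h) - 1 - fourier_exponent p h) \<le>
          norm (F p) * (16 / \<delta>\<^sup>2 * exp (\<delta> * M p) * (norm h)\<^sup>2)"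
        by (rule mult_left_mono) simp
      then show ?thesis
        by (simp add: norm_mult K_def mult_ac)
    qed
    have "norm ((case y of (w, v) \<Rightarrow> \<phi> (Abs_uhp w) v) - (case x of (w, v) \<Rightarrow> \<phi> (Abs_uhp w) v) - D h)
        \<le> infsum (\<lambda>p. K p * (16 / \<delta>\<^sup>2 * (norm h)\<^sup>2)) I"
      by (rule norm_infsum_le[OF 5 has_sum_infsum[OF summable_on_cmult_left[OF K]] 6])
    also have "\<dots> = infsum K I * (16 / \<delta>\<^sup>2 * (norm h)\<^sup>2)"
      by (rule infsum_cmult_left')
    also have "\<dots> = 16 / \<delta>\<^sup>2 * infsum K I * norm h * norm h"
      by (simp add: power2_eq_square mult_ac)
    finally show "norm ((case y of (w, v) \<Rightarrow> \<phi> (Abs_uhp w) v) - (case x of (w, v) \<Rightarrow> \<phi> (Abs_uhp w) v) - D (y - x)) / norm (y - x)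
        \<le> 16 / \<delta>\<^sup>2 * infsum K I * norm (y - x)"
      using h(2) \<delta>(1) unfolding h_def[symmetric] by (simp add: pos_divide_le_eq)
  next
    show "((\<lambda>y. 16 / \<delta>\<^sup>2 * infsum K I * norm (y - x)) \<longlongrightarrow> 0) (at x)"
      using \<delta>(1) by (auto intro!: tendsto_eq_intros)
  qed (rule D_linear)
  moreover have "D (c * w, c *s v) = c * D (w, v)" for c w v
    unfolding D_def fourier_exponent_cmult
    using infsum_cmult_right'[of c "\<lambda>p. F p * fourier_exponent p (w, v)" I] by (simp add: mult.left_commute)
  ultimately show "\<exists>D. ((\<lambda>(w, v). \<phi> (Abs_uhp w) v) has_derivative D) (at (Rep_uhp \<tau>, z)) \<and>
      (\<forall>c w v. D (c * w, c *s v) = c * D (w, v))"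
    unfolding x_def by blast
qed

section \<open>Products and uniqueness of Fourier expansions\<close>

text \<open>The sum runs over all of \<open>E8\<close>, as no finiteness in the frequency is assumed
  for a fixed power of the nome.\<close>

definition fourier_convolution :: "(nat \<Rightarrow> real^8 \<Rightarrow> complex) \<Rightarrow> (nat \<Rightarrow> real^8 \<Rightarrow> complex) \<Rightarrow> nat \<Rightarrow> real^8 \<Rightarrow> complex" where
  "fourier_convolution f g n l = (\<Sum>\<^sub>\<infinity>p\<in>{..n} \<times> E8. f (fst p) (snd p) * g (n - fst p) (l - snd p))"

text \<open>Unordered summability of complex families is absolute, so the double family is
  absolutely summable.\<close>

lemma has_sum_product_complex:
  fixes f :: "'a \<Rightarrow> complex"
  assumes f: "(f has_sum a) A" and g: "(g has_sum b) B"
  shows "((\<lambda>(x, y). f x * g y) has_sum a * b) (A \<times> B)"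
proof (rule has_sum_SigmaI[where g = "\<lambda>x. f x * b"])
  show "((\<lambda>y. case (x, y) of (x, y) \<Rightarrow> f x * g y) has_sum f x * b) B" if "x \<in> A" for x
    using has_sum_cmult_right[OF g, of "f x"] by simp
  show "((\<lambda>x. f x * b) has_sum a * b) A"
    by (rule has_sum_cmult_left[OF f])
  have "(\<lambda>p. norm (case p of (x, y) \<Rightarrow> f x * g y)) summable_on A \<times> B"
  proof (rule Infinite_Sum.abs_summable_on_Sigma_iff[THEN iffD2], intro conjI ballI)
    show "(\<lambda>y. norm (case (x, y) of (x, y) \<Rightarrow> f x * g y)) summable_on B" for x
      using summable_on_cmult_right[OF summable_on_norm_complex[OF g], of "norm (f x)"] by (simp add: norm_mult)
    have "(\<lambda>x. norm (f x) * infsum (\<lambda>y. norm (g y)) B) summable_on A"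
      by (rule summable_on_cmult_left[OF summable_on_norm_complex[OF f]])
    moreover have "norm (f x) * infsum (\<lambda>y. norm (g y)) B \<ge> 0" for x
      by (simp add: infsum_nonneg)
    ultimately show "(\<lambda>x. norm (\<Sum>\<^sub>\<infinity>y\<in>B. norm (case (x, y) of (x, y) \<Rightarrow> f x * g y))) summable_on A"
      by (simp add: norm_mult infsum_cmult_right' abs_mult infsum_nonneg)
  qed
  then show "(\<lambda>(x, y). f x * g y) summable_on Sigma A (\<lambda>_. B)"
    by (rule abs_summable_summable)
qed

lemma jacobi_expansion_mult:
  assumes f: "jacobi_expansion f \<phi>" and g: "jacobi_expansion g \<psi>"
  shows "jacobi_expansion (fourier_convolution f g) (\<lambda>\<tau> z. \<phi> \<tau> z * \<psi> \<tau> z)"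
  unfolding jacobi_expansion_def
proof (intro allI)
  fix \<tau> and z :: "complex^8"
  define I :: "(nat \<times> (real^8)) set" where "I = UNIV \<times> E8"
  define E where "E p = nome \<tau> ^ fst p * exp (2 * pi * \<i> * cdot (cvec (snd p)) z)"
    for p :: "nat \<times> (real^8)"
  define J where "J n l = {..n} \<times> E8" for n :: nat and l :: "real^8"
  have E_add: "E (i + j, k + l) = E (i, k) * E (j, l)" for i j k l
    by (simp add: E_def power_add cvec_add cdot_simps distrib_left exp_add)
  have E0: "E p \<noteq> 0" for p
    by (simp add: E_def)
  have "((\<lambda>(p, r). (f (fst p) (snd p) * E p) * (g (fst r) (snd r) * E r)) has_sum \<phi> \<tau> z * \<psi> \<tau> z) (I \<times> I)"
    by (rule has_sum_product_complex)
      (use jacobi_expansionD[OF f, of \<tau> z] jacobi_expansionD[OF g, of \<tau> z] in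
        \<open>simp_all add: case_prod_unfold E_def mult.assoc I_def\<close>)
  \<comment> \<open>Pairs of terms are indexed by their total exponent \<open>q\<close> and the
    exponent \<open>p\<close> of the first factor.\<close>
  also have "?this \<longleftrightarrow> ((\<lambda>(q, p). f (fst p) (snd p) * g (fst q - fst p) (snd q - snd p) * E q)
      has_sum \<phi> \<tau> z * \<psi> \<tau> z) (Sigma I (\<lambda>q. J (fst q) (snd q)))"
    by (rule has_sum_reindex_bij_witness[where
          j = "\<lambda>(p, r). ((fst p + fst r, snd p + snd r), p)" and
          i = "\<lambda>(q, p). (p, (fst q - fst p, snd q - snd p))"])
      (auto simp: I_def J_def E8_add E8_diff E_add)
  finally have *: "((\<lambda>(q, p). f (fst p) (snd p) * g (fst q - fst p) (snd q - snd p) * E q)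
      has_sum \<phi> \<tau> z * \<psi> \<tau> z) (Sigma I (\<lambda>q. J (fst q) (snd q)))" .
  have "((\<lambda>q. fourier_convolution f g (fst q) (snd q) * E q) has_sum \<phi> \<tau> z * \<psi> \<tau> z) I"
  proof (rule has_sum_SigmaD[OF *])
    fix q assume "q \<in> I"
    then have "(\<lambda>p. f (fst p) (snd p) * g (fst q - fst p) (snd q - snd p) * E q) summable_on J (fst q) (snd q)"
      using summable_on_SigmaD1[OF has_sum_imp_summable[OF *]] by blast
    then have "((\<lambda>p. f (fst p) (snd p) * g (fst q - fst p) (snd q - snd p) * E q) has_sum
        (\<Sum>\<^sub>\<infinity>p\<in>J (fst q) (snd q). f (fst p) (snd p) * g (fst q - fst p) (snd q - snd p) * E q)) (J (fst q) (snd q))"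
      by (rule has_sum_infsum)
    then show "((\<lambda>p. case (q, p) of (q, p) \<Rightarrow> f (fst p) (snd p) * g (fst q - fst p) (snd q - snd p) * E q) has_sum
        fourier_convolution f g (fst q) (snd q) * E q) (J (fst q) (snd q))"
      by (simp add: fourier_convolution_def J_def infsum_cmult_left')
  qed
  then show "((\<lambda>(n, l). fourier_convolution f g n l * nome \<tau> ^ n *
      exp (2 * pi * \<i> * cdot (cvec l) z)) has_sum \<phi> \<tau> z * \<psi> \<tau> z) (UNIV \<times> E8)"
    by (simp add: case_prod_unfold E_def I_def mult.assoc)
qed

text \<open>Used for the cancellation at the cusp: expansions that are constant in z at q^0 multiply
  there like numbers.\<close>

lemma fourier_convolution_delta:
  assumes f: "\<And>l. l \<in> E8 \<Longrightarrow> f 0 l = (if l = 0 then a else 0)"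
    and g: "\<And>l. l \<in> E8 \<Longrightarrow> g 0 l = (if l = 0 then b else 0)" and "l \<in> E8"
  shows "fourier_convolution f g 0 l = (if l = 0 then a * b else 0)"
proof -
  have "fourier_convolution f g 0 l = (\<Sum>\<^sub>\<infinity>p\<in>{(0, 0)}. f (fst p) (snd p) * g (0 - fst p) (l - snd p))"
    unfolding fourier_convolution_def
    by (rule infsum_cong_neutral) (auto simp: f E8_zero split: if_splits)
  then show ?thesis
    using \<open>l \<in> E8\<close> by (simp add: f g E8_zero)
qed

lemma jacobi_expansion_const:
  assumes "\<And>\<tau>. (\<lambda>n. a n * nome \<tau> ^ n) sums h \<tau>"
  shows "jacobi_expansion (\<lambda>n l. if l = 0 then a n else 0) (\<lambda>\<tau> z. h \<tau>)"
  unfolding jacobi_expansion_def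
proof (intro allI)
  fix \<tau> and z :: "complex^8"
  define q where "q = nome \<tau>"
  \<comment> \<open>The hypothesis concerns ordered sums. Absolute convergence follows from
    convergence at \<tau>/2, whose nome has larger modulus.\<close>
  define r where "r = exp (2 * pi * \<i> * (Rep_uhp \<tau> / 2))"
  have "norm q < norm r"
    using Im_Rep_uhp[of \<tau>] by (simp add: q_def r_def norm_exp_eq_Re)
  moreover have "summable (\<lambda>n. a n * r ^ n)"
    using assms[of "Abs_uhp (Rep_uhp \<tau> / 2)"] Im_Rep_uhp[of \<tau>] by (simp add: r_def Rep_Abs_uhp sums_iff)
  ultimately have "summable (\<lambda>n. norm (a n * q ^ n))"
    by (rule powser_insidea[rotated])
  then have "((\<lambda>n. a n * q ^ n) has_sum h \<tau>) UNIV"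
    using assms[of \<tau>] by (intro norm_summable_imp_has_sum) (simp_all add: q_def)
  also have "?this \<longleftrightarrow> ((\<lambda>(n, l::real^8). a n * q ^ n) has_sum h \<tau>) (UNIV \<times> {0})"
    by (rule has_sum_reindex_bij_witness[where i = fst and j = "\<lambda>n. (n, 0)"]) auto
  also have "\<dots> \<longleftrightarrow> ((\<lambda>(n, l). (if l = 0 then a n else 0) * q ^ n * exp (2 * pi * \<i> * cdot (cvec l) z)) has_sum h \<tau>) (UNIV \<times> E8)"
    by (rule has_sum_cong_neutral) (auto simp: E8_zero split: if_splits)
  finally show "((\<lambda>(n, l). (if l = 0 then a n else 0) * nome \<tau> ^ n *
      exp (2 * pi * \<i> * cdot (cvec l) z)) has_sum h \<tau>) (UNIV \<times> E8)"
    unfolding q_def .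
qed

lemma jacobi_expansion_at_zero:
  assumes f: "jacobi_expansion f \<phi>"
  shows "(\<lambda>n. (\<Sum>\<^sub>\<infinity>l\<in>E8. f n l) * nome \<tau> ^ n) sums \<phi> \<tau> 0"
proof -
  have *: "((\<lambda>(n, l). f n l * nome \<tau> ^ n) has_sum \<phi> \<tau> 0) (UNIV \<times> E8)"
    using jacobi_expansionD[OF f, of \<tau> 0] by simp
  have "((\<lambda>n. (\<Sum>\<^sub>\<infinity>l\<in>E8. f n l) * nome \<tau> ^ n) has_sum \<phi> \<tau> 0) UNIV"
  proof (rule has_sum_SigmaD[OF *])
    fix n :: nat
    have "(\<lambda>l. f n l * nome \<tau> ^ n) summable_on E8"
      using summable_on_SigmaD1[OF has_sum_imp_summable[OF *], of n] by simp
    from has_sum_infsum[OF this]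
    show "((\<lambda>l. case (n, l) of (n, l) \<Rightarrow> f n l * nome \<tau> ^ n) has_sum
        (\<Sum>\<^sub>\<infinity>l\<in>E8. f n l) * nome \<tau> ^ n) E8"
      by (simp add: infsum_cmult_left')
  qed
  then show "(\<lambda>n. (\<Sum>\<^sub>\<infinity>l\<in>E8. f n l) * nome \<tau> ^ n) sums \<phi> \<tau> 0"
    by (rule has_sum_imp_sums)
qed

lemma jacobi_expansion_divide_nome:
  assumes f: "jacobi_expansion f \<phi>" and f0: "\<And>l. l \<in> E8 \<Longrightarrow> f 0 l = 0"
  shows "jacobi_expansion (\<lambda>n. f (Suc n)) (\<lambda>\<tau> z. \<phi> \<tau> z / nome \<tau>)"
  unfolding jacobi_expansion_def
proof (intro allI)
  fix \<tau> and z :: "complex^8"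
  define q where "q = nome \<tau>"
  have "q \<noteq> 0"
    by (simp add: q_def)
  have "((\<lambda>(n, l). f n l * q ^ n * exp (2 * pi * \<i> * cdot (cvec l) z)) has_sum \<phi> \<tau> z) (UNIV \<times> E8)"
    using jacobi_expansionD[OF f, of \<tau> z] unfolding q_def .
  also have "?this \<longleftrightarrow> ((\<lambda>(n, l). f n l * q ^ n * exp (2 * pi * \<i> * cdot (cvec l) z)) has_sum \<phi> \<tau> z) ({1..} \<times> E8)"
    by (rule has_sum_cong_neutral) (auto simp: f0 Suc_le_eq intro!: gr0I)
  also have "\<dots> \<longleftrightarrow> ((\<lambda>(n, l). f (Suc n) l * q ^ Suc n * exp (2 * pi * \<i> * cdot (cvec l) z)) has_sum \<phi> \<tau> z) (UNIV \<times> E8)"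
    by (rule has_sum_reindex_bij_witness[where i = "\<lambda>(n, l). (Suc n, l)" and j = "\<lambda>(n, l). (n - 1, l)"])
      (auto simp: Suc_le_eq gr0_conv_Suc)
  finally have "((\<lambda>x. (case x of (n, l) \<Rightarrow> f (Suc n) l * q ^ Suc n * exp (2 * pi * \<i> * cdot (cvec l) z)) * inverse q)
      has_sum \<phi> \<tau> z * inverse q) (UNIV \<times> E8)"
    by (rule has_sum_cmult_left)
  then show "((\<lambda>(n, l). f (Suc n) l * nome \<tau> ^ n * exp (2 * pi * \<i> * cdot (cvec l) z))
      has_sum \<phi> \<tau> z / nome \<tau>) (UNIV \<times> E8)"
    using \<open>q \<noteq> 0\<close> unfolding q_def[symmetric] by (simp add: case_prod_unfold field_simps)
qed

text \<open>Averaging over the grid \<open>(2/N) \<int>\<^sup>8\<close> kills every character whose doubled frequencies are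
  smaller than \<open>N\<close> and not all zero.\<close>

lemma fourier_coefficient_zero:
  fixes a :: "real^8 \<Rightarrow> complex"
  assumes sum: "\<And>y :: real^8. ((\<lambda>l. a l * exp (2 * pi * \<i> * of_real (l \<bullet> y))) has_sum 0) E8"
  shows "a 0 = 0"
proof (rule ccontr)
  assume a0: "a 0 \<noteq> 0"
  have "(a has_sum 0) E8"
    using sum[of 0] by simp
  then have "(\<lambda>l. norm (a l)) summable_on E8"
    by (rule summable_on_norm_complex)
  \<comment> \<open>Outside \<open>F\<close> the coefficients have total mass at most half of
    \<open>norm (a 0)\<close>.\<close>
  from has_sum_finite_approximation[OF has_sum_infsum[OF this], of "norm (a 0) / 2"] a0
  obtain F where F: "finite F" "F \<subseteq> E8" "dist (\<Sum>l\<in>F. norm (a l)) (\<Sum>\<^sub>\<infinity>l\<in>E8. norm (a l)) \<le> norm (a 0) / 2"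
    by auto
  \<comment> \<open>Larger than every doubled coordinate in \<open>F\<close>, so that no nonzero
    frequency of \<open>F\<close> is trivial on the grid.\<close>
  define N where "N = nat (\<Sum>l\<in>F. \<Sum>i\<in>UNIV. \<lceil>2 * \<bar>l $ i\<bar>\<rceil>) + 1"
  have N: "2 * \<bar>l $ i\<bar> < N" if "l \<in> F" for l :: "real^8" and i
  proof -
    have 0: "0 \<le> \<lceil>2 * \<bar>l $ i\<bar>\<rceil>" for l :: "real^8" and i :: 8
      by (simp add: ceiling_mono[of 0, simplified])
    have "\<lceil>2 * \<bar>l $ i\<bar>\<rceil> \<le> (\<Sum>i\<in>UNIV. \<lceil>2 * \<bar>l $ i\<bar>\<rceil>)"
      by (rule member_le_sum) (auto simp: 0)
    also have "\<dots> \<le> (\<Sum>l\<in>F. \<Sum>i\<in>UNIV. \<lceil>2 * \<bar>l $ i\<bar>\<rceil>)"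
      by (rule member_le_sum[OF that]) (auto simp: F intro!: sum_nonneg 0)
    finally have "\<lceil>2 * \<bar>l $ i\<bar>\<rceil> < int N"
      unfolding N_def by linarith
    then have "real_of_int \<lceil>2 * \<bar>l $ i\<bar>\<rceil> < real N"
      by (metis of_int_less_iff of_int_of_nat_eq)
    then show ?thesis
      using le_of_int_ceiling[of "2 * \<bar>l $ i\<bar>"] by linarith
  qed
  have "N > 0"
    by (simp add: N_def)
  \<comment> \<open>The step is 2/N because the frequencies have half-integral coordinates.\<close>
  define Y where "Y j = (\<chi> i. 2 * real (j i) / real N)" for j :: "8 \<Rightarrow> nat"
  define P where "P = PiE (UNIV :: 8 set) (\<lambda>_. {..<N})"
  define c where "c l = (\<Sum>j\<in>P. exp (2 * pi * \<i> * of_real (l \<bullet> Y j))) / of_nat N ^ 8" for l :: "real^8"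
  have cardP: "card P = N ^ 8"
    unfolding P_def by (simp add: card_PiE)
  have c0: "c 0 = 1"
    using \<open>N > 0\<close> by (simp add: c_def cardP)
  have c1: "norm (c l) \<le> 1" for l
  proof -
    have "norm (\<Sum>j\<in>P. exp (2 * pi * \<i> * of_real (l \<bullet> Y j))) \<le> (\<Sum>j\<in>P. 1)"
      by (rule sum_norm_le) (simp add: norm_exp_eq_Re)
    then show ?thesis
      using \<open>N > 0\<close> by (simp add: c_def cardP norm_divide norm_power)
  qed
  have c_zero: "c l = 0" if l: "l \<in> F" "l \<noteq> 0" for l :: "real^8"
  proof -
    obtain i where i: "l $ i \<noteq> 0"
      using l(2) by (auto simp: vec_eq_iff)
    have "2 * l $ i \<in> \<int>"
      using F(2) l(1) by (auto simp: E8_def)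
    then obtain m where m: "2 * l $ i = of_int m"
      by (elim Ints_cases)
    define \<omega> where "\<omega> = exp (2 * pi * \<i> * (of_int m / of_nat N))"
    have "(\<Sum>k<N. \<omega> ^ k) = 0"
    proof -
      have "\<omega> \<noteq> 1"
      proof
        assume "\<omega> = 1"
        then obtain n :: int where "2 * pi * real_of_int m / N = 2 * of_int n * pi"
          unfolding \<omega>_def exp_eq_1 by auto
        then have "real_of_int m = of_int (n * int N)"
          using \<open>N > 0\<close> by (simp add: field_simps)
        then have "m = n * int N"
          by (simp only: of_int_eq_iff)
        moreover have "\<bar>m\<bar> < int N"
        proof -
          have "real_of_int \<bar>m\<bar> = 2 * \<bar>l $ i\<bar>"
            using m by (simp flip: of_int_abs add: abs_mult)
          then show ?thesis
            using N[OF l(1), of i] by linarith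
        qed
        ultimately have "m = 0"
          by (metis abs_mult abs_of_nat dvd_imp_le_int dvd_triv_right linorder_not_le)
        then show False
          using m i by simp
      qed
      moreover have "\<omega> ^ N = exp (2 * pi * \<i> * of_int m)"
        using \<open>N > 0\<close> by (simp add: \<omega>_def exp_of_nat_mult[symmetric])
      ultimately show ?thesis
        using exp_2pi_int[of m] by (simp add: geometric_sum)
    qed
    moreover have "\<omega> ^ k = exp (2 * pi * \<i> * of_real (l $ i * (2 * real k / real N)))" for k
    proof -
      have "l $ i * (2 * real k / real N) = of_int m * real k / real N"
        by (simp flip: m)
      then show ?thesis
        by (simp only:) (simp add: \<omega>_def exp_of_nat_mult[symmetric] mult_ac)
    qed
    ultimately have z: "(\<Sum>k<N. exp (2 * pi * \<i> * of_real (l $ i * (2 * real k / real N)))) = 0"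
      by simp
    have "(\<Sum>j\<in>P. exp (2 * pi * \<i> * of_real (l \<bullet> Y j))) =
        (\<Sum>j\<in>P. \<Prod>i\<in>UNIV. exp (2 * pi * \<i> * of_real (l $ i * (2 * real (j i) / real N))))"
      by (simp add: inner_vec_def Y_def exp_sum[symmetric] sum_distrib_left)
    also have "\<dots> = (\<Prod>i\<in>UNIV. \<Sum>k<N. exp (2 * pi * \<i> * of_real (l $ i * (2 * real k / real N))))"
      unfolding P_def by (rule prod_sum_PiE[symmetric]) auto
    also have "\<dots> = 0"
      using z by (intro prod_zero) auto
    finally show ?thesis
      by (simp add: c_def)
  qed
  have ac: "((\<lambda>l. a l * c l) has_sum 0) E8"
  proof -
    have "((\<lambda>l. \<Sum>j\<in>P. a l * exp (2 * pi * \<i> * of_real (l \<bullet> Y j))) has_sum (\<Sum>j\<in>P. 0)) E8"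
      by (rule has_sum_sum) (rule sum)
    from has_sum_cmult_left[OF this, of "1 / of_nat N ^ 8"] show ?thesis
      by (simp add: c_def sum_distrib_left sum_divide_distrib)
  qed
  have nF: "((\<lambda>l. norm (a l)) has_sum ((\<Sum>\<^sub>\<infinity>l\<in>E8. norm (a l)) - (\<Sum>l\<in>F. norm (a l)))) (E8 - F)"
    by (rule has_sum_Diff[OF has_sum_infsum[OF \<open>(\<lambda>l. norm (a l)) summable_on E8\<close>] _ F(2)])
      (simp add: F(1) has_sum_finiteI)
  have acF: "((\<lambda>l. a l * c l) has_sum (0 - (\<Sum>l\<in>F. a l * c l))) (E8 - F)"
    by (rule has_sum_Diff[OF ac _ F(2)]) (simp add: F(1) has_sum_finiteI)
  have "norm (0 - (\<Sum>l\<in>F. a l * c l)) \<le> (\<Sum>\<^sub>\<infinity>l\<in>E8. norm (a l)) - (\<Sum>l\<in>F. norm (a l))"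
    by (rule norm_infsum_le[OF acF nF]) (simp add: norm_mult mult_left_le c1)
  also have "\<dots> \<le> norm (a 0) / 2"
    using F(3) unfolding dist_real_def by linarith
  finally have le: "norm (\<Sum>l\<in>F. a l * c l) \<le> norm (a 0) / 2"
    by simp
  show False
  proof (cases "0 \<in> F")
    case True
    have "(\<Sum>l\<in>F. a l * c l) = (\<Sum>l\<in>{0}. a l * c l)"
      by (rule sum.mono_neutral_right) (use True F(1) c_zero in auto)
    then show False
      using le c0 a0 by simp
  next
    case False
    \<comment> \<open>Here the coefficient at 0 belongs to the tail itself, which is too small to
      contain it.\<close>
    have "norm (a 0) = (\<Sum>\<^sub>\<infinity>l\<in>{0}. norm (a l))"
      by simp
    also have "\<dots> \<le> (\<Sum>\<^sub>\<infinity>l\<in>E8 - F. norm (a l))"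
      by (rule infsum_mono2) (use nF False E8_zero in \<open>auto dest: has_sum_imp_summable\<close>)
    also have "\<dots> \<le> norm (a 0) / 2"
      using F(3) infsumI[OF nF] unfolding dist_real_def by linarith
    finally show False
      using a0 by simp
  qed
qed

section \<open>Jacobi's theta function\<close>

definition theta_term :: "complex \<Rightarrow> complex \<Rightarrow> int \<Rightarrow> complex" where
  "theta_term w z n = exp (pi * \<i> * (of_int n)\<^sup>2 * w + 2 * pi * \<i> * of_int n * z)"

definition theta :: "complex \<Rightarrow> complex \<Rightarrow> complex" where
  "theta w z = (\<Sum>\<^sub>\<infinity>n. theta_term w z n)"

lemma summable_exp_abs_int: "(\<lambda>n::int. exp (- \<bar>real_of_int n\<bar>)) summable_on UNIV"
proof -
  have s: "(\<lambda>n::nat. exp (- real n)) summable_on UNIV"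
  proof (rule norm_summable_imp_summable_on)
    have "summable (\<lambda>n. exp (-1 :: real) ^ n)"
      by (rule summable_geometric) simp
    then show "summable (\<lambda>n. norm (exp (- real n)))"
      by (simp add: exp_of_nat_mult[symmetric])
  qed
  have 1: "(\<lambda>n::int. exp (- \<bar>real_of_int n\<bar>)) summable_on range int"
    using s by (subst summable_on_reindex) (simp_all add: o_def)
  have 2: "(\<lambda>n::int. exp (- \<bar>real_of_int n\<bar>)) summable_on range (\<lambda>n. - int n)"
    using s by (subst summable_on_reindex) (simp_all add: o_def inj_def)
  have "(UNIV :: int set) = range int \<union> range (\<lambda>n. - int n)"
    by (auto intro: int_cases2)
  then show ?thesis
    using summable_on_union[OF 1 2] by simp
qed

text \<open>Completing the square. The summand 1 in \<open>2 * pi * v + 1\<close> pays for the decay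
  in n, and the constant depends only on \<open>y\<close> and \<open>v\<close>, so the majorant is
  locally uniform.\<close>

lemma norm_theta_term_le:
  assumes y: "y > 0" "y \<le> Im w" and v: "\<bar>Im z\<bar> \<le> v"
  shows "norm (theta_term w z n) \<le> exp ((2 * pi * v + 1)\<^sup>2 / (4 * pi * y)) * exp (- \<bar>real_of_int n\<bar>)"
proof -
  define m where "m = \<bar>real_of_int n\<bar>"
  define b where "b = 2 * pi * v + 1"
  have "- (2 * pi * n * Im z) \<le> 2 * pi * (m * v)"
  proof -
    have "- (n * Im z) \<le> m * \<bar>Im z\<bar>"
      by (metis abs_ge_minus_self abs_mult m_def)
    also have "\<dots> \<le> m * v"
      using v by (intro mult_left_mono) (auto simp: m_def)
    finally have "2 * pi * (- (n * Im z)) \<le> 2 * pi * (m * v)"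
      by (intro mult_left_mono) auto
    then show ?thesis
      by (simp add: mult_ac)
  qed
  moreover have "- (pi * (real_of_int n)\<^sup>2 * Im w) \<le> - (pi * y * m\<^sup>2)"
    using y by (simp add: m_def mult_right_mono mult.commute)
  moreover have "b * m - pi * y * m\<^sup>2 \<le> b\<^sup>2 / (4 * pi * y)"
  proof -
    have "0 \<le> (2 * pi * y * m - b)\<^sup>2"
      by simp
    then have "(b * m - pi * y * m\<^sup>2) * (4 * pi * y) \<le> b\<^sup>2"
      by (simp add: power2_eq_square algebra_simps)
    then show ?thesis
      using y by (simp add: pos_le_divide_eq)
  qed
  moreover have "b * m = 2 * pi * (m * v) + m"
    by (simp add: b_def algebra_simps)
  ultimately have "- (pi * (real_of_int n)\<^sup>2 * Im w) - 2 * pi * n * Im z \<le> b\<^sup>2 / (4 * pi * y) - m"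
    by linarith
  moreover have "Re (pi * \<i> * (of_int n)\<^sup>2 * w + 2 * pi * \<i> * of_int n * z) = - (pi * (real_of_int n)\<^sup>2 * Im w) - 2 * pi * n * Im z"
    by (simp add: power2_eq_square)
  ultimately have "norm (theta_term w z n) \<le> exp (b\<^sup>2 / (4 * pi * y) - m)"
    unfolding theta_term_def norm_exp_eq_Re by (simp only: exp_le_cancel_iff)
  moreover have "exp (b\<^sup>2 / (4 * pi * y) - m) = exp (b\<^sup>2 / (4 * pi * y)) * exp (- m)"
    unfolding exp_add[symmetric] by simp
  ultimately show ?thesis
    unfolding b_def[symmetric] m_def[symmetric] by linarith
qed

lemma theta_abs_summable:
  assumes "Im w > 0"
  shows "(\<lambda>n. norm (theta_term w z n)) summable_on UNIV"
  by (rule Infinite_Sum.abs_summable_on_comparison_test'[OF summable_on_cmult_right[OF summable_exp_abs_int]])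
    (rule norm_theta_term_le[OF assms order_refl order_refl])

lemma theta_has_sum:
  assumes "Im w > 0"
  shows "(theta_term w z has_sum theta w z) UNIV"
  unfolding theta_def using abs_summable_summable[OF theta_abs_summable[OF assms]] by (rule has_sum_infsum)

text \<open>Both arguments are holomorphic functions because the inversion formula is continued in
  each of its two variables.\<close>

lemma theta_holomorphic:
  assumes "open S" and a: "a holomorphic_on S" and b: "b holomorphic_on S"
    and Im: "\<And>x. x \<in> S \<Longrightarrow> Im (a x) > 0"
  shows "(\<lambda>x. theta (a x) (b x)) holomorphic_on S"
proof -
  define f where "f n x = theta_term (a x) (b x) (int_decode n)" for n x
  have sums: "(\<lambda>n. f n x) sums theta (a x) (b x)" if "x \<in> S" for x
  proof -
    have "(f' has_sum s) UNIV \<longleftrightarrow> ((\<lambda>n. f' (int_decode n)) has_sum s) UNIV" for f' :: "int \<Rightarrow> complex" and s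
      using has_sum_reindex_bij_betw[OF bij_int_decode, of f' s] by simp
    then show ?thesis
      using theta_has_sum[OF Im[OF that]] unfolding f_def by (metis has_sum_imp_sums)
  qed
  obtain g where g: "\<And>x. x \<in> S \<Longrightarrow> (\<lambda>n. f n x) sums g x" "\<And>x. x \<in> S \<Longrightarrow> g field_differentiable at x"
  proof (rule series_differentiable_comparison_complex[OF \<open>open S\<close>, of f])
    show "f n field_differentiable at x" if "x \<in> S" for n x
    proof -
      have "(\<lambda>x. f n x) holomorphic_on S"
        unfolding f_def theta_term_def by (intro holomorphic_intros a b)
      then show ?thesis
        using that \<open>open S\<close> by (simp add: holomorphic_on_imp_differentiable_at)
    qed
    show "\<exists>d h. 0 < d \<and> summable h \<and> range h \<subseteq> \<real>\<^sub>\<ge>\<^sub>0 \<and>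
        (\<forall>\<^sub>F n in sequentially. \<forall>y\<in>ball x d \<inter> S. cmod (f n y) \<le> cmod (h n))" if x: "x \<in> S" for x
    proof -
      define y where "y = Im (a x) / 2"
      define v where "v = \<bar>Im (b x)\<bar> + 1"
      have y: "y > 0" "y < Im (a x)"
        using Im[OF x] by (simp_all add: y_def)
      have "isCont (\<lambda>x. Im (a x)) x" "isCont (\<lambda>x. \<bar>Im (b x)\<bar>) x"
        using holomorphic_on_imp_continuous_on[OF a] holomorphic_on_imp_continuous_on[OF b] x \<open>open S\<close>
        by (auto intro!: continuous_intros simp: continuous_on_eq_continuous_at)
      then have "\<forall>\<^sub>F u in nhds x. Im (a u) > y" "\<forall>\<^sub>F u in nhds x. \<bar>Im (b u)\<bar> < v"
        using y(2) order_tendstoD(1)[of "\<lambda>u. Im (a u)" "Im (a x)" "nhds x" y]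
          order_tendstoD(2)[of "\<lambda>u. \<bar>Im (b u)\<bar>" "\<bar>Im (b x)\<bar>" "nhds x" v]
          tendsto_at_iff_tendsto_nhds[of "\<lambda>u. Im (a u)" x] tendsto_at_iff_tendsto_nhds[of "\<lambda>u. \<bar>Im (b u)\<bar>" x]
        by (auto simp: isCont_def v_def)
      then have "\<forall>\<^sub>F u in nhds x. Im (a u) > y \<and> \<bar>Im (b u)\<bar> < v"
        by (rule eventually_conj)
      then obtain d where d: "d > 0" "\<And>u. u \<in> ball x d \<Longrightarrow> Im (a u) > y \<and> \<bar>Im (b u)\<bar> < v"
        unfolding eventually_nhds_metric by (auto simp: dist_commute)
      define h where "h n = exp ((2 * pi * v + 1)\<^sup>2 / (4 * pi * y)) * exp (- \<bar>real_of_int (int_decode n)\<bar>)" for n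
      have "(\<lambda>n. exp (- \<bar>real_of_int (int_decode n)\<bar>)) summable_on UNIV"
        using summable_exp_abs_int summable_on_reindex_bij_betw[OF bij_int_decode, of "\<lambda>n. exp (- \<bar>real_of_int n\<bar>)"] by simp
      then have "summable h"
        unfolding h_def by (intro summable_mult summable_on_imp_summable)
      then have "summable (\<lambda>n. complex_of_real (h n))"
        by (rule summable_of_real)
      moreover have "cmod (f n u) \<le> cmod (complex_of_real (h n))" if "u \<in> ball x d" for n u
      proof -
        have "cmod (f n u) \<le> h n"
          unfolding f_def h_def using d(2)[OF that] y(1) by (intro norm_theta_term_le) auto
        then show ?thesis
          by simp
      qed
      moreover have "range (\<lambda>n. complex_of_real (h n)) \<subseteq> \<real>\<^sub>\<ge>\<^sub>0"
        by (auto simp: h_def)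
      ultimately show ?thesis
        using d(1) by (intro exI[of _ d] exI[of _ "\<lambda>n. complex_of_real (h n)"]) auto
    qed
  qed auto
  have "g x = theta (a x) (b x)" if "x \<in> S" for x
    using g(1)[OF that] sums[OF that] by (rule sums_unique2)
  moreover have "g holomorphic_on S"
    using g(2) \<open>open S\<close> by (simp add: holomorphic_on_def field_differentiable_at_within)
  ultimately show ?thesis
    by (simp cong: holomorphic_cong)
qed

lemma theta_minus: "theta w (- z) = theta w z"
  unfolding theta_def
  by (rule infsum_reindex_bij_witness[where i = uminus and j = uminus]) (auto simp: theta_term_def)

lemma theta_plus_one: "theta w (z + 1) = theta w z"
proof -
  have "theta_term w (z + 1) n = theta_term w z n" for n
    using exp_integer_2pi[of "of_int n"] by (simp add: theta_term_def distrib_left exp_add mult_ac)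
  then show ?thesis
    by (simp add: theta_def)
qed

section \<open>Fourier uniqueness for symmetric functions on the unit interval\<close>

text \<open>A function symmetric under x -> 1 - x is a continuous function of cos (2 pi x), so
  polynomial approximation in one real variable suffices.\<close>

lemma even_function_orthogonal:
  fixes d :: "real \<Rightarrow> complex" and u :: "real \<Rightarrow> real"
  assumes d: "continuous_on {0..1} d"
    and orth: "\<And>k::int. integral {0..1} (\<lambda>x. d x * exp (2 * pi * \<i> * of_int k * x)) = 0"
    and u: "continuous_on {0..1} u" "\<And>x. x \<in> {0..1} \<Longrightarrow> u (1 - x) = u x"
  shows "integral {0..1} (\<lambda>x. d x * of_real (u x)) = 0"
proof -
  \<comment> \<open>A factor cos (2 pi x) shifts the frequency by 1 in both directions, so
    orthogonality to exponentials extends to powers of the cosine.\<close>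
  have pow: "integral {0..1} (\<lambda>x. d x * (of_real (cos (2 * pi * x))) ^ j * exp (2 * pi * \<i> * of_int k * x)) = 0" for j :: nat and k :: int
  proof (induction j arbitrary: k)
    case 0
    then show ?case
      using orth by simp
  next
    case (Suc j)
    have int: "(\<lambda>x. d x * (of_real (cos (2 * pi * x))) ^ j * exp (2 * pi * \<i> * of_int k * x)) integrable_on {0..1}" for k
      by (intro integrable_continuous_interval continuous_intros d)
    have eq: "d x * (of_real (cos (2 * pi * x))) ^ Suc j * exp (2 * pi * \<i> * of_int k * x) =
        (d x * (of_real (cos (2 * pi * x))) ^ j * exp (2 * pi * \<i> * of_int (k + 1) * x) +
         d x * (of_real (cos (2 * pi * x))) ^ j * exp (2 * pi * \<i> * of_int (k - 1) * x)) / 2" for x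
    proof -
      have "complex_of_real (cos (2 * pi * x)) = (exp (2 * pi * \<i> * x) + exp (- (2 * pi * \<i> * x))) / 2"
        unfolding cos_of_real[symmetric] cos_exp_eq by (simp add: mult_ac)
      moreover have e: "exp (2 * pi * \<i> * of_int (k + 1) * x) = exp (2 * pi * \<i> * of_int k * x) * exp (2 * pi * \<i> * x)"
        "exp (2 * pi * \<i> * of_int (k - 1) * x) = exp (2 * pi * \<i> * of_int k * x) * exp (- (2 * pi * \<i> * x))"
        unfolding exp_add[symmetric] by (simp_all add: algebra_simps)
      have "D * (C * P) * E = (D * P * (E * A) + D * P * (E * A')) / 2" if "C = (A + A') / 2" for A A' C D E P :: complex
        by (simp add: that algebra_simps add_divide_distrib)
      ultimately show ?thesis
        unfolding power_Suc e by blast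
    qed
    show ?case
      unfolding eq integral_divide integral_add[OF int int] using Suc.IH[of "k + 1"] Suc.IH[of "k - 1"] by (simp only:) simp
  qed
  obtain B where B: "\<And>x. x \<in> {0..1} \<Longrightarrow> norm (d x) \<le> B" "B > 0"
  proof -
    have "bounded (d ` {0..1})"
      by (intro compact_imp_bounded compact_continuous_image d) simp
    then obtain b where "b > 0" "\<And>x. x \<in> {0..1} \<Longrightarrow> norm (d x) \<le> b"
      by (auto simp: bounded_pos)
    then show ?thesis
      using that[of b] by blast
  qed
  have small: "norm (integral {0..1} (\<lambda>x. d x * of_real (u x))) \<le> e" if e: "e > 0" for e
  proof -
    \<comment> \<open>\<open>u\<close> as a function of the cosine. The range of arccos covers the
      first half of the interval; the symmetry of \<open>u\<close> supplies the second.\<close>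
    define v where "v c = u (arccos c / (2 * pi))" for c
    have "continuous_on {-1..1} v"
      unfolding v_def
    proof (rule continuous_on_compose2[OF u(1)])
      show "continuous_on {-1..1} (\<lambda>c. arccos c / (2 * pi))"
        by (intro continuous_intros continuous_on_arccos') auto
      show "(\<lambda>c. arccos c / (2 * pi)) ` {-1..1} \<subseteq> {0..1}"
      proof safe
        fix c :: real assume "c \<in> {-1..1}"
        then show "arccos c / (2 * pi) \<in> {0..1}"
          using arccos_lbound[of c] arccos_ubound[of c] pi_gt_zero by (auto simp: divide_simps)
      qed
    qed
    then obtain p where p: "real_polynomial_function p" "\<And>c. c \<in> {-1..1} \<Longrightarrow> \<bar>v c - p c\<bar> < e / B"
      using Stone_Weierstrass_real_polynomial_function[of "{-1..1}" v "e / B"] e B(2) by auto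
    obtain a n where an: "p = (\<lambda>x. \<Sum>i\<le>n. a i * x ^ i)"
      using p(1) unfolding real_polynomial_function_iff_sum by blast
    have "((\<lambda>x. \<Sum>i\<le>n. of_real (a i) * (d x * (of_real (cos (2 * pi * x))) ^ i)) has_integral (\<Sum>i\<le>n. of_real (a i) * 0)) {0..1}"
    proof (intro has_integral_sum has_integral_mult_right)
      fix i
      have "(\<lambda>x. d x * (of_real (cos (2 * pi * x))) ^ i) integrable_on {0..1}"
        by (intro integrable_continuous_interval continuous_intros d)
      then show "((\<lambda>x. d x * (of_real (cos (2 * pi * x))) ^ i) has_integral 0) {0..1}"
        using pow[of i 0] by (simp add: has_integral_iff)
    qed simp
    then have 0: "integral {0..1} (\<lambda>x. d x * of_real (p (cos (2 * pi * x)))) = 0"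
      unfolding an by (simp add: sum_distrib_left mult_ac has_integral_iff)
    have cp: "continuous_on {0..1} (\<lambda>x. p (cos (2 * pi * x)))"
      unfolding an by (intro continuous_intros)
    have vu: "v (cos (2 * pi * x)) = u x" if x: "x \<in> {0..1}" for x
    proof (cases "x \<le> 1 / 2")
      case True
      then have "arccos (cos (2 * pi * x)) = 2 * pi * x"
        using x by (intro arccos_cos) auto
      then show ?thesis
        by (simp add: v_def)
    next
      case False
      have "cos (2 * pi * (1 - x)) = cos (2 * pi * x)"
        using cos_periodic[of "- (2 * pi * x)"] by (simp add: algebra_simps)
      moreover have "arccos (cos (2 * pi * (1 - x))) = 2 * pi * (1 - x)"
        using x False by (intro arccos_cos) auto
      ultimately have "v (cos (2 * pi * x)) = u (1 - x)"
        by (simp add: v_def)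
      then show ?thesis
        using u(2)[OF x] by simp
    qed
    have "integral {0..1} (\<lambda>x. d x * of_real (u x)) =
        integral {0..1} (\<lambda>x. d x * of_real (u x)) - integral {0..1} (\<lambda>x. d x * of_real (p (cos (2 * pi * x))))"
      by (simp add: 0)
    also have "\<dots> = integral {0..1} (\<lambda>x. d x * of_real (u x) - d x * of_real (p (cos (2 * pi * x))))"
      by (rule integral_diff[symmetric])
        (intro integrable_continuous_interval continuous_intros d u(1) cp)+
    also have "norm \<dots> \<le> (B * (e / B)) * (1 - 0)"
    proof (rule integral_bound)
      fix x :: real assume x: "x \<in> {0..1}"
      have "norm (d x * of_real (u x) - d x * of_real (p (cos (2 * pi * x)))) = norm (d x) * \<bar>v (cos (2 * pi * x)) - p (cos (2 * pi * x))\<bar>"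
        unfolding vu[OF x] by (simp flip: right_diff_distrib of_real_diff add: norm_mult)
      also have "\<dots> \<le> B * (e / B)"
        using B(1)[OF x] B(2) p(2)[of "cos (2 * pi * x)"] by (intro mult_mono) auto
      finally show "norm (d x * of_real (u x) - d x * of_real (p (cos (2 * pi * x)))) \<le> B * (e / B)" .
    qed (simp, intro continuous_intros d u(1) cp)
    finally show ?thesis
      using B(2) by simp
  qed
  show ?thesis
  proof (rule ccontr)
    assume "integral {0..1} (\<lambda>x. d x * of_real (u x)) \<noteq> 0"
    then show False
      using small[of "norm (integral {0..1} (\<lambda>x. d x * of_real (u x))) / 2"] by simp
  qed
qed

text \<open>Testing \<open>d\<close> against its own real and imaginary parts gives vanishing
  integrals of their squares.\<close>

lemma even_function_fourier_unique:
  fixes d :: "real \<Rightarrow> complex"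
  assumes d: "continuous_on {0..1} d"
    and orth: "\<And>k::int. integral {0..1} (\<lambda>x. d x * exp (2 * pi * \<i> * of_int k * x)) = 0"
    and sym: "\<And>x. x \<in> {0..1} \<Longrightarrow> d (1 - x) = d x" and x: "x \<in> {0..1}"
  shows "d x = 0"
proof -
  have zero: "u x = 0" if u: "continuous_on {0..1} u" "\<And>x. x \<in> {0..1} \<Longrightarrow> u (1 - x) = u x"
      and lin: "bounded_linear L" "\<And>x. L (d x * of_real (u x)) = (u x)\<^sup>2" for u and L :: "complex \<Rightarrow> real"
  proof -
    have "(\<lambda>x. d x * of_real (u x)) integrable_on {0..1}"
      by (intro integrable_continuous_interval continuous_intros d u(1))
    from integral_linear[OF this lin(1)]
    have "integral {0..1} (\<lambda>x. L (d x * of_real (u x))) = L (integral {0..1} (\<lambda>x. d x * of_real (u x)))"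
      by (simp add: o_def)
    also have "\<dots> = 0"
    proof -
      have "integral {0..1} (\<lambda>x. d x * of_real (u x)) = 0"
        by (rule even_function_orthogonal[OF d orth u])
      then show ?thesis
        using linear_0[OF bounded_linear.linear[OF lin(1)]] by simp
    qed
    finally have "integral {0..1} (\<lambda>x. (u x)\<^sup>2) = 0"
      by (simp add: lin(2))
    then have "\<forall>x\<in>{0..1}. (u x)\<^sup>2 = 0"
      by (subst (asm) integral_eq_0_iff) (auto intro!: continuous_intros u(1))
    then show ?thesis
      using x by simp
  qed
  have "Re (d x) = 0"
    by (rule zero[where L = Re and u = "\<lambda>x. Re (d x)"])
      (use d in \<open>auto intro!: continuous_intros bounded_linear_Re simp: sym power2_eq_square\<close>)
  moreover have "Im (d x) = 0"
    by (rule zero[where L = Im and u = "\<lambda>x. Im (d x)"])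
      (use d in \<open>auto intro!: continuous_intros bounded_linear_Im simp: sym power2_eq_square\<close>)
  ultimately show ?thesis
    by (simp add: complex_eq_iff)
qed

section \<open>Poisson summation for the Gaussian\<close>

text \<open>A rescaling of the characteristic function of the standard normal distribution.\<close>

lemma gaussian_fourier_transform:
  assumes t: "t > 0"
  shows "integrable lborel (\<lambda>x::real. of_real (exp (- pi * x\<^sup>2 / t)) * exp (2 * pi * \<i> * of_int k * x))"
    and "(LINT x|lborel. of_real (exp (- pi * x\<^sup>2 / t)) * exp (2 * pi * \<i> * of_int k * x)) = of_real (sqrt t * exp (- pi * (of_int k)\<^sup>2 * t))"
proof -
  \<comment> \<open>The scale at which \<open>pi * (\<sigma> * x)\<^sup>2 / t\<close> equals
    \<open>x\<^sup>2 / 2\<close>.\<close>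
  define \<sigma> where "\<sigma> = sqrt (t / (2 * pi))"
  have \<sigma>: "\<sigma> > 0" "\<sigma>\<^sup>2 = t / (2 * pi)"
    using t by (simp_all add: \<sigma>_def)
  define s where "s = 2 * pi * of_int k * \<sigma>"
  interpret real_distribution std_normal_distribution
    by (rule real_dist_normal_dist)
  define g where "g x = of_real (exp (- pi * x\<^sup>2 / t)) * exp (2 * pi * \<i> * of_int k * x)" for x :: real
  have eq: "g (0 + \<sigma> * x) = sqrt (2 * pi) *\<^sub>R (std_normal_density x *\<^sub>R exp (\<i> * of_real (s * x)))" for x
  proof -
    have "pi * (\<sigma> * x)\<^sup>2 / t = x\<^sup>2 / 2"
      using t by (simp add: power_mult_distrib \<sigma>(2))
    then have 1: "- pi * (0 + \<sigma> * x)\<^sup>2 / t = - x\<^sup>2 / 2"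
      by simp
    have 2: "2 * pi * \<i> * of_int k * of_real (0 + \<sigma> * x) = \<i> * of_real (s * x)"
      by (simp add: s_def)
    show ?thesis
      unfolding g_def 1 2 std_normal_density_def by (simp add: scaleR_conv_of_real)
  qed
  have int: "integrable lborel (\<lambda>x. std_normal_density x *\<^sub>R exp (\<i> * of_real (s * x)))"
  proof -
    have "integrable std_normal_distribution (\<lambda>x. exp (\<i> * of_real (s * x)))"
      by (rule integrable_iexp) auto
    then show ?thesis
      by (subst (asm) integrable_density) auto
  qed
  have "char std_normal_distribution s = (LINT x|lborel. std_normal_density x *\<^sub>R exp (\<i> * of_real (s * x)))"
    unfolding char_def by (subst integral_density) auto
  then have val: "(LINT x|lborel. std_normal_density x *\<^sub>R exp (\<i> * of_real (s * x))) = exp (- (s\<^sup>2) / 2)"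
    by (simp add: char_std_normal_distribution)
  have "integrable lborel (\<lambda>x. g (0 + \<sigma> * x))"
    unfolding eq by (rule integrable_scaleR_right) (rule int)
  then show "integrable lborel (\<lambda>x::real. of_real (exp (- pi * x\<^sup>2 / t)) * exp (2 * pi * \<i> * of_int k * x))"
    using \<sigma>(1) unfolding g_def[symmetric] by (subst (asm) lborel_integrable_real_affine_iff) auto
  have "(LINT x|lborel. g x) = \<bar>\<sigma>\<bar> *\<^sub>R (LINT x|lborel. g (0 + \<sigma> * x))"
    by (rule lborel_integral_real_affine) (use \<sigma> in simp)
  also have "\<dots> = \<sigma> *\<^sub>R (sqrt (2 * pi) *\<^sub>R of_real (exp (- (s\<^sup>2) / 2)))"
    unfolding eq integral_scaleR_right val using \<sigma>(1) by simp
  also have "\<dots> = of_real ((\<sigma> * sqrt (2 * pi)) * exp (- (s\<^sup>2) / 2))"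
    by (simp add: scaleR_conv_of_real)
  also have "\<sigma> * sqrt (2 * pi) = sqrt t"
    by (simp add: \<sigma>_def real_sqrt_mult[symmetric])
  also have "- (s\<^sup>2) / 2 = - pi * (of_int k)\<^sup>2 * t"
    unfolding s_def power_mult_distrib \<sigma>(2) by (simp add: power2_eq_square)
  finally show "(LINT x|lborel. of_real (exp (- pi * x\<^sup>2 / t)) * exp (2 * pi * \<i> * of_int k * x)) = of_real (sqrt t * exp (- pi * (of_int k)\<^sup>2 * t))"
    unfolding g_def .
qed

lemma has_sum_integral:
  fixes f :: "'a \<Rightarrow> real \<Rightarrow> complex"
  assumes cont: "\<And>n. continuous_on {a..b} (f n)"
    and le: "\<And>n x. x \<in> {a..b} \<Longrightarrow> norm (f n x) \<le> M n" and M: "M summable_on UNIV"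
  shows "((\<lambda>n. integral {a..b} (f n)) has_sum integral {a..b} (\<lambda>x. \<Sum>\<^sub>\<infinity>n. f n x)) UNIV"
proof -
  have "uniform_limit {a..b} (\<lambda>X x. \<Sum>n\<in>X. f n x) (\<lambda>x. \<Sum>\<^sub>\<infinity>n. f n x) (finite_subsets_at_top UNIV)"
    by (rule Weierstrass_m_test_general[OF _ M]) (rule le)
  then obtain I J where IJ: "\<And>X. ((\<lambda>x. \<Sum>n\<in>X. f n x) has_integral I X) {a..b}"
    "((\<lambda>x. \<Sum>\<^sub>\<infinity>n. f n x) has_integral J) {a..b}" "(I \<longlongrightarrow> J) (finite_subsets_at_top UNIV)"
    by (rule uniform_limit_integral) (auto intro!: continuous_on_sum cont)
  have "sum (\<lambda>n. integral {a..b} (f n)) X = I X" if "finite X" for X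
    using integral_unique[OF IJ(1)[of X]] that
    by (subst (asm) integral_sum) (auto intro!: integrable_continuous_interval cont)
  then have "\<forall>\<^sub>F X in finite_subsets_at_top UNIV. I X = sum (\<lambda>n. integral {a..b} (f n)) X"
    by (intro eventually_finite_subsets_at_top_weakI) simp
  then have "(sum (\<lambda>n. integral {a..b} (f n)) \<longlongrightarrow> J) (finite_subsets_at_top UNIV)"
    using IJ(3) tendsto_cong by blast
  then show ?thesis
    using integral_unique[OF IJ(2)] by (simp add: has_sum_def)
qed

lemma integral_exp_2pi_int:
  "integral {0..1} (\<lambda>x::real. exp (2 * pi * \<i> * of_int k * x)) = (if k = 0 then 1 else 0)"
proof (cases "k = 0")
  case False
  define c where "c = 2 * pi * \<i> * of_int k"
  have c: "c \<noteq> 0"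
    using False by (simp add: c_def)
  have "((\<lambda>x::real. exp (c * x)) has_integral exp (c * of_real 1) / c - exp (c * of_real 0) / c) {0..1}"
  proof (rule fundamental_theorem_of_calculus)
    fix x :: real
    have "((\<lambda>w. exp (c * w) / c) has_field_derivative exp (c * of_real x)) (at (of_real x))"
      using c by (auto intro!: derivative_eq_intros)
    then show "((\<lambda>x. exp (c * of_real x) / c) has_vector_derivative exp (c * of_real x)) (at x within {0..1})"
      by (rule has_vector_derivative_real_field)
  qed simp
  moreover have "exp c = 1"
    using exp_integer_2pi[of "of_int k"] by (simp add: c_def mult_ac)
  ultimately show ?thesis
    using False by (simp add: has_integral_iff c_def)
qed simp

text \<open>The transformed theta series times a Gaussian is the periodisation of that Gaussian;
  here the square is completed in one term.\<close>

lemma gaussian_term: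
  assumes "t > 0"
  shows "of_real (exp (- pi * x\<^sup>2 / t)) * theta_term (\<i> / of_real t) (of_real x / (\<i> * of_real t)) n =
    of_real (exp (- pi * (x - of_int n)\<^sup>2 / t))"
  using assms unfolding theta_term_def exp_add[symmetric] exp_of_real[symmetric]
  by (intro arg_cong[where f = exp]) (simp add: field_simps power2_eq_square)

text \<open>Integration over a period leaves the term n = - k alone.\<close>

lemma theta_fourier_coefficient:
  assumes t: "t > 0"
  shows "integral {0..1} (\<lambda>x. theta (\<i> * of_real t) (of_real x) * exp (2 * pi * \<i> * of_int k * x)) = exp (- pi * (of_int k)\<^sup>2 * t)"
proof -
  let ?f = "\<lambda>n x. theta_term (\<i> * of_real t) (of_real x) n * exp (2 * pi * \<i> * of_int k * of_real x)"
  have trm: "?f n x = of_real (exp (- pi * (of_int n)\<^sup>2 * t)) * exp (2 * pi * \<i> * of_int (n + k) * of_real x)" for n x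
    unfolding theta_term_def exp_add[symmetric] exp_of_real[symmetric]
    by (intro arg_cong[where f = exp]) (simp add: algebra_simps)
  have "norm (?f n x) = norm (theta_term (\<i> * of_real t) 0 n)" for n x
    unfolding trm norm_mult by (simp add: theta_term_def norm_exp_eq_Re power2_eq_square)
  then have "((\<lambda>n. integral {0..1} (?f n)) has_sum integral {0..1} (\<lambda>x. \<Sum>\<^sub>\<infinity>n. ?f n x)) UNIV"
    using t by (intro has_sum_integral[OF _ _ theta_abs_summable[of "\<i> * of_real t" 0]])
      (auto intro!: continuous_intros simp: theta_term_def)
  moreover have "integral {0..1} (?f n) = (if n = - k then of_real (exp (- pi * (of_int k)\<^sup>2 * t)) else 0)" for n
    unfolding trm integral_mult_right integral_exp_2pi_int by auto
  ultimately have "((\<lambda>n. if n = - k then of_real (exp (- pi * (of_int k)\<^sup>2 * t)) else 0) has_sum integral {0..1} (\<lambda>x. \<Sum>\<^sub>\<infinity>n. ?f n x)) UNIV"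
    by simp
  moreover have "((\<lambda>n. if n = - k then complex_of_real (exp (- pi * (of_int k)\<^sup>2 * t)) else 0) has_sum of_real (exp (- pi * (of_int k)\<^sup>2 * t))) UNIV"
    by (rule has_sum_finite_neutralI[of "{- k}"]) auto
  ultimately have "integral {0..1} (\<lambda>x. \<Sum>\<^sub>\<infinity>n. ?f n x) = of_real (exp (- pi * (of_int k)\<^sup>2 * t))"
    by (rule has_sum_unique)
  then show ?thesis
    by (simp add: theta_def infsum_cmult_left')
qed

text \<open>Unfolding: the integer translates of the unit interval tile the line, so the coefficient
  is a value of the Fourier transform of the Gaussian.\<close>

lemma periodization_fourier_coefficient:
  assumes t: "t > 0"
  shows "integral {0..1} (\<lambda>x. of_real (exp (- pi * x\<^sup>2 / t)) * theta (\<i> / of_real t) (of_real x / (\<i> * of_real t)) * exp (2 * pi * \<i> * of_int k * x)) =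
    sqrt t * exp (- pi * (of_int k)\<^sup>2 * t)"
proof -
  define h where "h x = of_real (exp (- pi * x\<^sup>2 / t)) * exp (2 * pi * \<i> * of_int k * x)" for x :: real
  have cont: "continuous_on A h" for A
    unfolding h_def using t by (intro continuous_intros) auto
  have shift: "h (x + of_int (- n)) = of_real (exp (- pi * (x - of_int n)\<^sup>2 / t)) * exp (2 * pi * \<i> * of_int k * x)" for x n
  proof -
    have "exp (2 * pi * \<i> * of_int k * of_real (x + of_int (- n))) = exp (2 * pi * \<i> * of_int k * x) * exp (2 * pi * \<i> * of_int (- k * n))"
      unfolding exp_add[symmetric] by (simp add: algebra_simps)
    also have "exp (2 * pi * \<i> * of_int (- k * n)) = 1"
      using exp_integer_2pi[of "of_int (- k * n)"] by (simp add: mult_ac)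
    finally show ?thesis
      by (simp add: h_def)
  qed
  have trm: "of_real (exp (- pi * x\<^sup>2 / t)) * theta_term (\<i> / of_real t) (of_real x / (\<i> * of_real t)) n * exp (2 * pi * \<i> * of_int k * x) = h (x + of_int (- n))" for x n
    unfolding shift gaussian_term[OF t] ..
  define M where "M n = exp ((2 * pi * (1 / t) + 1)\<^sup>2 / (4 * pi * (1 / t))) * exp (- \<bar>real_of_int n\<bar>)" for n
  have le: "norm (h (x + of_int (- n))) \<le> M n" if x: "x \<in> {0..1}" for x n
  proof -
    have "norm (theta_term (\<i> / of_real t) (of_real x / (\<i> * of_real t)) n) \<le> M n"
      unfolding M_def using t x by (intro norm_theta_term_le) (auto simp: Im_divide power2_eq_square divide_simps)
    moreover have "norm (complex_of_real (exp (- pi * x\<^sup>2 / t))) \<le> 1"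
      using t by (simp add: norm_exp_eq_Re power2_eq_square)
    moreover have "M n \<ge> 0"
      by (simp add: M_def)
    ultimately have "norm (complex_of_real (exp (- pi * x\<^sup>2 / t))) * norm (theta_term (\<i> / of_real t) (of_real x / (\<i> * of_real t)) n) \<le> 1 * M n"
      by (intro mult_mono) auto
    then show ?thesis
      unfolding trm[symmetric] by (simp add: norm_mult norm_exp_eq_Re)
  qed
  define B where "B = integral {0..1} (\<lambda>x. \<Sum>\<^sub>\<infinity>n. h (x + of_int (- n)))"
  have "((\<lambda>n. integral {0..1} (\<lambda>x. h (x + of_int (- n)))) has_sum B) UNIV"
    unfolding B_def
  proof (rule has_sum_integral[OF _ le])
    show "continuous_on {0..1} (\<lambda>x. h (x + of_int (- n)))" for n
      by (rule continuous_on_compose2[OF cont[of UNIV]]) (auto intro!: continuous_intros)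
    show "M summable_on UNIV"
      unfolding M_def by (rule summable_on_cmult_right[OF summable_exp_abs_int])
  qed auto
  moreover have "integral {0..1} (\<lambda>x. h (x + of_int (- n))) = integral {- of_int n..1 - of_int n} h" for n
    using integral_shift_real_ivl[of "- of_int n" "of_int (- n)" "1 - of_int n" h] by simp
  ultimately have "((\<lambda>n. integral {- of_int n..1 - of_int n} h) has_sum B) UNIV"
    by simp
  then have "((\<lambda>X. \<Sum>n\<in>X. integral {- of_int n..1 - of_int n} h) \<longlongrightarrow> B) (finite_subsets_at_top UNIV)"
    by (simp add: has_sum_def)
  \<comment> \<open>Unordered convergence is specialised to symmetric ranges, for which the unit
    intervals join to a single interval.\<close>
  moreover have "filterlim (\<lambda>N. {- int N..int N}) (finite_subsets_at_top UNIV) sequentially"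
    unfolding filterlim_finite_subsets_at_top
  proof (intro allI impI)
    fix X :: "int set" assume "finite X \<and> X \<subseteq> UNIV"
    then have "\<forall>\<^sub>F N in sequentially. \<forall>n\<in>X. n \<in> {- int N..int N}"
    proof (intro eventually_ball_finite ballI)
      show "\<forall>\<^sub>F N in sequentially. n \<in> {- int N..int N}" for n
        by (rule eventually_sequentiallyI[of "nat \<bar>n\<bar>"]) auto
    qed simp
    then show "\<forall>\<^sub>F N in sequentially. finite {- int N..int N} \<and> X \<subseteq> {- int N..int N} \<and> {- int N..int N} \<subseteq> UNIV"
      by eventually_elim auto
  qed
  ultimately have "(\<lambda>N. \<Sum>n\<in>{- int N..int N}. integral {- of_int n..1 - of_int n} h) \<longlonglongrightarrow> B"
    by (rule filterlim_compose)
  moreover have "(\<Sum>n\<in>{- int N..int N}. integral {- of_int n..1 - of_int n} h) = integral {- real N..real N + 1} h" for N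
  proof (induction N)
    case (Suc N)
    have "{- int (Suc N)..int (Suc N)} = insert (- int (Suc N)) (insert (int (Suc N)) {- int N..int N})"
      by auto
    then have "(\<Sum>n\<in>{- int (Suc N)..int (Suc N)}. integral {- of_int n..1 - of_int n} h) =
        integral {real N + 1..real N + 2} h + (integral {- 1 - real N..- real N} h + integral {- real N..real N + 1} h)"
      by (simp add: Suc.IH add_ac)
    also have "integral {- 1 - real N..- real N} h + integral {- real N..real N + 1} h = integral {- 1 - real N..real N + 1} h"
      by (rule Henstock_Kurzweil_Integration.integral_combine) (auto intro!: integrable_continuous_interval cont)
    also have "integral {real N + 1..real N + 2} h + integral {- 1 - real N..real N + 1} h = integral {- 1 - real N..real N + 2} h"
      by (subst add.commute, rule Henstock_Kurzweil_Integration.integral_combine) (auto intro!: integrable_continuous_interval cont)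
    finally show ?case
      by (simp add: algebra_simps)
  qed simp
  ultimately have lim1: "(\<lambda>N. integral {- real N..real N + 1} h) \<longlonglongrightarrow> B"
    by simp
  have int: "integrable lborel h"
    unfolding h_def by (rule gaussian_fourier_transform[OF t])
  have eq: "(LINT x|lborel. indicator {- real N..real N + 1} x *\<^sub>R h x) = integral {- real N..real N + 1} h" for N
    using set_borel_integral_eq_integral(2)[of "{- real N..real N + 1}" h]
      integrable_mult_indicator[OF _ int, of "{- real N..real N + 1}"]
    by (simp add: set_lebesgue_integral_def set_integrable_def)
  have "(\<lambda>N. LINT x|lborel. indicator {- real N..real N + 1} x *\<^sub>R h x) \<longlonglongrightarrow> (LINT x|lborel. h x)"
  proof (rule integral_dominated_convergence[where w = "\<lambda>x. norm (h x)"])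
    show "AE x in lborel. (\<lambda>N. indicator {- real N..real N + 1} x *\<^sub>R h x) \<longlonglongrightarrow> h x"
    proof (rule AE_I2)
      fix x :: real
      have "\<forall>\<^sub>F N in sequentially. indicator {- real N..real N + 1} x *\<^sub>R h x = h x"
        by (rule eventually_sequentiallyI[of "nat \<lceil>\<bar>x\<bar>\<rceil>"]) (auto simp: indicator_def nat_le_iff ceiling_le_iff)
      then show "(\<lambda>N. indicator {- real N..real N + 1} x *\<^sub>R h x) \<longlonglongrightarrow> h x"
        by (rule tendsto_eventually)
    qed
    show "AE x in lborel. norm (indicator {- real N..real N + 1} x *\<^sub>R h x) \<le> norm (h x)" for N
      by (rule AE_I2) (simp add: indicator_def)
  qed (use int in auto)
  then have "(\<lambda>N. integral {- real N..real N + 1} h) \<longlonglongrightarrow> of_real (sqrt t * exp (- pi * (of_int k)\<^sup>2 * t))"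
    unfolding eq using gaussian_fourier_transform(2)[OF t, of k] by (simp add: h_def)
  then have "B = of_real (sqrt t * exp (- pi * (of_int k)\<^sup>2 * t))"
    using LIMSEQ_unique[OF lim1] by blast
  moreover have "(\<Sum>\<^sub>\<infinity>n. h (x + of_int (- n))) = of_real (exp (- pi * x\<^sup>2 / t)) * theta (\<i> / of_real t) (of_real x / (\<i> * of_real t)) * exp (2 * pi * \<i> * of_int k * x)" for x
    unfolding trm[symmetric] theta_def infsum_cmult_left' infsum_cmult_right' ..
  ultimately show ?thesis
    by (simp add: B_def)
qed

text \<open>Both sides are continuous and symmetric and have the same Fourier coefficients.\<close>

lemma theta_inversion_real:
  assumes t: "t > 0" and x: "x \<in> {0..1}"
  shows "of_real (sqrt t) * theta (\<i> * of_real t) (of_real x) =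
    of_real (exp (- pi * x\<^sup>2 / t)) * theta (\<i> / of_real t) (of_real x / (\<i> * of_real t))"
proof -
  define f where "f x = of_real (sqrt t) * theta (\<i> * of_real t) (of_real x)" for x :: real
  define g where "g x = of_real (exp (- pi * x\<^sup>2 / t)) * theta (\<i> / of_real t) (of_real x / (\<i> * of_real t))" for x :: real
  have "(\<lambda>z. theta (\<i> * of_real t) z) holomorphic_on UNIV" "(\<lambda>z. theta (\<i> / of_real t) (z / (\<i> * of_real t))) holomorphic_on UNIV"
    by (intro theta_holomorphic holomorphic_intros; use t in \<open>simp add: Im_divide power2_eq_square\<close>)+
  then have "continuous_on UNIV (\<lambda>z. theta (\<i> * of_real t) z)" "continuous_on UNIV (\<lambda>z. theta (\<i> / of_real t) (z / (\<i> * of_real t)))"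
    by (auto intro: holomorphic_on_imp_continuous_on)
  then have c: "continuous_on {0..1} (\<lambda>x. theta (\<i> * of_real t) (of_real x))"
    "continuous_on {0..1} (\<lambda>x. theta (\<i> / of_real t) (of_real x / (\<i> * of_real t)))"
    by (auto intro!: continuous_on_compose2[of UNIV _ "{0..1}" of_real] continuous_intros)
  then have cont: "continuous_on {0..1} f" "continuous_on {0..1} g"
    unfolding f_def g_def using t by (auto intro!: continuous_intros)
  have "f x - g x = 0"
  proof (rule even_function_fourier_unique[OF _ _ _ x])
    show "continuous_on {0..1} (\<lambda>x. f x - g x)"
      by (intro continuous_intros cont)
    show "integral {0..1} (\<lambda>x. (f x - g x) * exp (2 * pi * \<i> * of_int k * x)) = 0" for k
    proof -
      have "integral {0..1} (\<lambda>x. f x * exp (2 * pi * \<i> * of_int k * x)) = integral {0..1} (\<lambda>x. g x * exp (2 * pi * \<i> * of_int k * x))"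
        using theta_fourier_coefficient[OF t, of k] periodization_fourier_coefficient[OF t, of k]
        by (simp add: f_def g_def mult.assoc)
      then show ?thesis
        unfolding left_diff_distrib
        by (subst integral_diff) (auto intro!: integrable_continuous_interval continuous_intros cont)
    qed
    fix x :: real
    have "f (1 - x) = f x"
      using theta_plus_one[of "\<i> * of_real t" "- of_real x"] by (simp add: f_def theta_minus)
    moreover have g: "g y = (\<Sum>\<^sub>\<infinity>n. of_real (exp (- pi * (y - of_int n)\<^sup>2 / t)))" for y
      unfolding g_def theta_def gaussian_term[OF t, symmetric] infsum_cmult_right' ..
    have "g (1 - x) = g x"
      unfolding g
    proof (rule infsum_reindex_bij_witness[where i = "\<lambda>n. 1 - n" and j = "\<lambda>n. 1 - n"])
      show "of_real (exp (- pi * (x - of_int (1 - n))\<^sup>2 / t)) = of_real (exp (- pi * (1 - x - of_int n)\<^sup>2 / t))" for n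
        by (simp add: power2_commute algebra_simps)
    qed auto
    ultimately show "f (1 - x) - g (1 - x) = f x - g x"
      by simp
  qed
  then show ?thesis
    by (simp add: f_def g_def)
qed

text \<open>The real case is continued in z from the unit interval to the plane, then in w from the
  imaginary axis to the half-plane. The principal root is correct throughout because - i w has
  positive real part.\<close>

theorem theta_inversion:
  assumes w: "Im w > 0"
  shows "theta (- 1 / w) (z / w) = csqrt (- \<i> * w) * exp (pi * \<i> * z\<^sup>2 / w) * theta w z"
proof -
  define H where "H = {w. Im w > 0}"
  have H: "open H" "connected H"
    unfolding H_def by (simp_all add: open_halfspace_Im_gt convex_connected convex_halfspace_Im_gt)
  have Im: "Im (- 1 / w) > 0" if "w \<in> H" for w
    using that by (simp add: H_def Im_divide sum_power2_gt_zero_iff)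
  define F where "F w z = theta (- 1 / w) (z / w) - csqrt (- \<i> * w) * exp (pi * \<i> * z\<^sup>2 / w) * theta w z" for w z
  have 1: "F (\<i> * of_real t) (of_real x) = 0" if t: "t > 0" and x: "x \<in> {0..1}" for t x
  proof -
    define v :: complex where "v = \<i> * of_real t"
    have inv: "- 1 / v = \<i> / of_real t"
      using t by (simp add: v_def field_simps)
    have sq: "csqrt (- \<i> * v) = of_real (sqrt t)"
      using t by (simp add: v_def csqrt_of_real_nonneg)
    have "pi * \<i> * (of_real x)\<^sup>2 / v + of_real (- pi * x\<^sup>2 / t) = 0"
      using t by (simp add: v_def field_simps)
    then have "exp (pi * \<i> * (of_real x)\<^sup>2 / v) * complex_of_real (exp (- pi * x\<^sup>2 / t)) = 1"
      unfolding exp_of_real[symmetric] exp_add[symmetric] by simp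
    then have "theta (- 1 / v) (of_real x / v) =
        exp (pi * \<i> * (of_real x)\<^sup>2 / v) * (complex_of_real (exp (- pi * x\<^sup>2 / t)) * theta (- 1 / v) (of_real x / v))"
      by (simp add: mult.assoc[symmetric])
    also have "complex_of_real (exp (- pi * x\<^sup>2 / t)) * theta (- 1 / v) (of_real x / v) = csqrt (- \<i> * v) * theta v (of_real x)"
      unfolding inv sq using theta_inversion_real[OF t x, symmetric, folded v_def] by (simp only: v_def)
    finally show ?thesis
      unfolding F_def v_def[symmetric] by simp
  qed
  have 2: "F (\<i> * of_real t) z = 0" if t: "t > 0" for t z
  proof (rule analytic_continuation[where f = "\<lambda>z. F (\<i> * of_real t) z" and S = UNIV and U = "of_real ` {0..1}" and \<xi> = 0])
    have "(\<lambda>z. theta (- 1 / (\<i> * of_real t)) (z / (\<i> * of_real t))) holomorphic_on UNIV" "(\<lambda>z. theta (\<i> * of_real t) z) holomorphic_on UNIV"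
      by (intro theta_holomorphic holomorphic_intros; use t Im[of "\<i> * of_real t"] in \<open>simp add: H_def\<close>)+
    then show "(\<lambda>z. F (\<i> * of_real t) z) holomorphic_on UNIV"
      unfolding F_def using t by (intro holomorphic_intros) auto
    show "(0::complex) islimpt of_real ` {0..1}"
    proof (rule islimptI)
      fix T :: "complex set" assume "0 \<in> T" "open T"
      then obtain e where e: "e > 0" "ball 0 e \<subseteq> T"
        using openE by blast
      then have "of_real (min 1 (e / 2)) \<in> of_real ` {0..1} \<inter> T"
        by (auto intro!: imageI subsetD[OF e(2)] simp: min_def)
      moreover have "complex_of_real (min 1 (e / 2)) \<noteq> 0"
        using e(1) by (simp add: min_def)
      ultimately show "\<exists>y\<in>of_real ` {0..1}. y \<in> T \<and> y \<noteq> (0::complex)"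
        by blast
    qed
  qed (use 1[OF t] in auto)
  have "F w z = 0"
  proof (rule analytic_continuation[where f = "\<lambda>w. F w z" and S = H and U = "(\<lambda>t. \<i> * of_real t) ` {0<..}" and \<xi> = \<i>])
    show "(\<lambda>w. F w z) holomorphic_on H"
    proof -
      have "w \<noteq> 0" if "w \<in> H" for w
        using that by (auto simp: H_def)
      moreover have "- \<i> * w \<notin> \<real>\<^sub>\<le>\<^sub>0" if "w \<in> H" for w
        using that by (auto simp: H_def complex_nonpos_Reals_iff)
      ultimately show ?thesis
        unfolding F_def using H Im by (intro holomorphic_intros theta_holomorphic) (auto simp: H_def)
    qed
    show "\<i> islimpt (\<lambda>t. \<i> * of_real t) ` {0<..}"
    proof (rule islimptI)
      fix T :: "complex set" assume "\<i> \<in> T" "open T"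
      then obtain e where e: "e > 0" "ball \<i> e \<subseteq> T"
        using openE by blast
      have "dist \<i> (\<i> * of_real (1 + e / 2)) = e / 2"
        using e(1) by (simp add: dist_norm norm_mult algebra_simps)
      then have "\<i> * of_real (1 + e / 2) \<in> T"
        using e by auto
      then show "\<exists>y\<in>(\<lambda>t. \<i> * of_real t) ` {0<..}. y \<in> T \<and> y \<noteq> \<i>"
        using e(1) by (intro bexI[of _ "\<i> * of_real (1 + e / 2)"]) (auto intro!: imageI simp: complex_eq_iff)
    qed
  qed (use H w 2 in \<open>auto simp: H_def\<close>)
  then show ?thesis
    by (simp add: F_def)
qed

section \<open>The theta function of the lattice\<close>

lemma has_sum_prod_UNIV:
  fixes f :: "'i::finite \<Rightarrow> 'b::countable \<Rightarrow> complex"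
  assumes "\<And>i. (\<lambda>n. norm (f i n)) summable_on UNIV"
  shows "((\<lambda>a. \<Prod>i\<in>UNIV. f i (a i)) has_sum (\<Prod>i\<in>UNIV. \<Sum>\<^sub>\<infinity>n. f i n)) UNIV"
proof -
  have "Infinite_Set_Sum.abs_summable_on (\<lambda>a. \<Prod>i\<in>UNIV. f i (a i)) (PiE UNIV (\<lambda>_. UNIV))"
    by (rule abs_summable_on_prod_PiE) (use assms abs_summable_equivalent in auto)
  then have "Infinite_Sum.abs_summable_on (\<lambda>a. \<Prod>i\<in>UNIV. f i (a i)) (PiE UNIV (\<lambda>_. UNIV))"
    by (rule abs_summable_equivalent[THEN iffD2])
  then have "(\<lambda>a. \<Prod>i\<in>UNIV. f i (a i)) summable_on PiE UNIV (\<lambda>_. UNIV)"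
    by (rule abs_summable_summable)
  moreover have "infsum (\<lambda>a. \<Prod>i\<in>UNIV. f i (a i)) (PiE UNIV (\<lambda>_. UNIV)) = (\<Prod>i\<in>UNIV. \<Sum>\<^sub>\<infinity>n. f i n)"
    by (rule infsum_prod_PiE_abs) (use assms in auto)
  ultimately show ?thesis
    using has_sum_infsum by fastforce
qed

text \<open>The four functions \<open>theta_char\<close> are, up to normalisation, Jacobi's theta functions, written as
  sums over half-integers \<open>m / 2\<close> so that products of eight of them are sums over \<open>half_vec\<close>.\<close>

definition half_term :: "complex \<Rightarrow> complex \<Rightarrow> int \<Rightarrow> complex" where
  "half_term w z m = exp (pi * \<i> * (of_int m)\<^sup>2 / 4 * w + pi * \<i> * of_int m * z)"

definition half_char :: "bool \<Rightarrow> bool \<Rightarrow> int \<Rightarrow> complex" where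
  "half_char c s m = (if odd m = c then if s \<and> odd (m div 2) then -1 else 1 else 0)"

definition theta_char :: "bool \<Rightarrow> bool \<Rightarrow> complex \<Rightarrow> complex \<Rightarrow> complex" where
  "theta_char c s w z = exp (of_bool c * (pi * \<i> * w / 4 + pi * \<i> * z)) *
     theta w (z + of_bool c * w / 2 + of_bool s / 2)"

lemma exp_pi_i_int: "exp (pi * \<i> * of_int n) = (if odd n then -1 else 1)"
proof (cases "even n")
  case True
  then obtain k where "n = 2 * k"
    by (elim evenE)
  then show ?thesis
    using exp_2pi_int[of k] by (simp add: mult_ac)
next
  case False
  then obtain k where "n = 2 * k + 1"
    by (elim oddE)
  then show ?thesis
    using exp_2pi_int[of k] by (simp add: distrib_left exp_add mult_ac)
qed

lemma theta_char_has_sum: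
  assumes w: "Im w > 0"
  shows "((\<lambda>m. half_char c s m * half_term w z m) has_sum theta_char c s w z) UNIV"
proof -
  define e where "e = (if c then 1 else 0 :: int)"
  have eq: "half_char c s (2 * n + e) * half_term w z (2 * n + e) =
      exp (of_bool c * (pi * \<i> * w / 4 + pi * \<i> * z)) * theta_term w (z + of_bool c * w / 2 + of_bool s / 2) n" for n
  proof -
    have "half_char c s (2 * n + e) = exp (of_bool s * (pi * \<i> * of_int n))"
      using exp_pi_i_int[of n] by (simp add: half_char_def e_def)
    then show ?thesis
      unfolding half_term_def theta_term_def
      by (simp only: exp_add[symmetric], intro arg_cong[where f = exp]) (simp add: e_def field_simps power2_eq_square)
  qed
  have "((\<lambda>n. half_char c s (2 * n + e) * half_term w z (2 * n + e)) has_sum theta_char c s w z) UNIV"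
    unfolding eq theta_char_def by (rule has_sum_cmult_right[OF theta_has_sum[OF w]])
  also have "?this \<longleftrightarrow> ((\<lambda>m. half_char c s m * half_term w z m) has_sum theta_char c s w z) {m. odd m = c}"
    by (rule has_sum_reindex_bij_witness[where i = "\<lambda>m. m div 2" and j = "\<lambda>n. 2 * n + e"]) (auto simp: e_def)
  also have "\<dots> \<longleftrightarrow> ((\<lambda>m. half_char c s m * half_term w z m) has_sum theta_char c s w z) UNIV"
    by (rule has_sum_cong_neutral) (auto simp: half_char_def)
  finally show ?thesis .
qed

text \<open>Inversion exchanges shifts by half the modulus with shifts by 1/2, hence the two
  characteristics; the factor - i appears when both are present.\<close>

lemma theta_char_inversion:
  assumes w: "Im w > 0"
  shows "theta_char c s (- 1 / w) (z / w) =
    csqrt (- \<i> * w) * exp (- pi * \<i> / 2) ^ of_bool (c \<and> s) * exp (pi * \<i> * z\<^sup>2 / w) * theta_char s c w z"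
proof -
  have w0: "w \<noteq> 0"
    using w by auto
  define C where "C = (of_bool c :: complex)"
  define D where "D = (of_bool s :: complex)"
  have C2: "C\<^sup>2 = C" "D\<^sup>2 = D"
    by (simp_all add: C_def D_def)
  define u where "u = z - C / 2 + D * w / 2"
  have u: "z / w + C * (- 1 / w) / 2 + D / 2 = u / w"
    using w0 by (simp add: u_def field_simps)
  \<comment> \<open>The inversion formula yields - C/2 where the definition has + C/2; the two
    differ by a period.\<close>
  have "z + D * w / 2 + C / 2 = u + C"
    by (simp add: u_def field_simps)
  then have "theta w u = theta w (z + D * w / 2 + C / 2)"
    by (cases c) (simp_all add: C_def theta_plus_one)
  then have "theta_char c s (- 1 / w) (z / w) =
      exp (C * (pi * \<i> * (- 1 / w) / 4 + pi * \<i> * (z / w))) * (csqrt (- \<i> * w) * exp (pi * \<i> * u\<^sup>2 / w) * theta w (z + D * w / 2 + C / 2))"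
    unfolding theta_char_def C_def[symmetric] D_def[symmetric] u theta_inversion[OF w] by simp
  also have "\<dots> = csqrt (- \<i> * w) * exp (C * (pi * \<i> * (- 1 / w) / 4 + pi * \<i> * (z / w)) + pi * \<i> * u\<^sup>2 / w) * theta w (z + D * w / 2 + C / 2)"
    by (simp add: exp_add mult_ac)
  also have "C * (pi * \<i> * (- 1 / w) / 4 + pi * \<i> * (z / w)) + pi * \<i> * u\<^sup>2 / w =
      - pi * \<i> / 2 * (C * D) + pi * \<i> * z\<^sup>2 / w + D * (pi * \<i> * w / 4 + pi * \<i> * z)"
  proof -
    have u2: "u\<^sup>2 = z\<^sup>2 + C / 4 + D * w\<^sup>2 / 4 - z * C + z * D * w - C * D * w / 2"
    proof -
      have "u\<^sup>2 = z\<^sup>2 + C\<^sup>2 / 4 + D\<^sup>2 * w\<^sup>2 / 4 - z * C + z * D * w - C * D * w / 2"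
        by (simp add: u_def power2_eq_square field_simps)
      then show ?thesis
        by (simp add: C2)
    qed
    show ?thesis
      unfolding u2 using w0 by (simp add: field_simps power2_eq_square)
  qed
  also have "exp (- pi * \<i> / 2 * (C * D) + pi * \<i> * z\<^sup>2 / w + D * (pi * \<i> * w / 4 + pi * \<i> * z)) =
      exp (- pi * \<i> / 2) ^ of_bool (c \<and> s) * exp (pi * \<i> * z\<^sup>2 / w) * exp (D * (pi * \<i> * w / 4 + pi * \<i> * z))"
  proof -
    have "exp (- pi * \<i> / 2 * (C * D)) = exp (- pi * \<i> / 2) ^ of_bool (c \<and> s)"
      by (cases c; cases s) (simp_all add: C_def D_def)
    then show ?thesis
      by (simp only: exp_add)
  qed
  finally show ?thesis
    unfolding theta_char_def C_def[symmetric] D_def[symmetric] by (simp add: mult_ac)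
qed

lemma prod_sign:
  fixes b :: "'i \<Rightarrow> int"
  assumes "finite A"
  shows "(\<Prod>i\<in>A. if odd (b i) then -1 else 1 :: complex) = (if odd (\<Sum>i\<in>A. b i) then -1 else 1)"
  using assms by induction auto

text \<open>\<open>c\<close> selects a common parity of all coordinates. Within a class the two
  values of \<open>s\<close> contribute 1 and the sign of the sum of the \<open>a i div 2\<close>,
  which tests divisibility of the coordinate sum by 4: the eight remainders of an odd vector add 8,
  which is 0 modulo 4.\<close>

lemma sum_half_char:
  "(\<Sum>c\<in>UNIV. \<Sum>s\<in>UNIV. \<Prod>i\<in>UNIV. half_char c s (a i)) = (if half_vec a \<in> E8 then 2 else 0)"
proof (cases "\<forall>i j. even (a i - a j)")
  case True
  define c where "c = odd (a 0)"
  have c: "odd (a i) = c" for i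
    using True[rule_format, of i 0] by (auto simp: c_def)
  have zero: "(\<Prod>i\<in>UNIV. half_char (\<not> c) s (a i)) = 0" for s
    by (rule prod_zero) (auto simp: half_char_def c)
  have 1: "(\<Prod>i\<in>UNIV. half_char c False (a i)) = 1"
    by (simp add: half_char_def c)
  have 2: "(\<Prod>i\<in>UNIV. half_char c True (a i)) = (if odd (\<Sum>i\<in>UNIV. a i div 2) then -1 else 1)"
    using prod_sign[of UNIV "\<lambda>i. a i div 2"] by (simp add: half_char_def c)
  have "(\<Sum>i\<in>UNIV. a i) = (\<Sum>i\<in>UNIV. 2 * (a i div 2) + (if c then 1 else 0))"
  proof (rule sum.cong[OF HOL.refl])
    fix i
    show "a i = 2 * (a i div 2) + (if c then 1 else 0)"
      using c[of i] by (cases c) (auto elim!: evenE oddE)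
  qed
  also have "\<dots> = 2 * (\<Sum>i\<in>UNIV. a i div 2) + (if c then 8 else 0)"
    by (simp add: sum.distrib sum_distrib_left)
  finally have "4 dvd (\<Sum>i\<in>UNIV. a i) \<longleftrightarrow> even (\<Sum>i\<in>UNIV. a i div 2)"
    by (cases c) (simp_all, presburger+)
  then have E8: "half_vec a \<in> E8 \<longleftrightarrow> even (\<Sum>i\<in>UNIV. a i div 2)"
    using True by (simp add: half_vec_in_E8_iff)
  have "(\<Sum>c\<in>UNIV. \<Sum>s\<in>UNIV. \<Prod>i\<in>UNIV. half_char c s (a i)) =
      (\<Sum>s\<in>UNIV. \<Prod>i\<in>UNIV. half_char c s (a i)) + (\<Sum>s\<in>UNIV. \<Prod>i\<in>UNIV. half_char (\<not> c) s (a i))"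
    by (cases c) (simp_all add: UNIV_bool)
  also have "\<dots> = (if half_vec a \<in> E8 then 2 else 0)"
    unfolding zero E8 by (simp add: UNIV_bool 1 2)
  finally show ?thesis .
next
  case False
  then obtain i j where ij: "odd (a i - a j)"
    by blast
  have zero: "(\<Prod>i\<in>UNIV. half_char c s (a i)) = 0" for c s
  proof -
    have "half_char c s (a i) = 0 \<or> half_char c s (a j) = 0"
      using ij by (auto simp: half_char_def)
    then show ?thesis
      by (auto intro: prod_zero)
  qed
  have "half_vec a \<notin> E8"
    using False by (simp add: half_vec_in_E8_iff)
  then show ?thesis
    by (simp add: zero del: prod_zero_iff)
qed

definition E8_theta_term :: "complex \<Rightarrow> complex^8 \<Rightarrow> real^8 \<Rightarrow> complex" where
  "E8_theta_term w z l = exp (pi * \<i> * of_real (l \<bullet> l) * w + 2 * pi * \<i> * cdot (cvec l) z)"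

definition E8_theta :: "complex \<Rightarrow> complex^8 \<Rightarrow> complex" where
  "E8_theta w z = (\<Sum>\<^sub>\<infinity>l\<in>E8. E8_theta_term w z l)"

lemma E8_theta_term_half_vec:
  "E8_theta_term w z (half_vec a) = (\<Prod>i\<in>UNIV. half_term w (z $ i) (a i))"
proof -
  have "(\<Sum>i\<in>UNIV. pi * \<i> * (of_int (a i))\<^sup>2 / 4 * w + pi * \<i> * of_int (a i) * z $ i) =
      pi * \<i> * of_real (half_vec a \<bullet> half_vec a) * w + 2 * pi * \<i> * cdot (cvec (half_vec a)) z"
    by (simp add: inner_vec_def cdot_def cvec_def sum.distrib sum_distrib_left sum_distrib_right power2_eq_square)
      (intro arg_cong2[where f = "(+)"] sum.cong HOL.refl; simp add: field_simps)
  then show ?thesis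
    unfolding E8_theta_term_def half_term_def by (simp only: exp_sum[OF finite, symmetric])
qed

text \<open>Each product of eight one-variable series expands into a sum over all integer vectors.
  By \<open>sum_half_char\<close> the four products together count every lattice vector twice and
  cancel all others.\<close>

lemma E8_theta_has_sum_theta_char:
  assumes w: "Im w > 0"
  shows "(E8_theta_term w z has_sum (\<Sum>c\<in>UNIV. \<Sum>s\<in>UNIV. \<Prod>i\<in>UNIV. theta_char c s w (z $ i)) / 2) E8"
proof -
  have 1: "((\<lambda>a. \<Prod>i\<in>UNIV. half_char c s (a i) * half_term w (z $ i) (a i)) has_sum
      (\<Prod>i\<in>UNIV. theta_char c s w (z $ i))) UNIV" for c s
    using has_sum_prod_UNIV[of "\<lambda>i m. half_char c s m * half_term w (z $ i) m", OF summable_on_norm_complex[OF theta_char_has_sum[OF w]]]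
    by (simp add: infsumI[OF theta_char_has_sum[OF w]])
  have "((\<lambda>a. (\<Sum>c\<in>UNIV. \<Sum>s\<in>UNIV. \<Prod>i\<in>UNIV. half_char c s (a i) * half_term w (z $ i) (a i)) * (1 / 2)) has_sum
      (\<Sum>c\<in>UNIV. \<Sum>s\<in>UNIV. \<Prod>i\<in>UNIV. theta_char c s w (z $ i)) * (1 / 2)) UNIV"
    by (intro has_sum_cmult_left has_sum_sum 1)
  moreover have "(\<Sum>c\<in>UNIV. \<Sum>s\<in>UNIV. \<Prod>i\<in>UNIV. half_char c s (a i) * half_term w (z $ i) (a i)) * (1 / 2) =
      (if half_vec a \<in> E8 then E8_theta_term w z (half_vec a) else 0)" for a
    by (simp add: prod.distrib sum_half_char E8_theta_term_half_vec flip: sum_distrib_right)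
  ultimately have "((\<lambda>a. if half_vec a \<in> E8 then E8_theta_term w z (half_vec a) else 0) has_sum
      (\<Sum>c\<in>UNIV. \<Sum>s\<in>UNIV. \<Prod>i\<in>UNIV. theta_char c s w (z $ i)) / 2) UNIV"
    by simp
  also have "?this \<longleftrightarrow> ((\<lambda>a. E8_theta_term w z (half_vec a)) has_sum
      (\<Sum>c\<in>UNIV. \<Sum>s\<in>UNIV. \<Prod>i\<in>UNIV. theta_char c s w (z $ i)) / 2) {a. half_vec a \<in> E8}"
    by (rule has_sum_cong_neutral) auto
  also have "\<dots> \<longleftrightarrow> (E8_theta_term w z has_sum (\<Sum>c\<in>UNIV. \<Sum>s\<in>UNIV. \<Prod>i\<in>UNIV. theta_char c s w (z $ i)) / 2) (half_vec ` {a. half_vec a \<in> E8})"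
    using has_sum_reindex[OF inj_on_subset[OF inj_half_vec], of "{a. half_vec a \<in> E8}" "E8_theta_term w z"]
    by (simp add: o_def)
  also have "half_vec ` {a. half_vec a \<in> E8} = E8"
    using E8_eq_half_vec by auto
  finally show ?thesis .
qed

lemma E8_theta_has_sum:
  assumes w: "Im w > 0"
  shows "(E8_theta_term w z has_sum E8_theta w z) E8"
  unfolding E8_theta_def by (rule has_sum_infsum[OF has_sum_imp_summable[OF E8_theta_has_sum_theta_char[OF w]]])

lemma E8_theta_eq_theta_char:
  assumes w: "Im w > 0"
  shows "E8_theta w z = (\<Sum>c\<in>UNIV. \<Sum>s\<in>UNIV. \<Prod>i\<in>UNIV. theta_char c s w (z $ i)) / 2"
  using has_sum_unique[OF E8_theta_has_sum[OF w] E8_theta_has_sum_theta_char[OF w]] .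

text \<open>Exchanging characteristics permutes the four products. Eight factors turn the square
  root into \<open>w ^ 4\<close> and remove the fourth root of unity.\<close>

lemma E8_theta_inversion:
  assumes w: "Im w > 0"
  shows "E8_theta (- 1 / w) (inverse w *s z) = w ^ 4 * exp (pi * \<i> * cdot z z / w) * E8_theta w z"
proof -
  have Im: "Im (- 1 / w) > 0"
    using w by (simp add: Im_divide sum_power2_gt_zero_iff)
  have sq: "csqrt (- \<i> * w) ^ 8 = w ^ 4"
  proof -
    have "csqrt (- \<i> * w) ^ 8 = ((csqrt (- \<i> * w))\<^sup>2) ^ 4"
      by (simp only: power_mult[symmetric]) simp
    also have "\<dots> = w ^ 4"
      by (simp only: power2_csqrt) (simp add: power_mult_distrib)
    finally show ?thesis .
  qed
  have e8: "exp (- pi * \<i> / 2) ^ 8 = 1"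
    using exp_2pi_int[of "-2"] by (simp add: exp_of_nat_mult[symmetric] mult_ac)
  have "(\<Prod>i\<in>UNIV. theta_char c s (- 1 / w) ((inverse w *s z) $ i)) =
      w ^ 4 * exp (pi * \<i> * cdot z z / w) * (\<Prod>i\<in>UNIV. theta_char s c w (z $ i))" for c s
  proof -
    have "(\<Prod>i\<in>UNIV. theta_char c s (- 1 / w) ((inverse w *s z) $ i)) =
        (\<Prod>i\<in>UNIV. csqrt (- \<i> * w) * exp (- pi * \<i> / 2) ^ of_bool (c \<and> s) * exp (pi * \<i> * (z $ i)\<^sup>2 / w) * theta_char s c w (z $ i))"
    proof -
      have "(inverse w *s z) $ i = z $ i / w" for i
        by (simp add: divide_inverse)
      then show ?thesis
        by (simp only: theta_char_inversion[OF w])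
    qed
    also have "\<dots> = csqrt (- \<i> * w) ^ 8 * (exp (- pi * \<i> / 2) ^ of_bool (c \<and> s)) ^ 8 *
        (\<Prod>i\<in>UNIV. exp (pi * \<i> * (z $ i)\<^sup>2 / w)) * (\<Prod>i\<in>UNIV. theta_char s c w (z $ i))"
      by (simp add: prod.distrib power_mult_distrib)
    also have "(exp (- pi * \<i> / 2) ^ of_bool (c \<and> s)) ^ 8 = 1"
      using e8 by (cases "c \<and> s") auto
    also have "(\<Prod>i\<in>UNIV. exp (pi * \<i> * (z $ i)\<^sup>2 / w)) = exp (pi * \<i> * cdot z z / w)"
      by (simp only: exp_sum[OF finite, symmetric]) (simp add: cdot_def sum_distrib_left sum_divide_distrib power2_eq_square)
    finally show ?thesis
      by (simp only: sq mult_1_right)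
  qed
  then have "E8_theta (- 1 / w) (inverse w *s z) =
      w ^ 4 * exp (pi * \<i> * cdot z z / w) * ((\<Sum>c\<in>UNIV. \<Sum>s\<in>UNIV. \<Prod>i\<in>UNIV. theta_char s c w (z $ i)) / 2)"
    unfolding E8_theta_eq_theta_char[OF Im] by (simp add: sum_distrib_left)
  also have "(\<Sum>c\<in>UNIV. \<Sum>s\<in>UNIV. \<Prod>i\<in>UNIV. theta_char s c w (z $ i)) = (\<Sum>c\<in>UNIV. \<Sum>s\<in>UNIV. \<Prod>i\<in>UNIV. theta_char c s w (z $ i))"
    by (rule sum.swap)
  finally show ?thesis
    unfolding E8_theta_eq_theta_char[OF w] .
qed

text \<open>The shift by \<open>x\<close> moves the summation index; the shift by \<open>y\<close>
  changes each exponent by a multiple of 2 pi i.\<close>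

lemma E8_theta_translation:
  assumes x: "x \<in> E8" and y: "y \<in> E8"
  shows "E8_theta w (z + w *s cvec x + cvec y) = exp (- pi * \<i> * (of_real (x \<bullet> x) * w + 2 * cdot (cvec x) z)) * E8_theta w z"
proof -
  define e where "e = exp (- pi * \<i> * (of_real (x \<bullet> x) * w + 2 * cdot (cvec x) z))"
  have "E8_theta_term w (z + w *s cvec x + cvec y) l = e * E8_theta_term w z (l + x)" if l: "l \<in> E8" for l
  proof -
    obtain n where n: "l \<bullet> y = of_int n"
      using E8_inner_int[OF l y] .
    have "E8_theta_term w (z + w *s cvec x + cvec y) l =
        exp (pi * \<i> * of_real (l \<bullet> l) * w + 2 * pi * \<i> * (cdot (cvec l) z + w * of_real (l \<bullet> x)) + 2 * pi * \<i> * of_int n)"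
      by (simp add: E8_theta_term_def cdot_simps n algebra_simps)
    also have "\<dots> = exp (pi * \<i> * of_real (l \<bullet> l) * w + 2 * pi * \<i> * (cdot (cvec l) z + w * of_real (l \<bullet> x)))"
      unfolding exp_add[of _ "2 * pi * \<i> * of_int n"] exp_2pi_int by simp
    also have "\<dots> = e * E8_theta_term w z (l + x)"
      unfolding e_def E8_theta_term_def exp_add[symmetric]
      by (intro arg_cong[where f = exp]) (simp add: cvec_add cdot_simps inner_add inner_commute algebra_simps)
    finally show ?thesis .
  qed
  then have "E8_theta w (z + w *s cvec x + cvec y) = (\<Sum>\<^sub>\<infinity>l\<in>E8. e * E8_theta_term w z (l + x))"
    unfolding E8_theta_def by (intro infsum_cong) simp
  also have "\<dots> = e * (\<Sum>\<^sub>\<infinity>l\<in>E8. E8_theta_term w z (l + x))"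
    by (rule infsum_cmult_right')
  also have "(\<Sum>\<^sub>\<infinity>l\<in>E8. E8_theta_term w z (l + x)) = E8_theta w z"
    unfolding E8_theta_def
    by (rule infsum_reindex_bij_witness[where i = "\<lambda>l. l - x" and j = "\<lambda>l. l + x"]) (auto simp: E8_add E8_diff x)
  finally show ?thesis
    by (simp add: e_def)
qed

lemma E8_theta_shift: "E8_theta (w + 1) z = E8_theta w z"
  unfolding E8_theta_def
proof (rule infsum_cong)
  fix l assume "l \<in> E8"
  then obtain n where n: "l \<bullet> l = 2 * of_nat n"
    by (rule E8_norm_even)
  have "E8_theta_term (w + 1) z l = E8_theta_term w z l * exp (2 * pi * \<i> * of_int (int n))"
    unfolding E8_theta_term_def exp_add[symmetric] n
    by (intro arg_cong[where f = exp]) (simp add: algebra_simps)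
  then show "E8_theta_term (w + 1) z l = E8_theta_term w z l"
    unfolding exp_2pi_int by simp
qed

lemma E8_theta_minus: "E8_theta w (- z) = E8_theta w z"
proof -
  have "cdot (cvec (- l)) z = cdot (cvec l) (- z)" for l
    by (simp add: cdot_def cvec_def)
  then show ?thesis
    unfolding E8_theta_def
    by (intro infsum_reindex_bij_witness[where i = uminus and j = uminus]) (auto simp: E8_minus E8_theta_term_def)
qed

text \<open>The reflection is an isometric involution of \<open>E8\<close>, so it permutes the
  terms.\<close>

lemma E8_theta_reflection:
  assumes r: "r \<in> E8" "r \<bullet> r = 2"
  shows "E8_theta w (reflection r z) = E8_theta w z"
proof -
  define s where "s l = l - (l \<bullet> r) *\<^sub>R r" for l
  have s_E8: "s l \<in> E8" if l: "l \<in> E8" for l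
  proof -
    obtain n where "l \<bullet> r = of_int n"
      using E8_inner_int[OF l r(1)] .
    then show ?thesis
      using E8_diff[OF l E8_scale[OF r(1), of n]] by (simp add: s_def)
  qed
  have s_s: "s (s l) = l" for l
    by (simp add: s_def inner_diff r(2) algebra_simps)
  have s_norm: "s l \<bullet> s l = l \<bullet> l" for l
    by (simp add: s_def inner_diff r(2) inner_commute algebra_simps)
  show ?thesis
    unfolding E8_theta_def
    by (rule infsum_reindex_bij_witness[where i = s and j = s])
      (auto simp: s_E8 s_s E8_theta_term_def s_norm cdot_cvec_reflection simp flip: s_def)
qed

section \<open>Weak Jacobi forms of index one\<close>

text \<open>Distinct vectors give distinct exponents, so the coefficients are 0 or 1 and no terms
  have to be collected. The freedom in \<open>A\<close> and \<open>L\<close> serves the summands of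
  \<open>A2\<close>, which need doubled vectors and a proper subset of \<open>E8\<close>.\<close>

lemma jacobi_expansion_of_injection:
  fixes N :: "real^8 \<Rightarrow> nat" and L :: "real^8 \<Rightarrow> real^8"
  assumes inj: "inj_on (\<lambda>l. (N l, L l)) A" and L: "\<And>l. l \<in> A \<Longrightarrow> L l \<in> E8"
    and sum: "\<And>\<tau> z. ((\<lambda>l. nome \<tau> ^ N l * exp (2 * pi * \<i> * cdot (cvec (L l)) z)) has_sum \<phi> \<tau> z) A"
  shows "jacobi_expansion (\<lambda>n l. of_bool ((n, l) \<in> (\<lambda>l. (N l, L l)) ` A)) \<phi>"
  unfolding jacobi_expansion_def
proof (intro allI)
  fix \<tau> and z :: "complex^8"
  define g where "g p = nome \<tau> ^ fst p * exp (2 * pi * \<i> * cdot (cvec (snd p)) z)"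
    for p :: "nat \<times> (real^8)"
  have "(g has_sum \<phi> \<tau> z) ((\<lambda>l. (N l, L l)) ` A)"
    using sum[of \<tau> z] by (subst has_sum_reindex[OF inj]) (simp add: g_def o_def)
  also have "?this \<longleftrightarrow> ((\<lambda>p. of_bool (p \<in> (\<lambda>l. (N l, L l)) ` A) * g p) has_sum \<phi> \<tau> z) (UNIV \<times> E8)"
    by (rule has_sum_cong_neutral) (use L in auto)
  finally show "((\<lambda>(n, l). of_bool ((n, l) \<in> (\<lambda>l. (N l, L l)) ` A) * nome \<tau> ^ n *
      exp (2 * pi * \<i> * cdot (cvec l) z)) has_sum \<phi> \<tau> z) (UNIV \<times> E8)"
    by (simp add: g_def case_prod_unfold mult.assoc)
qed

definition half_norm :: "real^8 \<Rightarrow> nat" where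
  "half_norm l = nat \<lfloor>l \<bullet> l / 2\<rfloor>"

lemma half_norm: "l \<in> E8 \<Longrightarrow> l \<bullet> l = 2 * real (half_norm l)"
  by (erule E8_norm_even) (simp add: half_norm_def)

lemma half_norm_eq_0: "l \<in> E8 \<Longrightarrow> half_norm l = 0 \<longleftrightarrow> l = 0"
  using half_norm[of l] by auto

lemma E8_theta_term_nome:
  assumes "l \<in> E8"
  shows "E8_theta_term w z l = exp (2 * pi * \<i> * w) ^ half_norm l * exp (2 * pi * \<i> * cdot (cvec l) z)"
  unfolding E8_theta_term_def half_norm[OF assms] exp_of_nat_mult[symmetric] exp_add[symmetric]
  by (intro arg_cong[where f = exp]) (simp add: mult_ac)

lemma E8_theta_expansion:
  "jacobi_expansion (\<lambda>n l. of_bool ((n, l) \<in> (\<lambda>l. (half_norm l, l)) ` E8)) (\<lambda>\<tau>. E8_theta (Rep_uhp \<tau>))"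
proof (rule jacobi_expansion_of_injection)
  fix \<tau> and z :: "complex^8"
  show "((\<lambda>l. nome \<tau> ^ half_norm l * exp (2 * pi * \<i> * cdot (cvec l) z)) has_sum E8_theta (Rep_uhp \<tau>) z) E8"
    by (rule has_sum_cong[THEN iffD1, OF _ E8_theta_has_sum[OF Im_Rep_uhp]]) (rule E8_theta_term_nome)
qed (auto simp: inj_on_def)

lemma Rep_mobius_S: "Rep_uhp (mobius 0 (- 1) 1 0 \<tau>) = - 1 / Rep_uhp \<tau>"
  using Rep_mobius[of 0 0 "-1" 1 \<tau>] by simp

lemma Rep_uhp_nonzero: "Rep_uhp \<tau> \<noteq> 0"
  using Im_Rep_uhp[of \<tau>] by auto

lemma weak_jacobi_form_E8_theta: "weak_jacobi_form 4 1 (\<lambda>\<tau>. E8_theta (Rep_uhp \<tau>))"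
proof (rule weak_jacobi_formI[OF jacobi_expansion_holomorphic[OF E8_theta_expansion] E8_theta_expansion])
  fix x \<tau> and z :: "complex^8"
  assume "x \<in> E8"
  from E8_theta_translation[OF this E8_zero, of "Rep_uhp \<tau>" z]
  show "E8_theta (Rep_uhp \<tau>) (z + Rep_uhp \<tau> *s cvec x) =
      exp (- of_nat 1 * pi * \<i> * (of_real (x \<bullet> x) * Rep_uhp \<tau> + 2 * cdot (cvec x) z)) * E8_theta (Rep_uhp \<tau>) z"
    by simp
next
  show "jacobi_law 4 1 (\<lambda>\<tau>. E8_theta (Rep_uhp \<tau>)) 0 (- 1) 1 0"
    using E8_theta_inversion[OF Im_Rep_uhp] by (simp add: jacobi_law_def Rep_mobius_S)
qed (rule E8_theta_reflection)

text \<open>For fixed \<open>w\<close> the Fourier coefficient at the zero vector is 1, which rules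
  out vanishing at all real points.\<close>

lemma E8_theta_not_identically_zero:
  assumes w: "Im w > 0"
  obtains z where "E8_theta w z \<noteq> 0"
proof -
  have "\<exists>z. E8_theta w z \<noteq> 0"
  proof (rule ccontr)
    assume zero: "\<not> (\<exists>z. E8_theta w z \<noteq> 0)"
    have "exp (pi * \<i> * of_real ((0::real^8) \<bullet> 0) * w) = 0"
    proof (rule fourier_coefficient_zero)
      fix y :: "real^8"
      have "E8_theta_term w (cvec y) = (\<lambda>l. exp (pi * \<i> * of_real (l \<bullet> l) * w) * exp (2 * pi * \<i> * of_real (l \<bullet> y)))"
        by (simp add: fun_eq_iff E8_theta_term_def exp_add cdot_simps)
      then show "((\<lambda>l. exp (pi * \<i> * of_real (l \<bullet> l) * w) * exp (2 * pi * \<i> * of_real (l \<bullet> y))) has_sum 0) E8"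
        using E8_theta_has_sum[OF w, of "cvec y"] zero by simp
    qed
    then show False
      by simp
  qed
  then show ?thesis
    using that by blast
qed

lemma weak_jacobi_form_translation:
  assumes "weak_jacobi_form k t \<phi>" "x \<in> E8"
  shows "\<phi> \<tau> (z + Rep_uhp \<tau> *s cvec x) =
    exp (- of_nat t * pi * \<i> * (of_real (x \<bullet> x) * Rep_uhp \<tau> + 2 * cdot (cvec x) z)) * \<phi> \<tau> z"
proof -
  have "\<forall>x\<in>E8. \<forall>y\<in>E8. \<forall>\<tau> z. \<phi> \<tau> (z + Rep_uhp \<tau> *s cvec x + cvec y) =
        exp (- of_nat t * pi * \<i> * (of_real (x \<bullet> x) * Rep_uhp \<tau> + 2 * cdot (cvec x) z)) * \<phi> \<tau> z"
    using assms(1) unfolding weak_jacobi_form_def by blast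
  from this[rule_format, OF assms(2) E8_zero, of \<tau> z] show ?thesis
    by simp
qed

text \<open>Since \<open>E8\<close> is unimodular, the translation law determines all Fourier coefficients in \<open>z\<close> of a form
  of index one from the coefficient at \<open>l = 0\<close>, which is then a modular form of weight \<open>k - 4\<close>.\<close>

lemma weak_jacobi_form_index_1_zero:
  assumes \<phi>: "weak_jacobi_form k 1 \<phi>" and k: "k < 4"
  shows "\<phi> = 0"
proof -
  obtain f where f: "jacobi_expansion f \<phi>"
    using \<phi> unfolding weak_jacobi_form_def jacobi_expansion_def by blast
  define q where "q \<tau> = nome \<tau>" for \<tau>
  define g where "g \<tau> l = (\<Sum>\<^sub>\<infinity>n. f n l * q \<tau> ^ n)" for \<tau> l
  have swap: "((\<lambda>(l, n). f n l * q \<tau> ^ n * exp (2 * pi * \<i> * cdot (cvec l) z)) has_sum \<phi> \<tau> z) (E8 \<times> UNIV)" for \<tau> z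
    using jacobi_expansionD[OF f, of \<tau> z] unfolding q_def
    by (subst has_sum_swap) (simp add: case_prod_unfold)
  have g_summable: "(\<lambda>n. f n l * q \<tau> ^ n) summable_on UNIV" if "l \<in> E8" for \<tau> l
    using summable_on_SigmaD1[OF has_sum_imp_summable[OF swap[of \<tau> 0]] that] by simp
  have g: "((\<lambda>l. g \<tau> l * exp (2 * pi * \<i> * cdot (cvec l) z)) has_sum \<phi> \<tau> z) E8" for \<tau> z
  proof (rule has_sum_SigmaD[OF swap])
    fix l assume "l \<in> E8"
    from has_sum_cmult_left[OF has_sum_infsum[OF g_summable[OF this]]]
    show "((\<lambda>n. case (l, n) of (l, n) \<Rightarrow> f n l * q \<tau> ^ n * exp (2 * pi * \<i> * cdot (cvec l) z)) has_sum
        g \<tau> l * exp (2 * pi * \<i> * cdot (cvec l) z)) UNIV"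
      by (simp add: g_def)
  qed
  have coeff: "g \<tau> x = exp (pi * \<i> * of_real (x \<bullet> x) * Rep_uhp \<tau>) * g \<tau> 0" if x: "x \<in> E8" for \<tau> x
  proof -
    define w where "w = Rep_uhp \<tau>"
    define e where "e = exp (- pi * \<i> * (of_real (x \<bullet> x) * w))"
    \<comment> \<open>Two expansions of \<phi> at y + \<tau> x in the real vector y, one by
      substitution and one by the translation law; their coefficients at the zero vector are
      compared.\<close>
    have "g \<tau> 0 * exp (2 * pi * \<i> * (w * of_real (0 \<bullet> x))) - e * g \<tau> (0 + x) = 0"
    proof (rule fourier_coefficient_zero)
      fix y :: "real^8"
      have 1: "((\<lambda>l. g \<tau> l * exp (2 * pi * \<i> * (w * of_real (l \<bullet> x))) * exp (2 * pi * \<i> * of_real (l \<bullet> y)))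
          has_sum \<phi> \<tau> (cvec y + w *s cvec x)) E8"
        by (rule has_sum_cong[THEN iffD1, OF _ g]) (simp add: cdot_simps distrib_left exp_add mult_ac)
      have "((\<lambda>l. g \<tau> l * exp (2 * pi * \<i> * cdot (cvec l) (cvec y))) has_sum \<phi> \<tau> (cvec y)) E8 \<longleftrightarrow>
          ((\<lambda>l. g \<tau> (l + x) * exp (2 * pi * \<i> * cdot (cvec (l + x)) (cvec y))) has_sum \<phi> \<tau> (cvec y)) E8"
        by (rule has_sum_reindex_bij_witness[where i = "\<lambda>l. l + x" and j = "\<lambda>l. l - x"]) (auto simp: E8_add E8_diff x)
      then have "((\<lambda>l. g \<tau> (l + x) * exp (2 * pi * \<i> * cdot (cvec (l + x)) (cvec y))) has_sum \<phi> \<tau> (cvec y)) E8"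
        using g by simp
      note 3 = has_sum_cmult_right[OF this, of "exp (- pi * \<i> * (of_real (x \<bullet> x) * w + 2 * cdot (cvec x) (cvec y)))"]
      have val: "exp (- pi * \<i> * (of_real (x \<bullet> x) * w + 2 * cdot (cvec x) (cvec y))) * \<phi> \<tau> (cvec y) = \<phi> \<tau> (cvec y + w *s cvec x)"
        using weak_jacobi_form_translation[OF \<phi> x, of \<tau> "cvec y"] by (simp add: w_def)
      have 2: "((\<lambda>l. e * g \<tau> (l + x) * exp (2 * pi * \<i> * of_real (l \<bullet> y))) has_sum \<phi> \<tau> (cvec y + w *s cvec x)) E8"
      proof (rule has_sum_cong[THEN iffD1, OF _ 3[unfolded val]])
        fix l :: "real^8"
        have "exp (- pi * \<i> * (of_real (x \<bullet> x) * w + 2 * cdot (cvec x) (cvec y))) * exp (2 * pi * \<i> * cdot (cvec (l + x)) (cvec y)) =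
            e * exp (2 * pi * \<i> * of_real (l \<bullet> y))"
          unfolding e_def exp_add[symmetric]
          by (intro arg_cong[where f = exp]) (simp add: cvec_add cdot_simps algebra_simps)
        then show "exp (- pi * \<i> * (of_real (x \<bullet> x) * w + 2 * cdot (cvec x) (cvec y))) * (g \<tau> (l + x) * exp (2 * pi * \<i> * cdot (cvec (l + x)) (cvec y))) =
            e * g \<tau> (l + x) * exp (2 * pi * \<i> * of_real (l \<bullet> y))"
          by (simp add: mult_ac)
      qed
      show "((\<lambda>l. (g \<tau> l * exp (2 * pi * \<i> * (w * of_real (l \<bullet> x))) - e * g \<tau> (l + x)) * exp (2 * pi * \<i> * of_real (l \<bullet> y))) has_sum 0) E8"
        using has_sum_diff[OF 1 2] by (simp add: left_diff_distrib)
    qed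
    then have "g \<tau> 0 = e * g \<tau> x"
      by simp
    moreover have "exp (pi * \<i> * of_real (x \<bullet> x) * w) * e = 1"
      unfolding e_def exp_add[symmetric] by simp
    ultimately show ?thesis
      by (simp add: w_def mult.assoc[symmetric])
  qed
  define h where "h \<tau> = g \<tau> 0" for \<tau>
  have \<phi>_eq: "\<phi> \<tau> z = h \<tau> * E8_theta (Rep_uhp \<tau>) z" for \<tau> z
  proof (rule has_sum_unique[OF g])
    show "((\<lambda>l. g \<tau> l * exp (2 * pi * \<i> * cdot (cvec l) z)) has_sum h \<tau> * E8_theta (Rep_uhp \<tau>) z) E8"
    proof (rule has_sum_cong[THEN iffD1, OF _ has_sum_cmult_right[OF E8_theta_has_sum[OF Im_Rep_uhp]]])
      fix l assume "l \<in> E8"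
      then show "h \<tau> * E8_theta_term (Rep_uhp \<tau>) z l = g \<tau> l * exp (2 * pi * \<i> * cdot (cvec l) z)"
        by (simp add: coeff E8_theta_term_def exp_add h_def)
    qed
  qed
  have law: "h (mobius a b c d \<tau>) = (of_int c * Rep_uhp \<tau> + of_int d) powi (k - 4) * h \<tau>"
    if det: "a * d - b * c = 1" for a b c d \<tau>
  proof -
    \<comment> \<open>The laws of \<phi> and of the theta function are compared at a point where the
      latter is nonzero. Both have index 1, so the exponential factors cancel.\<close>
    obtain z where z: "E8_theta (Rep_uhp \<tau>) z \<noteq> 0"
      using E8_theta_not_identically_zero[OF Im_Rep_uhp] .
    define j where "j = of_int c * Rep_uhp \<tau> + of_int d"
    define e where "e = exp (of_nat 1 * pi * \<i> * (of_int c * cdot z z / j))"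
    have j: "j \<noteq> 0"
      using automorphy_factor_nonzero[OF det] by (simp add: j_def)
    have 1: "\<phi> (mobius a b c d \<tau>) (inverse j *s z) = j powi k * e * \<phi> \<tau> z"
      using \<phi> det unfolding weak_jacobi_form_def j_def e_def by blast
    have 2: "E8_theta (Rep_uhp (mobius a b c d \<tau>)) (inverse j *s z) = j powi 4 * e * E8_theta (Rep_uhp \<tau>) z"
      using weak_jacobi_form_E8_theta det unfolding weak_jacobi_form_def j_def e_def by blast
    have "h (mobius a b c d \<tau>) * (j powi 4 * e * E8_theta (Rep_uhp \<tau>) z) = j powi k * e * (h \<tau> * E8_theta (Rep_uhp \<tau>) z)"
      using 1 unfolding \<phi>_eq 2 .
    moreover have "e \<noteq> 0"
      by (simp add: e_def)
    ultimately have "h (mobius a b c d \<tau>) * j powi 4 = j powi k * h \<tau>"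
      using z by simp
    then show ?thesis
      using j unfolding j_def[symmetric] by (simp add: power_int_diff field_simps)
  qed
  have sums: "(\<lambda>n. f n 0 * nome \<tau> ^ n) sums h \<tau>" for \<tau>
    using has_sum_imp_sums[OF has_sum_infsum[OF g_summable[OF E8_zero]]] by (simp add: h_def g_def q_def)
  have "h \<tau> = 0" for \<tau>
    by (rule negative_weight_zero[OF _ law sums]) (use k in simp)
  then show ?thesis
    by (simp add: fun_eq_iff \<phi>_eq)
qed

section \<open>Forms of index two\<close>

text \<open>Every point of the punctured disc is a nome, so the series converges on the whole disc.
  Products and reciprocals can then be formed there, with the cusp as centre.\<close>

lemma nome_power_series:
  assumes "\<And>\<tau>. (\<lambda>n. a n * nome \<tau> ^ n) sums f \<tau>"
  obtains H where "\<And>x. cmod x < 1 \<Longrightarrow> (\<lambda>n. a n * x ^ n) sums H x" "H holomorphic_on ball 0 1"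
    "\<And>\<tau>. f \<tau> = H (nome \<tau>)" "H 0 = a 0"
proof -
  define H where "H x = suminf (\<lambda>n. a n * x ^ n)" for x
  have sums: "(\<lambda>n. a n * x ^ n) sums H x" if "cmod x < 1" for x
  proof (cases "x = 0")
    case True
    then show ?thesis
      unfolding H_def by (simp add: sums_iff)
  next
    case False
    then obtain \<tau> where "nome \<tau> = x"
      using exp_surj_punctured_disc \<open>cmod x < 1\<close> by blast
    then show ?thesis
      using assms[of \<tau>] unfolding H_def by (simp add: sums_iff)
  qed
  moreover have "H holomorphic_on ball 0 1"
    by (rule power_series_holomorphic[where a = a]) (use sums in simp)
  moreover have "f \<tau> = H (nome \<tau>)" for \<tau>
    using assms[of \<tau>] unfolding H_def by (simp add: sums_iff)
  moreover have "H 0 = a 0"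
    by (simp add: H_def powser_zero)
  ultimately show ?thesis
    using that by blast
qed

lemma norm_nome_less_1: "cmod (nome \<tau>) < 1"
  unfolding norm_exp_2pi_i using Im_Rep_uhp[of \<tau>] by simp

text \<open>The power series gives holomorphy and invariance under \<tau> + 1, which leaves the
  inversion.\<close>

lemma modular_formI:
  assumes sums: "\<And>\<tau>. (\<lambda>n. a n * nome \<tau> ^ n) sums f \<tau>"
    and S: "\<And>\<tau>. f (mobius 0 (-1) 1 0 \<tau>) = Rep_uhp \<tau> powi k * f \<tau>"
  shows "modular_form k f"
proof -
  obtain H where H: "H holomorphic_on ball 0 1" "\<And>\<tau>. f \<tau> = H (nome \<tau>)"
    by (rule nome_power_series[OF sums], rule that)
  have "(\<lambda>w. H (exp (2 * pi * \<i> * w))) holomorphic_on {w. Im w > 0}"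
    by (rule holomorphic_on_compose_gen[OF _ H(1), unfolded o_def])
      (auto intro!: holomorphic_intros simp: norm_exp_2pi_i)
  then have 1: "(\<lambda>w. f (Abs_uhp w)) holomorphic_on {w. Im w > 0}"
    by (rule holomorphic_transform) (simp add: H(2) Rep_Abs_uhp)
  have shift: "f \<tau>' = f \<tau>" if "Rep_uhp \<tau>' = Rep_uhp \<tau> + 1" for \<tau> \<tau>'
    using exp_2pi_int[of 1] by (simp add: H(2) that distrib_left exp_add)
  \<comment> \<open>Regarded as a form of index 0, constant in z, \<open>f\<close> falls under the
    reduction to generators.\<close>
  have "jacobi_law k 0 (\<lambda>\<tau> z. f \<tau>) 0 (-1) 1 0"
    by (simp add: jacobi_law_def S)
  then have "jacobi_law k 0 (\<lambda>\<tau> z. f \<tau>) a b c d" if "a * d - b * c = 1" for a b c d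
    by (rule jacobi_law_generators[rotated]) (use shift that in auto)
  then have 2: "f (mobius a b c d \<tau>) = (of_int c * Rep_uhp \<tau> + of_int d) powi k * f \<tau>" if "a * d - b * c = 1" for a b c d \<tau>
    using that by (simp add: jacobi_law_def)
  show ?thesis
    unfolding modular_form_def using 1 2 sums by blast
qed

lemma modular_form_zero: "modular_form k (\<lambda>\<tau>. 0)"
  by (rule modular_formI[where a = "\<lambda>_. 0"]) simp_all

lemma modular_form_one: "modular_form 0 (\<lambda>\<tau>. 1)"
  by (rule modular_formI[where a = "\<lambda>n. if n = 0 then 1 else 0"]) (use sums_If_finite[of "\<lambda>n. n = 0"] in \<open>simp_all add: if_distrib[of "\<lambda>x. x * _"] cong: if_cong\<close>)

lemma modular_form_sums:
  assumes "modular_form k f"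
  obtains a where "\<And>\<tau>. (\<lambda>n. a n * nome \<tau> ^ n) sums f \<tau>"
  using assms unfolding modular_form_def by blast

lemma modular_form_S:
  assumes "modular_form k f"
  shows "f (mobius 0 (-1) 1 0 \<tau>) = Rep_uhp \<tau> powi k * f \<tau>"
proof -
  have "\<forall>a b c d \<tau>. a * d - b * c = 1 \<longrightarrow> f (mobius a b c d \<tau>) = (of_int c * Rep_uhp \<tau> + of_int d) powi k * f \<tau>"
    using assms unfolding modular_form_def by blast
  from this[rule_format, of 0 0 "-1" 1 \<tau>] show ?thesis
    by simp
qed

lemma modular_form_add:
  assumes "modular_form k f" "modular_form k g"
  shows "modular_form k (\<lambda>\<tau>. f \<tau> + g \<tau>)"
proof -
  obtain a b where "\<And>\<tau>. (\<lambda>n. a n * nome \<tau> ^ n) sums f \<tau>"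
    "\<And>\<tau>. (\<lambda>n. b n * nome \<tau> ^ n) sums g \<tau>"
    using assms by (metis modular_form_sums)
  from sums_add[OF this] show ?thesis
    by (intro modular_formI[where a = "\<lambda>n. a n + b n"])
      (simp_all add: distrib_right distrib_left modular_form_S[OF assms(1)] modular_form_S[OF assms(2)])
qed

text \<open>The expansion of the product is the Taylor series of a product of holomorphic functions
  on the disc.\<close>

lemma modular_form_mult:
  assumes "modular_form k f" "modular_form m g"
  shows "modular_form (k + m) (\<lambda>\<tau>. f \<tau> * g \<tau>)"
proof -
  obtain a b where a: "\<And>\<tau>. (\<lambda>n. a n * nome \<tau> ^ n) sums f \<tau>"
    and b: "\<And>\<tau>. (\<lambda>n. b n * nome \<tau> ^ n) sums g \<tau>"
    using assms by (metis modular_form_sums)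
  obtain F where F: "F holomorphic_on ball 0 1" "\<And>\<tau>. f \<tau> = F (nome \<tau>)"
    by (rule nome_power_series[OF a], rule that)
  obtain G where G: "G holomorphic_on ball 0 1" "\<And>\<tau>. g \<tau> = G (nome \<tau>)"
    by (rule nome_power_series[OF b], rule that)
  have "(\<lambda>x. F x * G x) holomorphic_on ball 0 1"
    by (intro holomorphic_intros F G)
  from holomorphic_power_series[OF this] norm_nome_less_1
  have "(\<lambda>n. (deriv ^^ n) (\<lambda>x. F x * G x) 0 / fact n * nome \<tau> ^ n) sums (f \<tau> * g \<tau>)" for \<tau>
    by (simp add: F(2) G(2))
  then show ?thesis
    by (rule modular_formI)
      (simp add: modular_form_S[OF assms(1)] modular_form_S[OF assms(2)] power_int_add Rep_uhp_nonzero)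
qed

lemma modular_form_cmult:
  assumes "modular_form k f"
  shows "modular_form k (\<lambda>\<tau>. c * f \<tau>)"
proof -
  obtain a where "\<And>\<tau>. (\<lambda>n. a n * nome \<tau> ^ n) sums f \<tau>"
    using assms by (metis modular_form_sums)
  from sums_mult[OF this, of c] show ?thesis
    by (intro modular_formI[where a = "\<lambda>n. c * a n"]) (simp_all add: mult.assoc mult.left_commute modular_form_S[OF assms(1)])
qed

text \<open>The Eisenstein series of weight 4 is the theta constant of \<open>E8\<close>. As a
  definition this gives the transformation law and the constant term 1 at once.\<close>

definition E4 :: "uhp \<Rightarrow> complex" where
  "E4 \<tau> = E8_theta (Rep_uhp \<tau>) 0"

lemma E4_sums:
  "(\<lambda>n. (\<Sum>\<^sub>\<infinity>l\<in>E8. of_bool ((n, l) \<in> (\<lambda>l. (half_norm l, l)) ` E8)) * nome \<tau> ^ n) sums E4 \<tau>"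
  unfolding E4_def by (rule jacobi_expansion_at_zero[OF E8_theta_expansion])

lemma modular_form_E4: "modular_form 4 E4"
proof (rule modular_formI[OF E4_sums])
  fix \<tau>
  show "E4 (mobius 0 (-1) 1 0 \<tau>) = Rep_uhp \<tau> powi 4 * E4 \<tau>"
    using E8_theta_inversion[OF Im_Rep_uhp, of \<tau> 0] by (simp add: Rep_mobius_S E4_def)
qed

text \<open>Sakai's form \<open>A\<^sub>2\<close>, the image of the theta function of \<open>E8\<close> under a Hecke operator of
  index \<open>2\<close>; the factor \<open>8/9\<close> normalises the constant term to \<open>1\<close>.\<close>

definition A2 :: "uhp \<Rightarrow> complex^8 \<Rightarrow> complex" where
  "A2 \<tau> z = 8 / 9 * (E8_theta (2 * Rep_uhp \<tau>) (2 *s z) +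
     (E8_theta (Rep_uhp \<tau> / 2) z + E8_theta ((Rep_uhp \<tau> + 1) / 2) z) / 16)"

text \<open>The shift by \<tau> x is a lattice translation for the modulus of each summand: by 2 x
  after doubling for 2 \<tau>, where it corresponds to the lattice vector x, by 2 x for \<tau>/2,
  and by 2 x together with the period - x for (\<tau> + 1)/2.\<close>

lemma A2_translation:
  assumes x: "x \<in> E8"
  shows "A2 \<tau> (z + Rep_uhp \<tau> *s cvec x) =
    exp (- of_nat 2 * pi * \<i> * (of_real (x \<bullet> x) * Rep_uhp \<tau> + 2 * cdot (cvec x) z)) * A2 \<tau> z"
proof -
  define w where "w = Rep_uhp \<tau>"
  define e where "e = exp (- of_nat 2 * pi * \<i> * (of_real (x \<bullet> x) * w + 2 * cdot (cvec x) z))"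
  have 1: "E8_theta (2 * w) (2 *s (z + w *s cvec x)) = e * E8_theta (2 * w) (2 *s z)"
  proof -
    have "2 *s (z + w *s cvec x) = 2 *s z + (2 * w) *s cvec x + cvec 0"
      by (simp add: vec_eq_iff algebra_simps)
    then show ?thesis
      unfolding E8_theta_translation[OF x E8_zero, of "2 * w" "2 *s z", folded \<open>2 *s (z + w *s cvec x) = _\<close>]
      by (simp add: e_def cdot_simps algebra_simps)
  qed
  have xx: "2 *\<^sub>R x \<in> E8"
    using E8_scale[OF x, of 2] by simp
  have 2: "E8_theta (w / 2) (z + w *s cvec x) = e * E8_theta (w / 2) z"
  proof -
    have "z + w *s cvec x = z + (w / 2) *s cvec (2 *\<^sub>R x) + cvec 0"
      by (simp add: vec_eq_iff cvec_scaleR algebra_simps)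
    then have "E8_theta (w / 2) (z + w *s cvec x) = E8_theta (w / 2) (z + (w / 2) *s cvec (2 *\<^sub>R x) + cvec 0)"
      by simp
    then show ?thesis
      unfolding E8_theta_translation[OF xx E8_zero]
      by (simp add: e_def cdot_simps cvec_scaleR algebra_simps)
  qed
  have 3: "E8_theta ((w + 1) / 2) (z + w *s cvec x) = e * E8_theta ((w + 1) / 2) z"
  proof -
    obtain n where n: "x \<bullet> x = 2 * of_nat n"
      using E8_norm_even[OF x] .
    have "z + w *s cvec x = z + ((w + 1) / 2) *s cvec (2 *\<^sub>R x) + cvec (- x)"
      by (simp add: vec_eq_iff cvec_scaleR cvec_minus algebra_simps add_divide_distrib)
    then have "E8_theta ((w + 1) / 2) (z + w *s cvec x) = E8_theta ((w + 1) / 2) (z + ((w + 1) / 2) *s cvec (2 *\<^sub>R x) + cvec (- x))"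
      by (rule arg_cong)
    also have "\<dots> = exp (- pi * \<i> * (of_real ((2 *\<^sub>R x) \<bullet> (2 *\<^sub>R x)) * ((w + 1) / 2) + 2 * cdot (cvec (2 *\<^sub>R x)) z)) * E8_theta ((w + 1) / 2) z"
      by (rule E8_theta_translation[OF xx E8_minus[OF x]])
    also have "- pi * \<i> * (of_real ((2 *\<^sub>R x) \<bullet> (2 *\<^sub>R x)) * ((w + 1) / 2) + 2 * cdot (cvec (2 *\<^sub>R x)) z) =
        - of_nat 2 * pi * \<i> * (of_real (x \<bullet> x) * w + 2 * cdot (cvec x) z) + 2 * pi * \<i> * of_int (- 2 * int n)"
      by (simp add: cvec_scaleR cdot_simps n algebra_simps add_divide_distrib)
    also have "exp \<dots> = e"
      unfolding exp_add exp_2pi_int e_def by simp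
    finally show ?thesis .
  qed
  show ?thesis
    unfolding A2_def w_def[symmetric] 1 2 3 e_def[symmetric] by (simp add: algebra_simps)
qed

text \<open>The inversion exchanges the first two summands of \<open>A2\<close>, whose ratio 1/16 =
  2^(-4) is dictated by the weight 4, and fixes the third.\<close>

lemma A2_inversion:
  "A2 (mobius 0 (-1) 1 0 \<tau>) (inverse (Rep_uhp \<tau>) *s z) =
    Rep_uhp \<tau> ^ 4 * exp (2 * pi * \<i> * cdot z z / Rep_uhp \<tau>) * A2 \<tau> z"
proof -
  define w where "w = Rep_uhp \<tau>"
  have w: "Im w > 0"
    by (simp add: w_def Im_Rep_uhp)
  then have w0: "w \<noteq> 0" "w \<noteq> 1"
    by auto
  define e where "e = exp (2 * pi * \<i> * cdot z z / w)"
  have 1: "E8_theta (2 * (- 1 / w)) (2 *s (inverse w *s z)) = w ^ 4 / 16 * e * E8_theta (w / 2) z"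
  proof -
    have eq1: "2 * (- 1 / w) = - 1 / (w / 2)"
      using w0 by (simp only: divide_simps) simp
    have eq2: "2 *s (inverse w *s z) = inverse (w / 2) *s z"
      unfolding vector_smult_assoc inverse_divide by (simp only: divide_inverse)
    have "Im (w / 2) > 0"
      using w by simp
    then show ?thesis
      unfolding eq1 eq2 E8_theta_inversion[OF \<open>Im (w / 2) > 0\<close>] by (simp add: power_divide e_def mult_ac)
  qed
  have 2: "E8_theta (- 1 / w / 2) (inverse w *s z) = 16 * w ^ 4 * e * E8_theta (2 * w) (2 *s z)"
  proof -
    have eq1: "- 1 / w / 2 = - 1 / (2 * w)"
      using w0 by (simp only: divide_simps) simp
    have eq2: "inverse w *s z = inverse (2 * w) *s (2 *s z)"
      by (simp add: vec_eq_iff)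
    have "Im (2 * w) > 0"
      using w by simp
    then show ?thesis
      unfolding eq1 eq2 E8_theta_inversion[OF \<open>Im (2 * w) > 0\<close>] by (simp add: power_mult_distrib e_def cdot_simps mult_ac)
  qed
  have 3: "E8_theta ((- 1 / w + 1) / 2) (inverse w *s z) = w ^ 4 * e * E8_theta ((w + 1) / 2) z"
  proof -
    \<comment> \<open>(w - 1) / (2 w) arises from p by inversion, translation by -2 and inversion
      again, and p differs by 1 from (w + 1) / 2. The sign picked up by z is harmless since the
      theta function is even.\<close>
    define p where "p = (w - 1) / 2"
    define u where "u = - 1 / p - 1 - 1"
    have p: "Im p > 0" "p \<noteq> 0"
      using w w0 by (simp_all add: p_def)
    have "Im (- 1 / p) > 0"
      using p by (simp add: Im_divide sum_power2_gt_zero_iff)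
    then have u: "Im u > 0"
      by (simp add: u_def)
    then have u0: "u \<noteq> 0"
      by auto
    have up: "u = - w / p"
      using p(2) by (simp add: u_def p_def field_simps)
    have v1: "(- 1 / w + 1) / 2 = - 1 / u"
      using w0 p(2) by (simp add: up p_def field_simps)
    have v2: "inverse w *s z = inverse u *s (inverse p *s (- z))"
      using w0 p(2) by (simp add: up vec_eq_iff field_simps)
    have "E8_theta (- 1 / u) (inverse u *s (inverse p *s (- z))) =
        u ^ 4 * exp (pi * \<i> * cdot (inverse p *s (- z)) (inverse p *s (- z)) / u) * E8_theta u (inverse p *s (- z))"
      by (rule E8_theta_inversion[OF u])
    also have "E8_theta u (inverse p *s (- z)) = E8_theta (- 1 / p) (inverse p *s (- z))"
      using E8_theta_shift[of u "inverse p *s (- z)"] E8_theta_shift[of "u + 1" "inverse p *s (- z)"] by (simp add: u_def)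
    also have "\<dots> = p ^ 4 * exp (pi * \<i> * cdot (- z) (- z) / p) * E8_theta p (- z)"
      by (rule E8_theta_inversion[OF p(1)])
    also have "E8_theta p (- z) = E8_theta ((w + 1) / 2) z"
      using E8_theta_shift[of p z] by (simp add: E8_theta_minus p_def field_simps)
    also have "cdot (- z) (- z) = cdot z z"
      by (simp add: cdot_def)
    also have "cdot (inverse p *s (- z)) (inverse p *s (- z)) = cdot z z / p\<^sup>2"
      by (simp add: cdot_def sum_divide_distrib power2_eq_square field_simps)
    also have "u ^ 4 * exp (pi * \<i> * (cdot z z / p\<^sup>2) / u) * (p ^ 4 * exp (pi * \<i> * cdot z z / p) * E8_theta ((w + 1) / 2) z) =
        (u * p) ^ 4 * exp (pi * \<i> * (cdot z z / p\<^sup>2) / u + pi * \<i> * cdot z z / p) * E8_theta ((w + 1) / 2) z"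
      by (simp add: power_mult_distrib exp_add mult_ac)
    also have "u * p = - w"
      using p(2) by (simp add: up)
    also have "(- w) ^ 4 = w ^ 4"
      by simp
    also have "pi * \<i> * (cdot z z / p\<^sup>2) / u + pi * \<i> * cdot z z / p = 2 * pi * \<i> * cdot z z / w"
    proof -
      have "pi * \<i> * (cdot z z / p\<^sup>2) / u = - (pi * \<i> * cdot z z / (p * w))"
        using p(2) w0 by (simp add: up power2_eq_square)
      then have "pi * \<i> * (cdot z z / p\<^sup>2) / u + pi * \<i> * cdot z z / p = pi * \<i> * cdot z z * (w - 1) / (p * w)"
        using p(2) w0 by (simp add: field_simps)
      also have "w - 1 = 2 * p"
        by (simp add: p_def)
      finally show ?thesis
        using p(2) by simp
    qed
    finally show ?thesis
      unfolding v1 v2 e_def .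
  qed
  show ?thesis
    unfolding A2_def Rep_mobius_S w_def[symmetric] 1 2 3 e_def[symmetric] by (simp add: field_simps)
qed

text \<open>In the average over \<tau>/2 and (\<tau> + 1)/2 the vectors of odd
  \<open>half_norm\<close> cancel, which leaves integral powers of the nome. At q^0 only the zero
  vector contributes, with 1 + 2/16 = 9/8 before normalisation.\<close>

lemma A2_expansion:
  obtains f where "jacobi_expansion f A2" "\<And>l. l \<in> E8 \<Longrightarrow> f 0 l = (if l = 0 then 1 else 0)"
proof -
  define f1 where "f1 n l = (of_bool ((n, l) \<in> (\<lambda>l. (2 * half_norm l, 2 *\<^sub>R l)) ` E8) :: complex)" for n l
  define B where "B = {l \<in> E8. even (half_norm l)}"
  define f2 where "f2 n l = (of_bool ((n, l) \<in> (\<lambda>l. (half_norm l div 2, l)) ` B) :: complex)" for n l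
  have 1: "jacobi_expansion f1 (\<lambda>\<tau> z. E8_theta (2 * Rep_uhp \<tau>) (2 *s z))"
    unfolding f1_def
  proof (rule jacobi_expansion_of_injection)
    show "inj_on (\<lambda>l. (2 * half_norm l, 2 *\<^sub>R l)) E8"
      by (rule inj_onI) (simp add: vec_eq_iff)
    fix \<tau> and z :: "complex^8"
    have "E8_theta_term (2 * Rep_uhp \<tau>) (2 *s z) l =
        nome \<tau> ^ (2 * half_norm l) * exp (2 * pi * \<i> * cdot (cvec (2 *\<^sub>R l)) z)" if "l \<in> E8" for l
      unfolding E8_theta_term_nome[OF that] exp_of_nat_mult[symmetric] exp_add[symmetric]
      by (intro arg_cong[where f = exp]) (simp add: cvec_scaleR cdot_simps algebra_simps)
    then show "((\<lambda>l. nome \<tau> ^ (2 * half_norm l) * exp (2 * pi * \<i> * cdot (cvec (2 *\<^sub>R l)) z))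
        has_sum E8_theta (2 * Rep_uhp \<tau>) (2 *s z)) E8"
      using E8_theta_has_sum[of "2 * Rep_uhp \<tau>" "2 *s z"] Im_Rep_uhp[of \<tau>] has_sum_cong[of E8] by (simp cong: has_sum_cong)
  qed (use E8_scale[of _ 2] in simp)
  have 2: "jacobi_expansion f2 (\<lambda>\<tau> z. 1 / 2 * (E8_theta (Rep_uhp \<tau> / 2) z + E8_theta ((Rep_uhp \<tau> + 1) / 2) z))"
    unfolding f2_def
  proof (rule jacobi_expansion_of_injection)
    fix \<tau> and z :: "complex^8"
    let ?w = "Rep_uhp \<tau>"
    have "((\<lambda>l. 1 / 2 * (E8_theta_term (?w / 2) z l + E8_theta_term ((?w + 1) / 2) z l))
        has_sum 1 / 2 * (E8_theta (?w / 2) z + E8_theta ((?w + 1) / 2) z)) E8"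
      using Im_Rep_uhp[of \<tau>] by (intro has_sum_cmult_right has_sum_add E8_theta_has_sum) simp_all
    also have "?this \<longleftrightarrow> ((\<lambda>l. exp (2 * pi * \<i> * ?w) ^ (half_norm l div 2) * exp (2 * pi * \<i> * cdot (cvec l) z))
        has_sum 1 / 2 * (E8_theta (?w / 2) z + E8_theta ((?w + 1) / 2) z)) B"
    proof (rule has_sum_cong_neutral)
      have *: "E8_theta_term ((?w + 1) / 2) z l = E8_theta_term (?w / 2) z l * (if odd (half_norm l) then -1 else 1)" if "l \<in> E8" for l
      proof -
        have "E8_theta_term ((?w + 1) / 2) z l = E8_theta_term (?w / 2) z l * exp (pi * \<i> * of_int (int (half_norm l)))"
          unfolding E8_theta_term_def half_norm[OF that] exp_add[symmetric]
          by (intro arg_cong[where f = exp]) (simp add: algebra_simps add_divide_distrib)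
        then show ?thesis
          unfolding exp_pi_i_int by simp
      qed
      show "1 / 2 * (E8_theta_term (?w / 2) z l + E8_theta_term ((?w + 1) / 2) z l) = 0" if "l \<in> E8 - B" for l
        using that by (simp add: * B_def)
      show "1 / 2 * (E8_theta_term (?w / 2) z l + E8_theta_term ((?w + 1) / 2) z l) =
          exp (2 * pi * \<i> * ?w) ^ (half_norm l div 2) * exp (2 * pi * \<i> * cdot (cvec l) z)" if "l \<in> E8 \<inter> B" for l
      proof -
        obtain m where m: "half_norm l = 2 * m"
          using \<open>l \<in> E8 \<inter> B\<close> by (auto simp: B_def elim: evenE)
        have l: "l \<in> E8"
          using \<open>l \<in> E8 \<inter> B\<close> by simp
        have "E8_theta_term (?w / 2) z l = exp (2 * pi * \<i> * ?w) ^ (half_norm l div 2) * exp (2 * pi * \<i> * cdot (cvec l) z)"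
          unfolding E8_theta_term_nome[OF l] exp_of_nat_mult[symmetric] exp_add[symmetric] m
          by (intro arg_cong[where f = exp]) simp
        then show ?thesis
          by (simp add: *[OF l] m)
      qed
    qed (auto simp: B_def)
    finally show "((\<lambda>l. exp (2 * pi * \<i> * ?w) ^ (half_norm l div 2) * exp (2 * pi * \<i> * cdot (cvec l) z))
        has_sum 1 / 2 * (E8_theta (?w / 2) z + E8_theta ((?w + 1) / 2) z)) B" .
  qed (auto simp: inj_on_def B_def)
  \<comment> \<open>The weight 1/8 is 2/16, since \<open>f2\<close> belongs to the average of the
    two series.\<close>
  define f where "f n l = 8 / 9 * (f1 n l + 1 / 8 * f2 n l)" for n l
  have "jacobi_expansion f A2"
    using jacobi_expansion_cmult[OF jacobi_expansion_add[OF 1 jacobi_expansion_cmult[OF 2, of "1 / 8"]], of "8 / 9"]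
    unfolding f_def A2_def[abs_def] by simp
  moreover have "f 0 l = (if l = 0 then 1 else 0)" if "l \<in> E8" for l
  proof -
    have "(0, l) \<in> (\<lambda>l. (2 * half_norm l, 2 *\<^sub>R l)) ` E8 \<longleftrightarrow> l = 0"
      using half_norm_eq_0 E8_zero by (force simp: image_iff)
    moreover have "(0, l) \<in> (\<lambda>l. (half_norm l div 2, l)) ` B \<longleftrightarrow> l = 0"
    proof -
      have "half_norm l div 2 = 0 \<and> even (half_norm l) \<longleftrightarrow> half_norm l = 0"
        by (auto elim!: evenE)
      then show ?thesis
        using half_norm_eq_0[OF that] that by (auto simp: B_def image_iff)
    qed
    ultimately show ?thesis
      by (simp add: f_def f1_def f2_def)
  qed
  ultimately show ?thesis
    using that by blast
qed

lemma reflection_scale: "2 *s reflection r z = reflection r (2 *s z)"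
  by (simp add: reflection_def vec_eq_iff cdot_simps algebra_simps)

lemma A2_reflection:
  assumes "r \<in> E8" "r \<bullet> r = 2"
  shows "A2 \<tau> (reflection r z) = A2 \<tau> z"
  unfolding A2_def reflection_scale by (simp add: E8_theta_reflection[OF assms])

lemma weak_jacobi_form_A2: "weak_jacobi_form 4 2 A2"
proof -
  obtain f where f: "jacobi_expansion f A2"
    using A2_expansion by metis
  show ?thesis
  proof (rule weak_jacobi_formI[OF jacobi_expansion_holomorphic[OF f] f A2_reflection A2_translation])
    show "jacobi_law 4 2 A2 0 (- 1) 1 0"
      using A2_inversion by (simp add: jacobi_law_def mult.assoc)
  qed
qed

section \<open>The discriminant\<close>

text \<open>Symmetrising the double sum cancels pairs of opposite parity; the others are (a + b, a -
  b). The factors on the left involve half-integral powers of the nome, while the right side is a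
  series in the nome itself.\<close>

lemma theta_product:
  assumes w: "Im w > 0"
  shows "theta w 0 * theta w (1 / 2) = (theta (2 * w) (1 / 2))\<^sup>2"
proof -
  define s where "s n = (if odd n then -1 else 1 :: complex)" for n :: int
  define E where "E p = exp (pi * \<i> * ((of_int (fst p))\<^sup>2 + (of_int (snd p))\<^sup>2) * w)" for p :: "int \<times> int"
  have half: "theta_term v (1 / 2) n = s n * theta_term v 0 n" for v n
  proof -
    have "theta_term v (1 / 2) n = exp (pi * \<i> * of_int n) * theta_term v 0 n"
      unfolding theta_term_def exp_add[symmetric] by (intro arg_cong[where f = exp]) simp
    then show ?thesis
      by (simp only: exp_pi_i_int s_def)
  qed
  have E: "theta_term w 0 m * theta_term w 0 n = E (m, n)" for m n
    unfolding theta_term_def E_def exp_add[symmetric] by (intro arg_cong[where f = exp]) (simp add: algebra_simps)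
  have "((\<lambda>(m, n). theta_term w 0 m * theta_term w (1 / 2) n) has_sum theta w 0 * theta w (1 / 2)) (UNIV \<times> UNIV)"
    by (intro has_sum_product_complex theta_has_sum w)
  moreover have "(\<lambda>(m, n). theta_term w 0 m * theta_term w (1 / 2) n) = (\<lambda>p. s (snd p) * E p)"
    by (auto simp: fun_eq_iff half E[symmetric])
  ultimately have 1: "((\<lambda>p. s (snd p) * E p) has_sum theta w 0 * theta w (1 / 2)) UNIV"
    by simp
  also have "?this \<longleftrightarrow> ((\<lambda>p. s (fst p) * E p) has_sum theta w 0 * theta w (1 / 2)) UNIV"
    by (rule has_sum_reindex_bij_witness[where i = prod.swap and j = prod.swap]) (auto simp: E_def add.commute)
  finally have 2: "((\<lambda>p. s (fst p) * E p) has_sum theta w 0 * theta w (1 / 2)) UNIV" .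
  have "((\<lambda>p. (s (snd p) * E p + s (fst p) * E p) * (1 / 2)) has_sum (theta w 0 * theta w (1 / 2) + theta w 0 * theta w (1 / 2)) * (1 / 2)) UNIV"
    by (intro has_sum_cmult_left has_sum_add 1 2)
  also have "?this \<longleftrightarrow> ((\<lambda>p. s (snd p) * E p) has_sum theta w 0 * theta w (1 / 2)) {p. even (fst p + snd p)}"
    by (rule has_sum_cong_neutral[THEN trans]) (auto simp: s_def)
  also have "\<dots> \<longleftrightarrow> ((\<lambda>p. s (fst p) * s (snd p) * E (fst p + snd p, fst p - snd p)) has_sum theta w 0 * theta w (1 / 2)) UNIV"
  proof (rule has_sum_reindex_bij_witness[where i = "\<lambda>p. (fst p + snd p, fst p - snd p)" and j = "\<lambda>p. ((fst p + snd p) div 2, (fst p - snd p) div 2)"])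
    fix p :: "int \<times> int"
    assume "p \<in> {p. even (fst p + snd p)}"
    then have "even (fst p + snd p)"
      by simp
    then obtain a where a: "fst p + snd p = 2 * a"
      by (rule evenE)
    define b where "b = fst p - a"
    have p: "p = (a + b, a - b)"
      using a by (simp add: b_def prod_eq_iff)
    show "(fst ((fst p + snd p) div 2, (fst p - snd p) div 2) + snd ((fst p + snd p) div 2, (fst p - snd p) div 2),
        fst ((fst p + snd p) div 2, (fst p - snd p) div 2) - snd ((fst p + snd p) div 2, (fst p - snd p) div 2)) = p"
      by (simp add: p)
    have "s (a - b) = s a * s b"
      by (simp add: s_def)
    then show "s (fst ((fst p + snd p) div 2, (fst p - snd p) div 2)) * s (snd ((fst p + snd p) div 2, (fst p - snd p) div 2)) *
        E (fst ((fst p + snd p) div 2, (fst p - snd p) div 2) + snd ((fst p + snd p) div 2, (fst p - snd p) div 2),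
        fst ((fst p + snd p) div 2, (fst p - snd p) div 2) - snd ((fst p + snd p) div 2, (fst p - snd p) div 2)) = s (snd p) * E p"
      by (simp add: p)
  qed auto
  finally have "((\<lambda>p. s (fst p) * s (snd p) * E (fst p + snd p, fst p - snd p)) has_sum theta w 0 * theta w (1 / 2)) UNIV" .
  moreover have "((\<lambda>(a, b). theta_term (2 * w) (1 / 2) a * theta_term (2 * w) (1 / 2) b) has_sum theta (2 * w) (1 / 2) * theta (2 * w) (1 / 2)) (UNIV \<times> UNIV)"
    using w by (intro has_sum_product_complex theta_has_sum) simp_all
  moreover have "theta_term (2 * w) (1 / 2) a * theta_term (2 * w) (1 / 2) b = s a * s b * E (a + b, a - b)" for a b
  proof -
    have "theta_term (2 * w) 0 a * theta_term (2 * w) 0 b = E (a + b, a - b)"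
      unfolding theta_term_def E_def exp_add[symmetric]
      by (intro arg_cong[where f = exp]) (simp add: algebra_simps power2_eq_square)
    then show ?thesis
      by (simp add: half mult_ac)
  qed
  ultimately show ?thesis
    using has_sum_unique by (simp add: case_prod_unfold power2_eq_square) blast
qed

lemma sums_by_fibres:
  fixes N :: "int \<Rightarrow> nat" and c :: "nat \<Rightarrow> complex"
  assumes "\<And>k. finite {n. N n = k}" and sum: "((\<lambda>n. c (N n) * x ^ N n) has_sum s) UNIV"
  shows "(\<lambda>k. of_nat (card {n. N n = k}) * c k * x ^ k) sums s"
proof (rule has_sum_imp_sums, rule has_sum_SigmaD)
  have "((\<lambda>n. c (N n) * x ^ N n) has_sum s) UNIV \<longleftrightarrow> ((\<lambda>(k, n). c k * x ^ k) has_sum s) (Sigma UNIV (\<lambda>k. {n. N n = k}))"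
    by (rule has_sum_reindex_bij_witness[where i = snd and j = "\<lambda>n. (N n, n)"]) auto
  with sum show "((\<lambda>(k, n). c k * x ^ k) has_sum s) (Sigma UNIV (\<lambda>k. {n. N n = k}))"
    by simp
  show "((\<lambda>n. case (k, n) of (k, n) \<Rightarrow> c k * x ^ k) has_sum of_nat (card {n. N n = k}) * c k * x ^ k) {n. N n = k}" for k
    using assms(1)[of k] by (intro has_sum_finiteI) (auto simp: mult.assoc)
qed

text \<open>The exponents below are quadratic in n, and \<open>r\<close> is the symmetry that
  preserves them. It bounds the coefficients of the collected series by 2.\<close>

lemma card_fibre_le_2:
  fixes N :: "int \<Rightarrow> nat"
  assumes "\<And>m n. N m = N n \<Longrightarrow> m = n \<or> m = r n"
  shows "finite {n. N n = k}" "card {n. N n = k} \<le> 2"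
proof -
  have "\<exists>a b. {n. N n = k} \<subseteq> {a, b}"
  proof (cases "\<exists>a. N a = k")
    case True
    then obtain a where "N a = k"
      by blast
    then have "{n. N n = k} \<subseteq> {a, r a}"
      using assms by auto
    then show ?thesis
      by blast
  qed auto
  then obtain a b where ab: "{n. N n = k} \<subseteq> {a, b}"
    by blast
  then show "finite {n. N n = k}"
    by (rule finite_subset) simp
  have "card {n. N n = k} \<le> card {a, b}"
    by (rule card_mono[OF _ ab]) simp
  also have "\<dots> \<le> 2"
    by (simp add: card_insert_if)
  finally show "card {n. N n = k} \<le> 2" .
qed

text \<open>The terms after the first have total size at most 2 |x| / (1 - |x|), which is below 1
  for |x| < 1/3.\<close>

lemma sums_nonzero:
  fixes a :: "nat \<Rightarrow> complex"
  assumes "(\<lambda>k. a k * x ^ k) sums s" "norm (a 0) \<ge> 1" "\<And>k. norm (a k) \<le> 2" "norm x < 1 / 3"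
  shows "s \<noteq> 0"
proof
  assume "s = 0"
  then have "(\<lambda>k. a (Suc k) * x ^ Suc k) sums (- a 0)"
    using assms(1) sums_Suc_iff[of "\<lambda>k. a k * x ^ k" "- a 0"] by simp
  moreover have "(\<lambda>k. 2 * norm x * norm x ^ k) sums (2 * norm x * (1 / (1 - norm x)))"
    using assms(4) by (intro sums_mult geometric_sums) simp
  moreover have "norm (a (Suc k) * x ^ Suc k) \<le> 2 * norm x * norm x ^ k" for k
    using mult_right_mono[OF assms(3)[of "Suc k"], of "norm x * norm x ^ k"] by (simp add: norm_mult norm_power mult.assoc)
  ultimately have "norm (- a 0) \<le> 2 * norm x * (1 / (1 - norm x))"
    by (rule norm_sums_le)
  also have "\<dots> < 1"
    using assms(4) by (simp add: field_simps)
  finally show False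
    using assms(2) by simp
qed

lemma theta_nome_series:
  obtains p where "\<And>\<tau>. (\<lambda>k. p k * nome \<tau> ^ k) sums theta (2 * Rep_uhp \<tau>) (1 / 2)"
    "norm (p 0) \<ge> 1" "\<And>k. norm (p k :: complex) \<le> 2"
proof -
  define N where "N n = nat (n\<^sup>2)" for n :: int
  have inj: "m = n \<or> m = - n" if "N m = N n" for m n
  proof -
    have "m\<^sup>2 = n\<^sup>2"
      using that by (simp add: N_def eq_nat_nat_iff)
    then show ?thesis
      by (simp add: power2_eq_iff)
  qed
  have "{n. N n = 0} = {0}"
    by (auto simp: N_def)
  moreover have "(\<lambda>k. of_nat (card {n. N n = k}) * (if odd k then -1 else 1) * nome \<tau> ^ k) sums theta (2 * Rep_uhp \<tau>) (1 / 2)" for \<tau>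
  proof (rule sums_by_fibres[OF card_fibre_le_2(1)[OF inj]])
    have "theta_term (2 * Rep_uhp \<tau>) (1 / 2) n = (if odd (N n) then -1 else 1) * nome \<tau> ^ N n" for n
    proof -
      have "odd (N n) \<longleftrightarrow> odd n"
        by (simp add: N_def even_nat_iff)
      moreover have N: "(of_nat (N n) :: complex) = (of_int n)\<^sup>2"
        by (simp add: N_def)
      have "theta_term (2 * Rep_uhp \<tau>) (1 / 2) n = exp (pi * \<i> * of_int n) * nome \<tau> ^ N n"
        unfolding theta_term_def exp_of_nat_mult[symmetric] exp_add[symmetric] N
        by (intro arg_cong[where f = exp]) (simp add: mult_ac)
      ultimately show ?thesis
        by (simp only: exp_pi_i_int)
    qed
    then have eq: "(\<lambda>n. (if odd (N n) then -1 else 1) * nome \<tau> ^ N n) = theta_term (2 * Rep_uhp \<tau>) (1 / 2)"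
      by (simp add: fun_eq_iff)
    show "((\<lambda>n. (if odd (N n) then -1 else 1) * nome \<tau> ^ N n) has_sum theta (2 * Rep_uhp \<tau>) (1 / 2)) UNIV"
      unfolding eq using Im_Rep_uhp[of \<tau>] by (intro theta_has_sum) simp
  qed
  ultimately show ?thesis
    using card_fibre_le_2(2)[OF inj]
    by (intro that[of "\<lambda>k. of_nat (card {n. N n = k}) * (if odd k then -1 else 1)"]) (auto simp: norm_mult)
qed

text \<open>The exponents are triangular numbers, invariant under n -> -1 - n. Exponent 0 occurs for
  n = 0 and n = -1; this is the origin of the factor 2^8 in \<open>discr\<close>.\<close>

lemma theta_half_period_nome_series:
  obtains t where "\<And>\<tau>. (\<lambda>k. t k * nome \<tau> ^ k) sums theta (Rep_uhp \<tau>) (Rep_uhp \<tau> / 2)"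
    "norm (t 0) \<ge> 1" "\<And>k. norm (t k :: complex) \<le> 2"
proof -
  define N where "N n = nat (n * (n + 1) div 2)" for n :: int
  have nonneg: "n * (n + 1) \<ge> 0" for n :: int
    by (cases "n \<ge> 0") (auto simp: mult_nonpos_nonpos)
  have N: "2 * int (N n) = n * (n + 1)" for n
  proof -
    have "2 * (n * (n + 1) div 2) = n * (n + 1)"
      by (rule dvd_mult_div_cancel) simp
    then show ?thesis
      using nonneg[of n] by (simp add: N_def)
  qed
  have inj: "m = n \<or> m = - 1 - n" if "N m = N n" for m n
  proof -
    have "m * (m + 1) = n * (n + 1)"
      using N[of m] N[of n] that by simp
    then have "(m - n) * (m + n + 1) = 0"
      by (simp add: algebra_simps)
    then show ?thesis
      by auto
  qed
  have "0 \<in> {n. N n = 0}"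
    by (simp add: N_def)
  then have "card {n. N n = 0} \<ge> 1"
    using card_fibre_le_2(1)[OF inj] by (metis card_0_eq empty_iff less_one not_le)
  moreover have "(\<lambda>k. of_nat (card {n. N n = k}) * 1 * nome \<tau> ^ k) sums theta (Rep_uhp \<tau>) (Rep_uhp \<tau> / 2)" for \<tau>
  proof (rule sums_by_fibres[OF card_fibre_le_2(1)[OF inj]])
    have "theta_term (Rep_uhp \<tau>) (Rep_uhp \<tau> / 2) n = 1 * nome \<tau> ^ N n" for n
    proof -
      have "(of_nat (N n) :: complex) = of_int (2 * int (N n)) / 2"
        by simp
      also have "\<dots> = of_int n * (of_int n + 1) / 2"
        unfolding N by simp
      finally show ?thesis
        unfolding theta_term_def exp_of_nat_mult[symmetric] mult_1
        by (intro arg_cong[where f = exp]) (simp add: field_simps power2_eq_square)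
    qed
    then have eq: "(\<lambda>n. 1 * nome \<tau> ^ N n) = theta_term (Rep_uhp \<tau>) (Rep_uhp \<tau> / 2)"
      by (simp add: fun_eq_iff)
    show "((\<lambda>n. 1 * nome \<tau> ^ N n) has_sum theta (Rep_uhp \<tau>) (Rep_uhp \<tau> / 2)) UNIV"
      unfolding eq by (rule theta_has_sum[OF Im_Rep_uhp])
  qed
  ultimately show ?thesis
    using card_fibre_le_2(2)[OF inj]
    by (intro that[of "\<lambda>k. of_nat (card {n. N n = k})"]) auto
qed

text \<open>This is \<open>2\<^sup>8 \<Delta>\<close>, as a product of theta constants.\<close>

definition discr :: "uhp \<Rightarrow> complex" where
  "discr \<tau> = (\<Prod>p\<in>{(False, False), (False, True), (True, False)}. theta_char (fst p) (snd p) (Rep_uhp \<tau>) 0) ^ 8"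

text \<open>One factor nome splits off, and the two series that remain do not vanish at the
  cusp.\<close>

lemma discr_eq:
  "discr \<tau> = nome \<tau> * theta (2 * Rep_uhp \<tau>) (1 / 2) ^ 16 * theta (Rep_uhp \<tau>) (Rep_uhp \<tau> / 2) ^ 8"
proof -
  let ?w = "Rep_uhp \<tau>"
  have "discr \<tau> = (theta ?w 0 * theta ?w (1 / 2)) ^ 8 * exp (pi * \<i> * ?w / 4) ^ 8 * theta ?w (?w / 2) ^ 8"
    by (simp add: discr_def theta_char_def power_mult_distrib mult_ac)
  also have "(theta ?w 0 * theta ?w (1 / 2)) ^ 8 = theta (2 * ?w) (1 / 2) ^ 16"
    unfolding theta_product[OF Im_Rep_uhp] by (simp flip: power_mult)
  also have "exp (pi * \<i> * ?w / 4) ^ 8 = exp (2 * pi * \<i> * ?w)"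
    unfolding exp_of_nat_mult[symmetric] by (intro arg_cong[where f = exp]) simp
  finally show ?thesis
    by (simp add: mult_ac)
qed

text \<open>One characteristic is fixed and the other two are exchanged. No root of unity arises, as
  the pair (True, True) is absent, and 24 square roots multiply to the twelfth power.\<close>

lemma discr_S: "discr (mobius 0 (-1) 1 0 \<tau>) = Rep_uhp \<tau> powi 12 * discr \<tau>"
proof -
  let ?w = "Rep_uhp \<tau>"
  define c where "c = csqrt (- \<i> * ?w)"
  have inv: "theta_char a b (- 1 / ?w) 0 = c * exp (- pi * \<i> / 2) ^ of_bool (a \<and> b) * theta_char b a ?w 0" for a b
    using theta_char_inversion[OF Im_Rep_uhp, of a b \<tau> 0] by (simp add: c_def)
  have "c ^ 24 = (c\<^sup>2) ^ 12"
    by (simp only: power_mult[symmetric]) simp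
  also have "\<dots> = ?w ^ 12"
    unfolding c_def power2_csqrt by (simp add: power_mult_distrib)
  finally have c: "c ^ 24 = ?w ^ 12" .
  have "discr (mobius 0 (-1) 1 0 \<tau>) = (c * theta_char False False ?w 0 * (c * theta_char True False ?w 0 * (c * theta_char False True ?w 0))) ^ 8"
    unfolding discr_def Rep_mobius_S by (simp add: inv[simplified])
  also have "\<dots> = c ^ 24 * (theta_char False False ?w 0 * (theta_char False True ?w 0 * theta_char True False ?w 0)) ^ 8"
    by (simp add: power_mult_distrib power_add[symmetric] mult_ac)
  also have "(theta_char False False ?w 0 * (theta_char False True ?w 0 * theta_char True False ?w 0)) ^ 8 = discr \<tau>"
    by (simp add: discr_def)
  finally show ?thesis
    by (simp add: c)
qed

lemma nome_small:
  assumes "Im (Rep_uhp \<tau>) \<ge> 1 / 5"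
  shows "cmod (nome \<tau>) < 1 / 3"
proof -
  \<comment> \<open>The exponent 6/5, a lower bound for 2 pi / 5, is split into five parts so that
    the quadratic Taylor bound is sharp enough.\<close>
  have "3 < (1 + 6 / 25 + (6 / 25)\<^sup>2 / 2 :: real) ^ 5"
    by (simp add: power2_eq_square eval_nat_numeral)
  also have "\<dots> \<le> exp (6 / 25) ^ 5"
    by (intro power_mono exp_lower_Taylor_quadratic) auto
  also have "\<dots> = exp (6 / 5)"
    by (simp flip: exp_of_nat_mult)
  also have "\<dots> \<le> exp (2 * pi * Im (Rep_uhp \<tau>))"
  proof -
    have "3 * (1 / 5) \<le> pi * Im (Rep_uhp \<tau>)"
      using assms pi_gt3 by (intro mult_mono) auto
    then show ?thesis
      by simp
  qed
  finally have "exp (- (2 * pi * Im (Rep_uhp \<tau>))) < 1 / 3"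
    by (simp add: exp_minus field_simps)
  then show ?thesis
    unfolding norm_exp_2pi_i by simp
qed

text \<open>Zeros are excluded by the leading terms where Im \<tau> \<ge> 1/5 and elsewhere by the
  transformation law. The quotient \<open>Q\<close> of \<open>discr\<close> by the nome is then free
  of zeros on the whole disc, centre included, so its reciprocal is a power series.\<close>

lemma discr_inverse_series:
  shows modular_form_discr: "modular_form 12 discr"
    and discr_nonzero: "\<And>\<tau>. discr \<tau> \<noteq> 0"
    and nome_over_discr_sums: "\<exists>u. \<forall>\<tau>. (\<lambda>n. u n * nome \<tau> ^ n) sums (nome \<tau> / discr \<tau>)"
proof -
  obtain p where p: "\<And>\<tau>. (\<lambda>k. p k * nome \<tau> ^ k) sums theta (2 * Rep_uhp \<tau>) (1 / 2)"
    "norm (p 0) \<ge> 1" "\<And>k. norm (p k) \<le> 2"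
    using theta_nome_series by metis
  obtain t where t: "\<And>\<tau>. (\<lambda>k. t k * nome \<tau> ^ k) sums theta (Rep_uhp \<tau>) (Rep_uhp \<tau> / 2)"
    "norm (t 0) \<ge> 1" "\<And>k. norm (t k) \<le> 2"
    using theta_half_period_nome_series by metis
  obtain P where P: "P holomorphic_on ball 0 1" "\<And>\<tau>. theta (2 * Rep_uhp \<tau>) (1 / 2) = P (nome \<tau>)" "P 0 = p 0"
    by (rule nome_power_series[OF p(1)], rule that)
  obtain T where T: "T holomorphic_on ball 0 1" "\<And>\<tau>. theta (Rep_uhp \<tau>) (Rep_uhp \<tau> / 2) = T (nome \<tau>)" "T 0 = t 0"
    by (rule nome_power_series[OF t(1)], rule that)
  define Q where "Q x = P x ^ 16 * T x ^ 8" for x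
  have Q: "Q holomorphic_on ball 0 1"
    unfolding Q_def by (intro holomorphic_intros P T)
  have discr_Q: "discr \<tau> = nome \<tau> * Q (nome \<tau>)" for \<tau>
    unfolding discr_eq Q_def P(2) T(2) by simp
  have "(\<lambda>x. x * Q x) holomorphic_on ball 0 1"
    by (intro holomorphic_intros Q)
  from holomorphic_power_series[OF this] norm_nome_less_1
  have "(\<lambda>n. (deriv ^^ n) (\<lambda>x. x * Q x) 0 / fact n * nome \<tau> ^ n) sums discr \<tau>" for \<tau>
    by (simp add: discr_Q)
  then show mf: "modular_form 12 discr"
    by (rule modular_formI) (rule discr_S)
  show nonzero: "discr \<tau> \<noteq> 0" for \<tau>
  proof -
    obtain a b c d where det: "a * d - b * c = 1" and Im: "Im (Rep_uhp (mobius a b c d \<tau>)) \<ge> 1 / 5"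
      by (rule exists_mobius_Im_ge)
    have "discr (mobius a b c d \<tau>) \<noteq> 0"
      unfolding discr_eq
      using sums_nonzero[OF p nome_small[OF Im]] sums_nonzero[OF t nome_small[OF Im]] by simp
    moreover have "discr (mobius a b c d \<tau>) = (of_int c * Rep_uhp \<tau> + of_int d) powi 12 * discr \<tau>"
      using mf det unfolding modular_form_def by blast
    ultimately show ?thesis
      by auto
  qed
  have "Q x \<noteq> 0" if "x \<in> ball 0 1" for x
  proof (cases "x = 0")
    case True
    then show ?thesis
      using p(2) t(2) by (auto simp: Q_def P(3) T(3))
  next
    case False
    then obtain \<tau> where "nome \<tau> = x"
      using exp_surj_punctured_disc[of x] \<open>x \<in> ball 0 1\<close> by auto
    then show ?thesis
      using discr_Q[of \<tau>] nonzero[of \<tau>] by auto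
  qed
  then have "(\<lambda>x. 1 / Q x) holomorphic_on ball 0 1"
    by (intro holomorphic_intros Q) auto
  from holomorphic_power_series[OF this] norm_nome_less_1
  have "(\<lambda>n. (deriv ^^ n) (\<lambda>x. 1 / Q x) 0 / fact n * nome \<tau> ^ n) sums (nome \<tau> / discr \<tau>)" for \<tau>
    by (simp add: discr_Q)
  then show "\<exists>u. \<forall>\<tau>. (\<lambda>n. u n * nome \<tau> ^ n) sums (nome \<tau> / discr \<tau>)"
    by (intro exI[of _ "\<lambda>n. (deriv ^^ n) (\<lambda>x. 1 / Q x) 0 / fact n"] allI)
qed

section \<open>The weak Jacobi form of weight -4 and index 2\<close>

definition phi_4_2 :: "uhp \<Rightarrow> complex^8 \<Rightarrow> complex" where
  "phi_4_2 \<tau> z = ((E8_theta (Rep_uhp \<tau>) z)\<^sup>2 - E4 \<tau> * A2 \<tau> z) / discr \<tau>"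

text \<open>The q^0 terms of the two products agree, so the numerator is divisible by the nome.
  Multiplying the quotient by the series of nome / discr then takes the place of a division by
  \<open>discr\<close>.\<close>

lemma phi_4_2_expansion: "\<exists>f. jacobi_expansion f phi_4_2"
proof -
  define a where "a n l = (of_bool ((n, l) \<in> (\<lambda>l. (half_norm l, l)) ` E8) :: complex)" for n l
  define e where "e n l = (if l = 0 then (\<Sum>\<^sub>\<infinity>l\<in>E8. a n l) else 0)" for n and l :: "real^8"
  obtain b where b: "jacobi_expansion b A2" "\<And>l. l \<in> E8 \<Longrightarrow> b 0 l = (if l = 0 then 1 else 0)"
    using A2_expansion by metis
  obtain u where u: "\<And>\<tau>. (\<lambda>n. u n * nome \<tau> ^ n) sums (nome \<tau> / discr \<tau>)"
    using nome_over_discr_sums by metis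
  have a: "jacobi_expansion a (\<lambda>\<tau>. E8_theta (Rep_uhp \<tau>))" "\<And>l. l \<in> E8 \<Longrightarrow> a 0 l = (if l = 0 then 1 else 0)"
    using E8_theta_expansion by (auto simp: a_def[abs_def] image_iff half_norm_eq_0 E8_zero)
  have e: "jacobi_expansion e (\<lambda>\<tau> z. E4 \<tau>)"
    unfolding e_def a_def by (rule jacobi_expansion_const[OF E4_sums])
  have e0: "e 0 l = (if l = 0 then 1 else 0)" for l
  proof -
    have "(\<Sum>\<^sub>\<infinity>l\<in>E8. a 0 l) = (\<Sum>\<^sub>\<infinity>l\<in>{0 :: real^8}. 1)"
      by (rule infsum_cong_neutral) (auto simp: a(2) E8_zero)
    then show ?thesis
      by (simp add: e_def)
  qed
  define g where "g n l = fourier_convolution a a n l - fourier_convolution e b n l" for n l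
  have "jacobi_expansion g (\<lambda>\<tau> z. E8_theta (Rep_uhp \<tau>) z * E8_theta (Rep_uhp \<tau>) z - E4 \<tau> * A2 \<tau> z)"
    unfolding g_def by (intro jacobi_expansion_diff jacobi_expansion_mult a e b)
  moreover have "g 0 l = 0" if "l \<in> E8" for l
    unfolding g_def using fourier_convolution_delta[where f = a and a = 1 and g = a and b = 1, OF a(2) a(2) that]
      fourier_convolution_delta[where f = e and a = 1 and g = b and b = 1, OF e0 b(2) that] by simp
  ultimately have "jacobi_expansion (\<lambda>n. g (Suc n)) (\<lambda>\<tau> z. (E8_theta (Rep_uhp \<tau>) z * E8_theta (Rep_uhp \<tau>) z - E4 \<tau> * A2 \<tau> z) / nome \<tau>)"
    by (rule jacobi_expansion_divide_nome)
  from jacobi_expansion_mult[OF this jacobi_expansion_const[OF u]]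
  show ?thesis
    by (auto simp: phi_4_2_def[abs_def] power2_eq_square)
qed

lemma weak_jacobi_form_phi_4_2: "weak_jacobi_form (-4) 2 phi_4_2"
proof -
  obtain f where f: "jacobi_expansion f phi_4_2"
    using phi_4_2_expansion by blast
  show ?thesis
  proof (rule weak_jacobi_formI[OF jacobi_expansion_holomorphic[OF f] f])
    fix r \<tau> and z :: "complex^8"
    assume "r \<in> E8" "r \<bullet> r = 2"
    then show "phi_4_2 \<tau> (reflection r z) = phi_4_2 \<tau> z"
      by (simp add: phi_4_2_def A2_reflection E8_theta_reflection)
  next
    fix x \<tau> and z :: "complex^8"
    assume x: "x \<in> E8"
    let ?w = "Rep_uhp \<tau>"
    define e where "e = exp (- pi * \<i> * (of_real (x \<bullet> x) * ?w + 2 * cdot (cvec x) z))"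
    have e2: "exp (- of_nat 2 * pi * \<i> * (of_real (x \<bullet> x) * ?w + 2 * cdot (cvec x) z)) = e\<^sup>2"
      unfolding e_def exp_double[symmetric] by (intro arg_cong[where f = exp]) simp
    have "E8_theta ?w (z + ?w *s cvec x) = e * E8_theta ?w z"
      using E8_theta_translation[OF x E8_zero, of ?w z] by (simp add: e_def)
    moreover have "A2 \<tau> (z + ?w *s cvec x) = e\<^sup>2 * A2 \<tau> z"
      using A2_translation[OF x, of \<tau> z] unfolding e2 .
    ultimately show "phi_4_2 \<tau> (z + ?w *s cvec x) =
        exp (- of_nat 2 * pi * \<i> * (of_real (x \<bullet> x) * ?w + 2 * cdot (cvec x) z)) * phi_4_2 \<tau> z"
      unfolding e2 by (simp add: phi_4_2_def power_mult_distrib algebra_simps)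
  next
    show "jacobi_law (- 4) 2 phi_4_2 0 (- 1) 1 0"
      unfolding jacobi_law_def
    proof (intro allI)
      fix \<tau> and z :: "complex^8"
      let ?w = "Rep_uhp \<tau>"
      let ?S = "mobius 0 (-1) 1 0 \<tau>"
      define e where "e = exp (pi * \<i> * cdot z z / ?w)"
      have e2: "exp (2 * pi * \<i> * cdot z z / ?w) = e\<^sup>2"
        unfolding e_def exp_double[symmetric] by (intro arg_cong[where f = exp]) simp
      have "E8_theta (Rep_uhp ?S) (inverse ?w *s z) = ?w ^ 4 * e * E8_theta ?w z"
        unfolding Rep_mobius_S e_def by (rule E8_theta_inversion[OF Im_Rep_uhp])
      moreover have "A2 ?S (inverse ?w *s z) = ?w ^ 4 * e\<^sup>2 * A2 \<tau> z"
        using A2_inversion[of \<tau> z] unfolding e2 .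
      moreover have "E4 ?S = ?w ^ 4 * E4 \<tau>" "discr ?S = ?w ^ 12 * discr \<tau>"
        using modular_form_S[OF modular_form_E4, of \<tau>] discr_S[of \<tau>] by simp_all
      ultimately have "phi_4_2 ?S (inverse ?w *s z) =
          ((?w ^ 4 * e * E8_theta ?w z)\<^sup>2 - ?w ^ 4 * E4 \<tau> * (?w ^ 4 * e\<^sup>2 * A2 \<tau> z)) / (?w ^ 12 * discr \<tau>)"
        by (simp add: phi_4_2_def)
      also have "\<dots> = (?w ^ 8 * e\<^sup>2 * ((E8_theta ?w z)\<^sup>2 - E4 \<tau> * A2 \<tau> z)) / (?w ^ 12 * discr \<tau>)"
        by (simp add: power_mult_distrib power_add[symmetric] power_mult[symmetric] algebra_simps)
      also have "\<dots> = (?w ^ 8 / ?w ^ 12) * e\<^sup>2 * phi_4_2 \<tau> z"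
        by (simp add: phi_4_2_def)
      also have "?w ^ 8 / ?w ^ 12 = ?w powi (- 4)"
        using Rep_uhp_nonzero[of \<tau>] by (simp add: power_int_minus divide_simps power_add[symmetric])
      finally show "phi_4_2 ?S (inverse (of_int 1 * ?w + of_int 0) *s z) =
          (of_int 1 * ?w + of_int 0) powi (- 4) *
          exp (of_nat 2 * pi * \<i> * (of_int 1 * cdot z z / (of_int 1 * ?w + of_int 0))) * phi_4_2 \<tau> z"
        using e2 by (simp add: mult.assoc)
    qed
  qed
qed

section \<open>Polynomials over a subring\<close>

lemma poly_mapping_sum_single:
  "(\<Sum>m\<in>Poly_Mapping.keys r. Poly_Mapping.single m (Poly_Mapping.lookup r m)) = r"
  by (rule poly_mapping_eqI)
    (auto simp: lookup_sum lookup_single when_def in_keys_iff sum.delta' cong: if_cong)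

lemma lookup_times_sum:
  fixes p q :: "'m::comm_monoid_add \<Rightarrow>\<^sub>0 'a::comm_semiring_1"
  shows "Poly_Mapping.lookup (p * q) k =
    (\<Sum>m\<in>Poly_Mapping.keys p. \<Sum>m'\<in>Poly_Mapping.keys q.
       if m + m' = k then Poly_Mapping.lookup p m * Poly_Mapping.lookup q m' else 0)"
proof -
  have "p * q = (\<Sum>m\<in>Poly_Mapping.keys p. \<Sum>m'\<in>Poly_Mapping.keys q.
      Poly_Mapping.single (m + m') (Poly_Mapping.lookup p m * Poly_Mapping.lookup q m'))"
    by (subst poly_mapping_sum_single[of p, symmetric], subst poly_mapping_sum_single[of q, symmetric])
      (simp add: sum_product mult_single)
  then show ?thesis
    by (simp add: lookup_sum lookup_single when_def)
qed

definition monomial_value :: "('a \<Rightarrow>\<^sub>0 nat) \<Rightarrow> 'a::comm_ring_1" where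
  "monomial_value m = (\<Prod>s\<in>Poly_Mapping.keys m. s ^ Poly_Mapping.lookup m s)"

lemma monomial_value_superset:
  assumes "finite A" "Poly_Mapping.keys m \<subseteq> A"
  shows "monomial_value m = (\<Prod>s\<in>A. s ^ Poly_Mapping.lookup m s)"
  unfolding monomial_value_def
  by (rule prod.mono_neutral_left) (use assms in \<open>auto simp: in_keys_iff\<close>)

lemma monomial_value_add: "monomial_value (m + m') = monomial_value m * monomial_value m'"
proof -
  let ?A = "Poly_Mapping.keys m \<union> Poly_Mapping.keys m'"
  have "Poly_Mapping.keys (m + m') \<subseteq> ?A"
    by (rule keys_add)
  then show ?thesis
    by (simp add: monomial_value_superset[of ?A] lookup_add power_add prod.distrib)
qed

lemma poly_value_superset:
  assumes "finite A" "Poly_Mapping.keys p \<subseteq> A"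
  shows "poly_value p = (\<Sum>m\<in>A. Poly_Mapping.lookup p m * monomial_value m)"
  unfolding poly_value_def monomial_value_def
  by (rule sum.mono_neutral_left) (use assms in \<open>auto simp: in_keys_iff\<close>)

lemma poly_value_add: "poly_value (p + q) = poly_value p + poly_value q"
proof -
  let ?A = "Poly_Mapping.keys p \<union> Poly_Mapping.keys q"
  have "Poly_Mapping.keys (p + q) \<subseteq> ?A"
    by (rule keys_add)
  then show ?thesis
    by (simp add: poly_value_superset[of ?A] lookup_add distrib_right sum.distrib)
qed

lemma poly_value_zero: "poly_value 0 = 0"
  by (simp add: poly_value_def)

lemma poly_value_diff: "poly_value (p - q) = poly_value p - poly_value q"
  by (metis add_diff_cancel diff_add_cancel poly_value_add)

lemma poly_value_sum: "poly_value (sum f A) = (\<Sum>a\<in>A. poly_value (f a))"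
  by (induction A rule: infinite_finite_induct) (auto simp: poly_value_add poly_value_zero)

lemma poly_value_single: "poly_value (Poly_Mapping.single m c) = c * monomial_value m"
  by (simp add: poly_value_superset[of "{m}"] lookup_single)

lemma poly_value_mult: "poly_value (p * q) = poly_value p * poly_value q"
proof -
  have "p * q = (\<Sum>m\<in>Poly_Mapping.keys p. \<Sum>m'\<in>Poly_Mapping.keys q.
      Poly_Mapping.single (m + m') (Poly_Mapping.lookup p m * Poly_Mapping.lookup q m'))"
    by (subst poly_mapping_sum_single[of p, symmetric], subst poly_mapping_sum_single[of q, symmetric])
      (simp add: sum_product mult_single)
  also have "poly_value \<dots> = poly_value p * poly_value q"
    by (simp add: poly_value_sum poly_value_single monomial_value_add poly_value_superset[OF finite_keys order_refl, of p]
        poly_value_superset[OF finite_keys order_refl, of q]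
        sum_product mult_ac)
  finally show ?thesis .
qed

lemma polys_over_diff:
  assumes "\<And>a b. a \<in> M \<Longrightarrow> b \<in> M \<Longrightarrow> a - b \<in> M"
    and "p \<in> polys_over M S" "q \<in> polys_over M S"
  shows "p - q \<in> polys_over M S"
  using assms keys_diff[of p q] unfolding polys_over_def by (auto simp: lookup_minus) blast

lemma polys_over_mult:
  assumes add: "\<And>a b. a \<in> M \<Longrightarrow> b \<in> M \<Longrightarrow> a + b \<in> M" and "0 \<in> M"
    and mult: "\<And>a b. a \<in> M \<Longrightarrow> b \<in> M \<Longrightarrow> a * b \<in> M"
    and p: "p \<in> polys_over M S" and q: "q \<in> polys_over M S"
  shows "p * q \<in> polys_over M S"
proof -
  have sum: "sum f A \<in> M" if "\<And>a. a \<in> A \<Longrightarrow> f a \<in> M" for f and A :: "'c set"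
    using that by (induction A rule: infinite_finite_induct) (auto simp: add \<open>0 \<in> M\<close>)
  have "Poly_Mapping.lookup (p * q) m \<in> M" for m
    unfolding lookup_times_sum using p q by (auto intro!: sum simp: polys_over_def \<open>0 \<in> M\<close> mult)
  moreover have "Poly_Mapping.keys m \<subseteq> S" if m: "m \<in> Poly_Mapping.keys (p * q)" for m
  proof -
    obtain a b where "m = a + b" "a \<in> Poly_Mapping.keys p" "b \<in> Poly_Mapping.keys q"
      using m keys_mult[of p q] by blast
    then show ?thesis
      using p q keys_add[of a b] unfolding polys_over_def by blast
  qed
  ultimately show ?thesis
    by (auto simp: polys_over_def)
qed

lemma polys_over_single:
  assumes "c \<in> M" "0 \<in> M" "Poly_Mapping.keys m \<subseteq> S"
  shows "Poly_Mapping.single m c \<in> polys_over M S"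
  using assms by (auto simp: polys_over_def lookup_single when_def)

text \<open>Strict convexity of the sum of squares makes a monomial that maximises it an extreme
  point of the support, so its square arises in only one way.\<close>

lemma extreme_monomial:
  fixes K :: "('a \<Rightarrow>\<^sub>0 nat) set"
  assumes "finite K" "K \<noteq> {}"
  obtains m where "m \<in> K" "\<And>a b. a \<in> K \<Longrightarrow> b \<in> K \<Longrightarrow> a + b = m + m \<Longrightarrow> a = m \<and> b = m"
proof -
  define A where "A = (\<Union>m\<in>K. Poly_Mapping.keys m)"
  have A: "finite A"
    using assms by (simp add: A_def)
  define N where "N m = (\<Sum>s\<in>A. (int (Poly_Mapping.lookup m s))\<^sup>2)" for m
  have "Max (N ` K) \<in> N ` K"
    using assms by (intro Max_in) auto
  then obtain m where m1: "m \<in> K" "N m = Max (N ` K)"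
    by force
  have m: "m \<in> K" "\<And>a. a \<in> K \<Longrightarrow> N a \<le> N m"
    using m1 assms by simp_all
  show ?thesis
  proof (rule that[OF m(1)])
    fix a b assume ab: "a \<in> K" "b \<in> K" "a + b = m + m"
    have *: "Poly_Mapping.lookup a s + Poly_Mapping.lookup b s = 2 * Poly_Mapping.lookup m s" for s
      using arg_cong[OF ab(3), of "\<lambda>x. Poly_Mapping.lookup x s"] by (simp add: lookup_add)
    \<comment> \<open>The parallelogram identity under a + b = 2 m. After summation over
      \<open>A\<close>, maximality of \<open>m\<close> leaves no room for the squared
      differences.\<close>
    have "2 * (int (Poly_Mapping.lookup a s))\<^sup>2 + 2 * (int (Poly_Mapping.lookup b s))\<^sup>2 =
      4 * (int (Poly_Mapping.lookup m s))\<^sup>2 +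
      (int (Poly_Mapping.lookup a s) - int (Poly_Mapping.lookup b s))\<^sup>2" for s
    proof -
      have "int (Poly_Mapping.lookup a s) = 2 * int (Poly_Mapping.lookup m s) - int (Poly_Mapping.lookup b s)"
        using *[of s] by linarith
      then show ?thesis
        by (simp only:) (simp add: power2_eq_square algebra_simps)
    qed
    then have "2 * N a + 2 * N b = 4 * N m +
      (\<Sum>s\<in>A. (int (Poly_Mapping.lookup a s) - int (Poly_Mapping.lookup b s))\<^sup>2)"
      by (simp add: N_def sum_distrib_left flip: sum.distrib)
    then have "(\<Sum>s\<in>A. (int (Poly_Mapping.lookup a s) - int (Poly_Mapping.lookup b s))\<^sup>2) \<le> 0"
      using m(2)[OF ab(1)] m(2)[OF ab(2)] by linarith
    then have "\<forall>s\<in>A. (int (Poly_Mapping.lookup a s) - int (Poly_Mapping.lookup b s))\<^sup>2 = 0"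
      using A by (metis (no_types, lifting) antisym sum_nonneg sum_nonneg_eq_0_iff zero_le_power2)
    then have "Poly_Mapping.lookup a s = Poly_Mapping.lookup b s" if "s \<in> A" for s
      using that by simp
    moreover have "Poly_Mapping.lookup a s = 0 \<and> Poly_Mapping.lookup b s = 0" if "s \<notin> A" for s
      using that ab(1,2) by (auto simp: A_def in_keys_iff)
    ultimately have eq: "Poly_Mapping.lookup a s = Poly_Mapping.lookup b s" for s
      by metis
    have "Poly_Mapping.lookup a s = Poly_Mapping.lookup m s" for s
      using *[of s] eq[of s] by linarith
    then show "a = m \<and> b = m"
      using eq by (metis poly_mapping_eqI)
  qed
qed

text \<open>Reducedness of a polynomial ring over an integral domain, phrased through a homomorphism
  \<open>e\<close> defined on the coefficients only.\<close>

lemma coefficients_of_square: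
  fixes e :: "'a::comm_ring_1 \<Rightarrow> complex" and p :: "('b \<Rightarrow>\<^sub>0 nat) \<Rightarrow>\<^sub>0 'a"
  assumes add: "\<And>a b. e (a + b) = e a + e b"
    and mult: "\<And>a b. a \<in> M \<Longrightarrow> b \<in> M \<Longrightarrow> e (a * b) = e a * e b"
    and p: "\<And>m. Poly_Mapping.lookup p m \<in> M"
    and square: "\<And>m. e (Poly_Mapping.lookup (p * p) m) = 0"
  shows "e (Poly_Mapping.lookup p m) = 0"
proof (rule ccontr)
  assume m: "e (Poly_Mapping.lookup p m) \<noteq> 0"
  have e0: "e 0 = 0"
    using add[of 0 0] by simp
  have e_sum: "e (sum f A) = (\<Sum>a\<in>A. e (f a))" for f and A :: "('b \<Rightarrow>\<^sub>0 nat) set"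
    by (induction A rule: infinite_finite_induct) (auto simp: add e0)
  \<comment> \<open>The support of \<open>p\<close> as seen by \<open>e\<close>. Products with a
    factor outside it vanish, so extremality is needed only within \<open>K\<close>.\<close>
  define K where "K = {m. e (Poly_Mapping.lookup p m) \<noteq> 0}"
  have K: "K \<subseteq> Poly_Mapping.keys p"
    using e0 by (auto simp: K_def in_keys_iff)
  then have 1: "finite K"
    by (rule finite_subset) simp
  have 2: "K \<noteq> {}"
    using m by (auto simp: K_def)
  obtain k where k: "k \<in> K"
    "\<And>a b. a \<in> K \<Longrightarrow> b \<in> K \<Longrightarrow> a + b = k + k \<Longrightarrow> a = k \<and> b = k"
    by (rule extreme_monomial[OF 1 2]) (rule that)
  have "0 = e (Poly_Mapping.lookup (p * p) (k + k))"
    by (simp add: square)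
  also have "\<dots> = (\<Sum>a\<in>Poly_Mapping.keys p. \<Sum>b\<in>Poly_Mapping.keys p.
      if a + b = k + k then e (Poly_Mapping.lookup p a) * e (Poly_Mapping.lookup p b) else 0)"
    unfolding lookup_times_sum e_sum by (intro sum.cong refl) (auto simp: mult p e0)
  also have "\<dots> = (\<Sum>a\<in>Poly_Mapping.keys p. \<Sum>b\<in>Poly_Mapping.keys p.
      if a = k \<and> b = k then e (Poly_Mapping.lookup p a) * e (Poly_Mapping.lookup p b) else 0)"
    using k by (intro sum.cong refl) (auto simp: K_def)
  also have "\<dots> = (\<Sum>a\<in>Poly_Mapping.keys p. if a = k then (\<Sum>b\<in>Poly_Mapping.keys p.
      if b = k then e (Poly_Mapping.lookup p a) * e (Poly_Mapping.lookup p b) else 0) else 0)"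
    by (intro sum.cong refl) auto
  also have "\<dots> = (e (Poly_Mapping.lookup p k))\<^sup>2"
    using k(1) K by (auto simp: sum.delta' power2_eq_square)
  finally show False
    using k(1) by (simp add: K_def)
qed

section \<open>The ring of weak Jacobi forms\<close>

lemma weak_jacobi_form_zero: "weak_jacobi_form k t 0"
proof -
  have f: "jacobi_expansion (\<lambda>n l. 0) 0"
    by (simp add: jacobi_expansion_def case_prod_unfold)
  show ?thesis
    by (rule weak_jacobi_formI[OF jacobi_expansion_holomorphic[OF f] f]) (simp_all add: jacobi_law_def)
qed

lemma single_in_weak_jacobi_ring:
  assumes "weak_jacobi_form k t \<phi>"
  shows "Poly_Mapping.single (k, t) \<phi> \<in> weak_jacobi_ring"
  using assms weak_jacobi_form_zero by (auto simp: weak_jacobi_ring_def lookup_single when_def)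

lemma single_in_modular_ring:
  assumes "modular_form k f"
  shows "Poly_Mapping.single (k, 0) (\<lambda>\<tau> z. f \<tau>) \<in> modular_ring"
proof -
  have "\<exists>g. modular_form k' g \<and> Poly_Mapping.lookup (Poly_Mapping.single (k, 0) (\<lambda>\<tau> z. f \<tau>)) (k', 0) = (\<lambda>\<tau> z :: complex^8. g \<tau>)" for k'
  proof (cases "k' = k")
    case True
    then show ?thesis
      using assms by auto
  next
    case False
    then show ?thesis
      using modular_form_zero[of k'] by (intro exI[of _ "\<lambda>\<tau>. 0"]) (auto simp: lookup_single when_def fun_eq_iff)
  qed
  then show ?thesis
    by (auto simp: modular_ring_def lookup_single when_def)
qed

lemma modular_ring_index:
  assumes "F \<in> modular_ring" "t \<noteq> 0"
  shows "Poly_Mapping.lookup F (k, t) = 0"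
  using assms by (simp add: modular_ring_def)

lemma modular_ring_weight:
  assumes "F \<in> modular_ring" "k < 0"
  shows "Poly_Mapping.lookup F (k, t) = 0"
proof (cases "t = 0")
  case True
  obtain f where f: "modular_form k f" "Poly_Mapping.lookup F (k, 0) = (\<lambda>\<tau> z. f \<tau>)"
    using assms(1) unfolding modular_ring_def by blast
  then show ?thesis
    using modular_form_negative_weight[OF f(1) assms(2)] True by (simp add: fun_eq_iff)
qed (use modular_ring_index[OF assms(1)] in simp)

text \<open>The homogeneous pieces of \<open>modular_ring\<close>: its closure properties reduce to
  those of modular forms of a fixed weight.\<close>

definition modular_space :: "int \<Rightarrow> (uhp \<Rightarrow> complex^8 \<Rightarrow> complex) set" where
  "modular_space k = {\<phi>. \<exists>f. modular_form k f \<and> \<phi> = (\<lambda>\<tau> z. f \<tau>)}"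

lemma modular_ring_iff:
  "F \<in> modular_ring \<longleftrightarrow> (\<forall>k. Poly_Mapping.lookup F (k, 0) \<in> modular_space k) \<and>
    (\<forall>k t. t \<noteq> 0 \<longrightarrow> Poly_Mapping.lookup F (k, t) = 0)"
  unfolding modular_ring_def modular_space_def by simp

lemma modular_space_zero: "0 \<in> modular_space k"
  using modular_form_zero[of k] by (auto simp: modular_space_def fun_eq_iff intro!: exI[of _ "\<lambda>\<tau>. 0"])

lemma modular_space_add: "\<phi> \<in> modular_space k \<Longrightarrow> \<psi> \<in> modular_space k \<Longrightarrow> \<phi> + \<psi> \<in> modular_space k"
  using modular_form_add by (fastforce simp: modular_space_def fun_eq_iff)

lemma modular_space_diff: "\<phi> \<in> modular_space k \<Longrightarrow> \<psi> \<in> modular_space k \<Longrightarrow> \<phi> - \<psi> \<in> modular_space k"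
  using modular_form_add[OF _ modular_form_cmult[of k _ "-1"]] by (fastforce simp: modular_space_def fun_eq_iff)

lemma modular_space_mult: "\<phi> \<in> modular_space k \<Longrightarrow> \<psi> \<in> modular_space m \<Longrightarrow> \<phi> * \<psi> \<in> modular_space (k + m)"
  using modular_form_mult by (fastforce simp: modular_space_def fun_eq_iff)

lemma modular_space_sum:
  "(\<And>a. a \<in> A \<Longrightarrow> f a \<in> modular_space k) \<Longrightarrow> sum f A \<in> modular_space k"
  by (induction A rule: infinite_finite_induct) (auto simp: modular_space_zero modular_space_add)

lemma modular_ring_add: "F \<in> modular_ring \<Longrightarrow> G \<in> modular_ring \<Longrightarrow> F + G \<in> modular_ring"
  by (simp add: modular_ring_iff lookup_add modular_space_add)

lemma modular_ring_diff: "F \<in> modular_ring \<Longrightarrow> G \<in> modular_ring \<Longrightarrow> F - G \<in> modular_ring"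
  by (simp add: modular_ring_iff lookup_minus modular_space_diff)

lemma modular_ring_zero: "0 \<in> modular_ring"
  by (simp add: modular_ring_iff modular_space_zero)

lemma modular_ring_one: "1 \<in> modular_ring"
proof -
  have "(1 :: graded_fun) = Poly_Mapping.single (0, 0) (\<lambda>\<tau> z. 1)"
    by (rule poly_mapping_eqI) (auto simp: lookup_one lookup_single when_def zero_prod_def fun_eq_iff)
  then show ?thesis
    using single_in_modular_ring[OF modular_form_one] by simp
qed

lemma modular_ring_mult:
  assumes F: "F \<in> modular_ring" and G: "G \<in> modular_ring"
  shows "F * G \<in> modular_ring"
  unfolding modular_ring_iff
proof (intro conjI allI impI)
  fix k
  show "Poly_Mapping.lookup (F * G) (k, 0) \<in> modular_space k"
    unfolding lookup_times_sum
  proof (intro modular_space_sum)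
    fix a b :: "int \<times> nat"
    show "(if a + b = (k, 0) then Poly_Mapping.lookup F a * Poly_Mapping.lookup G b else 0) \<in> modular_space k"
    proof (cases "a + b = (k, 0)")
      case True
      then have ab: "a = (fst a, 0)" "b = (fst b, 0)" "k = fst a + fst b"
        by (auto simp: prod_eq_iff)
      have "Poly_Mapping.lookup F (fst a, 0) * Poly_Mapping.lookup G (fst b, 0) \<in> modular_space (fst a + fst b)"
        using F G by (intro modular_space_mult) (simp_all add: modular_ring_iff)
      then show ?thesis
        using True ab by metis
    qed (simp add: modular_space_zero)
  qed
next
  fix k :: int and t :: nat assume "t \<noteq> 0"
  show "Poly_Mapping.lookup (F * G) (k, t) = 0"
    unfolding lookup_times_sum
  proof (intro sum.neutral ballI)
    fix a b :: "int \<times> nat"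
    have "snd a \<noteq> 0 \<or> snd b \<noteq> 0" if "a + b = (k, t)"
      using that \<open>t \<noteq> 0\<close> by (auto simp: prod_eq_iff)
    then show "(if a + b = (k, t) then Poly_Mapping.lookup F a * Poly_Mapping.lookup G b else 0) = 0"
      using modular_ring_index[OF F, of "snd a" "fst a"] modular_ring_index[OF G, of "snd b" "fst b"] by auto
  qed
qed

text \<open>Weights in \<open>modular_ring\<close> are nonnegative, so 0 splits only as 0 + 0. This
  makes the weight 0 component multiplicative, that is, a reduction modulo forms of positive
  weight.\<close>

lemma lookup_mult_weight_0:
  assumes F: "F \<in> modular_ring" and G: "G \<in> modular_ring"
  shows "Poly_Mapping.lookup (F * G) (0, 0) = Poly_Mapping.lookup F (0, 0) * Poly_Mapping.lookup G (0, 0)"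
proof -
  have "Poly_Mapping.lookup (F * G) (0, 0) = (\<Sum>a\<in>Poly_Mapping.keys F. \<Sum>b\<in>Poly_Mapping.keys G.
      if a = (0, 0) then if b = (0, 0) then Poly_Mapping.lookup F a * Poly_Mapping.lookup G b else 0 else 0)"
    unfolding lookup_times_sum
  proof (intro sum.cong HOL.refl)
    fix a b :: "int \<times> nat"
    assume ab: "a \<in> Poly_Mapping.keys F" "b \<in> Poly_Mapping.keys G"
    have nonneg: "fst a \<ge> 0" "fst b \<ge> 0"
      using ab modular_ring_weight[OF F, of "fst a" "snd a"] modular_ring_weight[OF G, of "fst b" "snd b"]
      by (auto simp: in_keys_iff not_less[symmetric])
    have "a + b = (0, 0) \<longleftrightarrow> a = (0, 0) \<and> b = (0, 0)"
      using nonneg by (auto simp: prod_eq_iff)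
    then show "(if a + b = (0, 0) then Poly_Mapping.lookup F a * Poly_Mapping.lookup G b else 0) =
        (if a = (0, 0) then if b = (0, 0) then Poly_Mapping.lookup F a * Poly_Mapping.lookup G b else 0 else 0)"
      by auto
  qed
  also have "\<dots> = (\<Sum>a\<in>Poly_Mapping.keys F. if a = (0, 0) then \<Sum>b\<in>Poly_Mapping.keys G.
      if b = (0, 0) then Poly_Mapping.lookup F a * Poly_Mapping.lookup G b else 0 else 0)"
    by (intro sum.cong HOL.refl) auto
  also have "\<dots> = Poly_Mapping.lookup F (0, 0) * Poly_Mapping.lookup G (0, 0)"
    by (auto simp: sum.delta in_keys_iff)
  finally show ?thesis .
qed

lemma lookup_single_0_mult:
  fixes p :: "'m::comm_monoid_add \<Rightarrow>\<^sub>0 'a::comm_semiring_1"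
  shows "Poly_Mapping.lookup (Poly_Mapping.single 0 c * p) m = c * Poly_Mapping.lookup p m"
proof (cases "c = 0")
  case False
  then have keys: "Poly_Mapping.keys (Poly_Mapping.single (0 :: 'm) c) = {0}"
    by simp
  show ?thesis
    unfolding lookup_times_sum keys by (auto simp: sum.delta in_keys_iff)
qed simp

lemma E8_theta_square_relation:
  "Poly_Mapping.single (4, 1) (\<lambda>\<tau>. E8_theta (Rep_uhp \<tau>)) * Poly_Mapping.single (4, 1) (\<lambda>\<tau>. E8_theta (Rep_uhp \<tau>)) =
    Poly_Mapping.single (4, 0) (\<lambda>\<tau> z. E4 \<tau>) * Poly_Mapping.single (4, 2) A2 +
    (Poly_Mapping.single (12, 0) (\<lambda>\<tau> z. discr \<tau>) * Poly_Mapping.single (- 4, 2) phi_4_2 :: graded_fun)"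
proof -
  have "(\<lambda>\<tau>. E8_theta (Rep_uhp \<tau>)) * (\<lambda>\<tau>. E8_theta (Rep_uhp \<tau>)) = (\<lambda>\<tau> z. E4 \<tau>) * A2 + (\<lambda>\<tau> z. discr \<tau>) * phi_4_2"
    by (simp add: fun_eq_iff phi_4_2_def discr_nonzero power2_eq_square)
  then show ?thesis
    by (simp add: mult_single flip: single_add)
qed

text \<open>Every component of \<open>c\<close> has index 0 and positive weight, so it reaches (4,
  1) only together with a component of \<open>X\<close> of index 1 and weight below 4.\<close>

lemma lookup_mult_index_1:
  assumes c: "c \<in> modular_ring" "Poly_Mapping.lookup c (0, 0) = 0" and X: "X \<in> weak_jacobi_ring"
  shows "Poly_Mapping.lookup (c * X) (4, 1) = 0"
  unfolding lookup_times_sum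
proof (intro sum.neutral ballI)
  fix a b :: "int \<times> nat"
  show "(if a + b = (4, 1) then Poly_Mapping.lookup c a * Poly_Mapping.lookup X b else 0) = 0"
  proof (cases "a + b = (4, 1) \<and> Poly_Mapping.lookup c a \<noteq> 0")
    case True
    have "snd a = 0"
      using True modular_ring_index[OF c(1), of "snd a" "fst a"] by auto
    moreover have "fst a > 0"
      using True modular_ring_weight[OF c(1), of "fst a" "snd a"] c(2) \<open>snd a = 0\<close>
      by (metis linorder_neqE_linordered_idom prod.collapse)
    ultimately have b: "b = (fst b, 1)" "fst b < 4"
      using True by (auto simp: prod_eq_iff)
    then have "weak_jacobi_form (fst b) 1 (Poly_Mapping.lookup X b)"
      using X unfolding weak_jacobi_ring_def by (metis (mono_tags, lifting) mem_Collect_eq)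
    then have "Poly_Mapping.lookup X b = 0"
      by (rule weak_jacobi_form_index_1_zero[OF _ b(2)])
    then show ?thesis
      by simp
  qed auto
qed

theorem theorem5p8:
  shows "\<not> (\<exists>S. S \<subseteq> weak_jacobi_ring \<and>
               algebraically_independent modular_ring S \<and>
               adjoin modular_ring S = weak_jacobi_ring)"
proof
  assume "\<exists>S. S \<subseteq> weak_jacobi_ring \<and> algebraically_independent modular_ring S \<and>
    adjoin modular_ring S = weak_jacobi_ring"
  then obtain S where indep: "algebraically_independent modular_ring S"
    and gen: "adjoin modular_ring S = weak_jacobi_ring"
    by blast
  define A :: graded_fun where "A = Poly_Mapping.single (4, 1) (\<lambda>\<tau>. E8_theta (Rep_uhp \<tau>))"
  define B :: graded_fun where "B = Poly_Mapping.single (4, 2) A2"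
  define P :: graded_fun where "P = Poly_Mapping.single (- 4, 2) phi_4_2"
  define E :: graded_fun where "E = Poly_Mapping.single (4, 0) (\<lambda>\<tau> z. E4 \<tau>)"
  define D :: graded_fun where "D = Poly_Mapping.single (12, 0) (\<lambda>\<tau> z. discr \<tau>)"
  have E: "E \<in> modular_ring" "Poly_Mapping.lookup E (0, 0) = 0"
    and D: "D \<in> modular_ring" "Poly_Mapping.lookup D (0, 0) = 0"
    by (auto simp: E_def D_def lookup_single intro!: single_in_modular_ring modular_form_E4 modular_form_discr)
  have "A \<in> weak_jacobi_ring" "B \<in> weak_jacobi_ring" "P \<in> weak_jacobi_ring"
    unfolding A_def B_def P_def
    by (intro single_in_weak_jacobi_ring weak_jacobi_form_E8_theta weak_jacobi_form_A2 weak_jacobi_form_phi_4_2)+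
  then obtain pA pB pP where A: "pA \<in> polys_over modular_ring S" "A = poly_value pA"
    and B: "pB \<in> polys_over modular_ring S" "B = poly_value pB"
    and P: "pP \<in> polys_over modular_ring S" "P = poly_value pP"
    unfolding gen[symmetric] adjoin_def by blast
  note ring = modular_ring_add modular_ring_zero modular_ring_mult
  \<comment> \<open>The relation lifted to polynomials. Its value is zero, so by independence the
    lift itself is zero.\<close>
  have "pA * pA - Poly_Mapping.single 0 E * pB - Poly_Mapping.single 0 D * pP \<in> polys_over modular_ring S"
    by (intro polys_over_diff[OF modular_ring_diff] polys_over_mult[OF ring] polys_over_single A B P E D modular_ring_zero) auto
  moreover have "poly_value (pA * pA - Poly_Mapping.single 0 E * pB - Poly_Mapping.single 0 D * pP) = 0"
    using E8_theta_square_relation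
    by (simp add: poly_value_diff poly_value_mult poly_value_single monomial_value_def flip: A B P)
      (simp add: A_def B_def P_def E_def D_def)
  ultimately have "pA * pA - Poly_Mapping.single 0 E * pB - Poly_Mapping.single 0 D * pP = 0"
    using indep unfolding algebraically_independent_def by blast
  then have square: "pA * pA = Poly_Mapping.single 0 E * pB + Poly_Mapping.single 0 D * pP"
    by (simp add: algebra_simps)
  have coeff: "Poly_Mapping.lookup p m \<in> modular_ring" if "p \<in> polys_over modular_ring S" for p m
    using that by (simp add: polys_over_def)
  \<comment> \<open>Evaluation at a fixed point makes the weight 0 component complex-valued. It
    kills \<open>E\<close> and \<open>D\<close>, hence every coefficient of the square.\<close>
  have "Poly_Mapping.lookup (Poly_Mapping.lookup pA m) (0, 0) \<tau> z = 0" for m \<tau> z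
  proof (rule coefficients_of_square[where M = modular_ring and e = "\<lambda>F. Poly_Mapping.lookup F (0, 0) \<tau> z"])
    show "Poly_Mapping.lookup (Poly_Mapping.lookup (pA * pA) m) (0, 0) \<tau> z = 0" for m
      unfolding square lookup_add lookup_single_0_mult
        lookup_mult_weight_0[OF E(1) coeff[OF B(1)]] lookup_mult_weight_0[OF D(1) coeff[OF P(1)]]
      by (simp add: E(2) D(2))
  qed (use coeff[OF A(1)] in \<open>auto simp: lookup_add lookup_mult_weight_0\<close>)
  then have c: "Poly_Mapping.lookup (Poly_Mapping.lookup pA m) (0, 0) = 0" for m
    by (simp add: fun_eq_iff)
  \<comment> \<open>A monomial in \<open>S\<close> is the value of a polynomial with coefficient 1,
    so the assumed equality with \<open>adjoin\<close> places it in the ring.\<close>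
  have X: "monomial_value m \<in> weak_jacobi_ring" if "m \<in> Poly_Mapping.keys pA" for m
  proof -
    have "Poly_Mapping.keys m \<subseteq> S"
      using A(1) that by (auto simp: polys_over_def)
    then have "Poly_Mapping.single m 1 \<in> polys_over modular_ring S"
      by (intro polys_over_single modular_ring_one modular_ring_zero)
    then have "poly_value (Poly_Mapping.single m 1) \<in> weak_jacobi_ring"
      unfolding gen[symmetric] adjoin_def by blast
    then show ?thesis
      by (simp add: poly_value_single)
  qed
  have "(\<lambda>\<tau>. E8_theta (Rep_uhp \<tau>)) = Poly_Mapping.lookup A (4, 1)"
    by (simp add: A_def)
  also have "A = (\<Sum>m\<in>Poly_Mapping.keys pA. Poly_Mapping.lookup pA m * monomial_value m)"
    unfolding A(2) by (rule poly_value_superset) auto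
  also have "Poly_Mapping.lookup \<dots> (4, 1) = 0"
    unfolding lookup_sum by (intro sum.neutral ballI lookup_mult_index_1 coeff[OF A(1)] c X)
  finally have "E8_theta (Rep_uhp \<tau>) z = 0" for \<tau> z
    by (simp add: fun_eq_iff)
  moreover obtain z where "E8_theta (Rep_uhp (Abs_uhp \<i>)) z \<noteq> 0"
    using E8_theta_not_identically_zero[OF Im_Rep_uhp] .
  ultimately show False
    by blast
qed

end
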